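(* Let $A$ be a unital C$^*$-algebra and let $u=(u_{pq})\in M_n(A)$ be such that (1) the $^*$-subalgebra $A_0$ of $A$ generated by the matrix elements $u_{pq}$ is dense in $A$, and (2) there exists a $^*$-homomorphism $\Phi:A\to A\otimes A$ with $\Phi(u_{pq})=\sum_k u_{pk}\otimes u_{kq}$ for all $p,q=1,\dots,n$. Then the following two conditions are equivalent. (3) There exists a linear antimultiplicative map $\kappa:A_0\to A_0$ such that $\kappa(\kappa(a^* )^* )=a$ for all $a\in A_0$, and $\sum_k\kappa(u_{pk})u_{kq}=\delta_{pq}1$ and $\sum_k u_{pk}\kappa(u_{kq})=\delta_{pq}1$ for all $p,q=1,\dots,n$. (3') The matrix $(u_{pq})$ and the transpose matrix $(u_{qp})$ are invertible in $M_n(A)$. In other words, the two definitions of a compact matrix quantum group, namely pairs $(A,u)$ satisfying (1), (2), (3), and pairs $(A,u)$ satisfying (1), (2), (3'), are equivalent.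
   Context: $A\otimes A$ denotes the minimal C$^*$-tensor product. Antimultiplicative means $\kappa(ab)=\kappa(b)\kappa(a)$. $\delta_{pq}$ is the Kronecker delta. *)

theory Defs
  imports "HOL-Analysis.Analysis"
begin

text \<open>
  Nonzero unital C*-algebras.  The parent classes provide a complete real normed algebra with
  \<open>norm 1 = 1\<close>; the complex structure is required to extend the real one.
\<close>

class unital_cstar_algebra = real_normed_algebra_1 + banach +
  fixes scaleC :: "complex \<Rightarrow> 'a \<Rightarrow> 'a"  (infixr "*\<^sub>C" 75)
    and star :: "'a \<Rightarrow> 'a"
  assumes scaleC_add_right: "c *\<^sub>C (x + y) = c *\<^sub>C x + c *\<^sub>C y"
    and scaleC_add_left: "(c + d) *\<^sub>C x = c *\<^sub>C x + d *\<^sub>C x"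
    and scaleC_scaleC: "c *\<^sub>C d *\<^sub>C x = (c * d) *\<^sub>C x"
    and scaleC_of_real: "complex_of_real r *\<^sub>C x = r *\<^sub>R x"
    and mult_scaleC_left: "(c *\<^sub>C x) * y = c *\<^sub>C (x * y)"
    and mult_scaleC_right: "x * (c *\<^sub>C y) = c *\<^sub>C (x * y)"
    and norm_scaleC: "norm (c *\<^sub>C x) = cmod c * norm x"
    and star_star: "star (star x) = x"
    and star_add: "star (x + y) = star x + star y"
    and star_scaleC: "star (c *\<^sub>C x) = cnj c *\<^sub>C star x"
    and star_mult: "star (x * y) = star y * star x"
    and cstar_identity: "norm (star x * x) = (norm x)\<^sup>2"

lemma vector_space_scaleC:
  "vector_space (scaleC :: complex \<Rightarrow> 'a \<Rightarrow> 'a::unital_cstar_algebra)"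
proof
  show "1 *\<^sub>C x = x" for x :: 'a
    using scaleC_of_real[of 1 x] by simp
qed (simp_all add: scaleC_add_right scaleC_add_left scaleC_scaleC)

global_interpretation cvec:
  vector_space "scaleC :: complex \<Rightarrow> 'a \<Rightarrow> 'a::unital_cstar_algebra"
  by (rule vector_space_scaleC)

abbreviation clinear :: "('a::unital_cstar_algebra \<Rightarrow> 'b::unital_cstar_algebra) \<Rightarrow> bool"
  where "clinear \<equiv> Vector_Spaces.linear scaleC scaleC"

definition star_hom :: "('a::unital_cstar_algebra \<Rightarrow> 'b::unital_cstar_algebra) \<Rightarrow> bool"
  where "star_hom f \<longleftrightarrow> clinear f \<and> (\<forall>a b. f (a * b) = f a * f b) \<and> (\<forall>a. f (star a) = star (f a))"

text \<open>As usual, *-subalgebras are not required to contain the unit, nor *-homomorphisms to preserve it.\<close>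

definition star_subalgebra :: "'a::unital_cstar_algebra set \<Rightarrow> bool"
  where "star_subalgebra S \<longleftrightarrow>
    cvec.subspace S \<and> (\<forall>a\<in>S. \<forall>b\<in>S. a * b \<in> S) \<and> (\<forall>a\<in>S. star a \<in> S)"

definition entry_algebra :: "'a::unital_cstar_algebra^'n^'m \<Rightarrow> 'a set"
  where "entry_algebra u = star_subalgebra hull {u $ p $ q | p q. True}"

definition state :: "('a::unital_cstar_algebra \<Rightarrow> complex) \<Rightarrow> bool"
  where "state \<phi> \<longleftrightarrow> Vector_Spaces.linear scaleC (*) \<phi> \<and> (\<forall>a. \<phi> (star a * a) \<in> \<real>\<^sub>\<ge>\<^sub>0) \<and> \<phi> 1 = 1"

text \<open>
  Elements of the algebraic tensor product are represented by lists of pairs, the list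
  \<open>[(a\<^sub>1, b\<^sub>1), \<dots>, (a\<^sub>m, b\<^sub>m)]\<close> standing for \<open>a\<^sub>1 \<otimes> b\<^sub>1 + \<dots> + a\<^sub>m \<otimes> b\<^sub>m\<close>.  Different lists may stand for
  the same tensor; everything below depends on the tensor only.
\<close>

definition alg_mult :: "('a::times \<times> 'b::times) list \<Rightarrow> ('a \<times> 'b) list \<Rightarrow> ('a \<times> 'b) list"
  where "alg_mult xs ys = [(a * c, b * d). (a, b) \<leftarrow> xs, (c, d) \<leftarrow> ys]"

definition alg_star ::
    "('a::unital_cstar_algebra \<times> 'b::unital_cstar_algebra) list \<Rightarrow> ('a \<times> 'b) list"
  where "alg_star xs = [(star a, star b). (a, b) \<leftarrow> xs]"

definition product_functional ::
    "('a \<Rightarrow> complex) \<Rightarrow> ('b \<Rightarrow> complex) \<Rightarrow> ('a \<times> 'b) list \<Rightarrow> complex"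
  where "product_functional \<phi> \<psi> xs = (\<Sum>(a, b)\<leftarrow>xs. \<phi> a * \<psi> b)"

text \<open>
  The minimal (spatial) C*-norm, as the operator norm in the tensor product of the universal
  representations: for states \<open>\<phi>\<close>, \<open>\<psi>\<close> with GNS triples \<open>(\<pi>\<^sub>\<phi>, H\<^sub>\<phi>, \<xi>\<^sub>\<phi>)\<close> and \<open>(\<pi>\<^sub>\<psi>, H\<^sub>\<psi>, \<xi>\<^sub>\<psi>)\<close>, the vectors
  \<open>\<eta> = (\<pi>\<^sub>\<phi> \<otimes> \<pi>\<^sub>\<psi>)(y) (\<xi>\<^sub>\<phi> \<otimes> \<xi>\<^sub>\<psi>)\<close> with \<open>y\<close> in the algebraic tensor product are dense in \<open>H\<^sub>\<phi> \<otimes> H\<^sub>\<psi>\<close>, and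
  \<open>\<parallel>\<eta>\<parallel>\<^sup>2 = (\<phi> \<otimes> \<psi>)(y* y)\<close>, \<open>\<parallel>(\<pi>\<^sub>\<phi> \<otimes> \<pi>\<^sub>\<psi>)(x) \<eta>\<parallel>\<^sup>2 = (\<phi> \<otimes> \<psi>)((x y)* (x y))\<close>.  So the set below consists of
  the numbers \<open>\<parallel>(\<pi>\<^sub>\<phi> \<otimes> \<pi>\<^sub>\<psi>)(x) \<eta>\<parallel>\<close> for unit vectors \<open>\<eta>\<close> of this form.  It is bounded by the sum of
  the \<open>\<parallel>a\<parallel> \<parallel>b\<parallel>\<close> over the pairs \<open>(a, b)\<close> in \<open>x\<close>.
\<close>

definition spatial_norm ::
    "('a::unital_cstar_algebra \<times> 'b::unital_cstar_algebra) list \<Rightarrow> real"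
  where "spatial_norm x = Sup {sqrt (Re (product_functional \<phi> \<psi>
              (alg_mult (alg_star (alg_mult x y)) (alg_mult x y)))) | \<phi> \<psi> y.
            state \<phi> \<and> state \<psi> \<and> product_functional \<phi> \<psi> (alg_mult (alg_star y) y) = 1}"

text \<open>
  The C*-algebra \<open>'c\<close> with the map \<open>tens\<close>, written \<open>(a, b) \<mapsto> a \<otimes> b\<close>, is the completion of the algebraic
  tensor product of \<open>'a\<close> and \<open>'b\<close> in the minimal C*-norm.  This determines \<open>'c\<close> and \<open>tens\<close> up to
  isomorphism.  Injectivity of the algebraic tensor product into \<open>'c\<close> follows from the norm
  condition, since \<open>spatial_norm\<close> vanishes only on lists representing \<open>0\<close>.
\<close>

definition minimal_tensor_product ::
    "('a::unital_cstar_algebra \<Rightarrow> 'b::unital_cstar_algebra \<Rightarrow> 'c::unital_cstar_algebra) \<Rightarrow> bool"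
  where "minimal_tensor_product tens \<longleftrightarrow>
    (\<forall>b. clinear (\<lambda>a. tens a b)) \<and> (\<forall>a. clinear (tens a)) \<and>
    (\<forall>a b c d. tens a b * tens c d = tens (a * c) (b * d)) \<and>
    (\<forall>a b. star (tens a b) = tens (star a) (star b)) \<and>
    (\<forall>xs. norm (\<Sum>(a, b)\<leftarrow>xs. tens a b) = spatial_norm xs) \<and>
    closure (cvec.span {tens a b | a b. True}) = UNIV"

definition clinear_on ::
    "'a::unital_cstar_algebra set \<Rightarrow> ('a \<Rightarrow> 'b::unital_cstar_algebra) \<Rightarrow> bool"
  where "clinear_on S f \<longleftrightarrow>
    (\<forall>a\<in>S. \<forall>b\<in>S. f (a + b) = f a + f b) \<and> (\<forall>c. \<forall>a\<in>S. f (c *\<^sub>C a) = c *\<^sub>C f a)"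

end

(*
  From (3') to (3): convolution powers of states have an invariant cluster point, and Van Daele's
  argument turns this into a Haar state h on the *-algebra generated by u; only the invertibility of
  the transpose is needed in place of density relations. For a corepresentation w with inverse v the
  matrix Q = h(w* w) is positive definite and satisfies w* Q w = Q, so v has entries in that algebra.
  The space of matrices h(b w) absorbs multiplication by Q^{-1} y* Q for its own elements y, which
  forces it to contain the identity: the counit is h(b . ) for some b. By right invariance
  v_im = (h (x) id)(Delta(b) (w_im (x) 1)), so a linear relation between the w_im is inherited by the
  v_im, and w_im |-> v_im is a well-defined antipode. Product states, needed for convolution, come from
  the spatial norm via Hahn-Banach; that norm-one unital functionals are positive rests on the
  positivity of a* a (Kelley--Vaught), proved without functional calculus.
*)

theory Submission
  imports Defs "HOL-Library.Function_Algebras"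
begin

section \<open>The order of a C*-algebra\<close>

text \<open>Two difficulties shape the development. The Haar state is not known to be faithful, so
  nothing may be deduced from h(a* a) = 0 for an arbitrary a; its place is taken by the
  invertibility of w, which makes the scalar matrix Q definite. And the antipode cannot be defined
  as a map before linear relations are known to be respected; it is therefore carried as a relation
  between combinations of the w_ij and of the v_ij, for which sums, products and adjoints come from
  direct sums, tensor products and conjugates of corepresentations. Conjugation exchanges the
  inverse of w with the inverse of its transpose, so the two are carried together. Homomorphisms
  need not preserve units; that the comultiplication fixes 1 is drawn from the invertibility of u.
  In the converse direction the involutivity condition makes a -> star (kappa (star a)) the inverse
  of kappa, and applying it to the relations for kappa(u) inverts the transpose.\<close>

lemma star_zero [simp]: "star (0 :: 'a::unital_cstar_algebra) = 0"
proof -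
  have "star (0 :: 'a) + star 0 = star 0"
    by (metis star_add add_0)
  then show ?thesis by simp
qed

lemma star_minus [simp]: "star (- x) = - star (x :: 'a::unital_cstar_algebra)"
  by (metis star_add star_zero add.right_inverse add_eq_0_iff)

lemma star_diff: "star (x - y) = star x - star (y :: 'a::unital_cstar_algebra)"
  by (metis star_add star_minus diff_conv_add_uminus)

lemma star_one [simp]: "star (1 :: 'a::unital_cstar_algebra) = 1"
  by (metis mult.right_neutral star_mult star_star)

lemma star_scaleR [simp]: "star (r *\<^sub>R x) = r *\<^sub>R star (x :: 'a::unital_cstar_algebra)"
  by (metis complex_cnj_complex_of_real scaleC_of_real star_scaleC)

lemma star_sum: "star (sum f A) = (\<Sum>i\<in>A. star (f i :: 'a::unital_cstar_algebra))"
  by (induction A rule: infinite_finite_induct) (auto simp: star_add)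

lemma norm_star [simp]: "norm (star x) = norm (x :: 'a::unital_cstar_algebra)"
proof -
  have le: "norm y \<le> norm (star y)" for y :: 'a
  proof (cases "y = 0")
    case False
    have "norm y * norm y \<le> norm (star y) * norm y"
      using cstar_identity[of y] norm_mult_ineq[of "star y" y] by (simp add: power2_eq_square)
    with False show ?thesis by simp
  qed simp
  show ?thesis using le[of x] le[of "star x"] by (simp add: star_star)
qed

lemma star_eq_iff: "star x = y \<longleftrightarrow> x = star (y :: 'a::unital_cstar_algebra)"
  by (metis star_star)

lemma norm_square_self_adjoint:
  "star h = h \<Longrightarrow> norm (h * h) = (norm (h :: 'a::unital_cstar_algebra))\<^sup>2"
  by (metis cstar_identity)

lemma self_adjoint_square_eq_0: "star h = h \<Longrightarrow> h * h = 0 \<Longrightarrow> (h :: 'a::unital_cstar_algebra) = 0"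
  by (metis norm_square_self_adjoint norm_eq_zero power_eq_0_iff zero_neq_numeral)

lemma cstar_eq_0: "star x * x = 0 \<Longrightarrow> (x :: 'a::unital_cstar_algebra) = 0"
  by (metis cstar_identity norm_eq_zero power_eq_0_iff zero_neq_numeral)

lemma scaleR_conv_scaleC: "r *\<^sub>R x = complex_of_real r *\<^sub>C (x :: 'a::unital_cstar_algebra)"
  by (simp add: scaleC_of_real)

lemma scaleC_one [simp]: "1 *\<^sub>C x = (x :: 'a::unital_cstar_algebra)"
  using scaleC_of_real[of 1 x] by simp

lemma scaleC_minus_one: "(-1) *\<^sub>C x = - (x :: 'a::unital_cstar_algebra)"
  using scaleC_of_real[of "-1" x] by simp

lemma scaleC_zero_left [simp]: "0 *\<^sub>C x = (0 :: 'a::unital_cstar_algebra)"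
  using scaleC_of_real[of 0 x] by simp

lemma scaleC_zero_right [simp]: "c *\<^sub>C 0 = (0 :: 'a::unital_cstar_algebra)"
  by (metis scaleC_add_right add_0 add_cancel_right_right)

lemma scaleC_minus_right: "c *\<^sub>C (- x) = - (c *\<^sub>C (x :: 'a::unital_cstar_algebra))"
  by (metis scaleC_scaleC scaleC_minus_one mult.commute)

lemma scaleC_diff_right: "c *\<^sub>C (x - y) = c *\<^sub>C x - c *\<^sub>C (y :: 'a::unital_cstar_algebra)"
  by (metis scaleC_add_right scaleC_minus_right diff_conv_add_uminus)

lemma scaleC_sum_right: "c *\<^sub>C sum f A = (\<Sum>i\<in>A. c *\<^sub>C (f i :: 'a::unital_cstar_algebra))"
  by (induction A rule: infinite_finite_induct) (auto simp: scaleC_add_right)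

lemma scaleC_sum_left: "sum f A *\<^sub>C x = (\<Sum>i\<in>A. f i *\<^sub>C (x :: 'a::unital_cstar_algebra))"
  by (induction A rule: infinite_finite_induct) (auto simp: scaleC_add_left)

text \<open>
  The iteration \<open>y \<mapsto> (x + y\<^sup>2) / 2\<close> converges to \<open>1 - \<surd>(1 - x)\<close>: it is dominated in norm by the same
  iteration for the number \<open>x = 1\<close>.
\<close>

primrec sqrt_iter :: "'a::real_normed_algebra_1 \<Rightarrow> nat \<Rightarrow> 'a" where
  "sqrt_iter x 0 = 0"
| "sqrt_iter x (Suc n) = (1/2) *\<^sub>R (x + sqrt_iter x n * sqrt_iter x n)"

lemma sqrt_iter_commute: "z * x = x * z \<Longrightarrow> z * sqrt_iter x n = sqrt_iter x n * z"
proof (induction n)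
  case (Suc n)
  then have "z * (sqrt_iter x n * sqrt_iter x n) = (sqrt_iter x n * sqrt_iter x n) * z"
    by (metis mult.assoc)
  with Suc show ?case by (simp add: distrib_left distrib_right)
qed simp

lemma sqrt_iter_real: "0 \<le> sqrt_iter (1::real) n \<and> sqrt_iter (1::real) n \<le> 1
    \<and> sqrt_iter (1::real) n \<le> sqrt_iter 1 (Suc n)"
proof (induction n)
  case (Suc n)
  let ?r = "sqrt_iter (1::real)"
  have a: "0 \<le> ?r (Suc n)" using Suc by simp
  have b: "?r (Suc n) \<le> 1" using Suc mult_le_one[of "?r n" "?r n"] by simp
  have "?r n * ?r n \<le> ?r (Suc n) * ?r (Suc n)"
    using Suc by (intro mult_mono) auto
  then have "?r (Suc n) \<le> ?r (Suc (Suc n))"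
    unfolding sqrt_iter.simps(2)[of _ "Suc n"] by (simp add: sqrt_iter.simps(2)[of _ n])
  with a b show ?case by blast
qed simp

lemma norm_sqrt_iter_le:
  "norm x \<le> 1 \<Longrightarrow> norm (sqrt_iter x n) \<le> sqrt_iter (1::real) n"
proof (induction n)
  case (Suc n)
  let ?y = "sqrt_iter x n" and ?r = "sqrt_iter (1::real) n"
  have "norm (?y * ?y) \<le> norm ?y * norm ?y" by (rule norm_mult_ineq)
  also have "\<dots> \<le> ?r * ?r" using Suc by (intro mult_mono) (auto simp: sqrt_iter_real)
  finally have "norm (x + ?y * ?y) \<le> 1 + ?r * ?r"
    using norm_triangle_ineq[of x "?y * ?y"] Suc.prems by linarith
  then show ?case by simp
qed simp

text \<open>Iterates of the same \<open>x\<close> commute, so a difference of squares factors as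
  difference times sum; both factors are dominated by their real counterparts, for which the same
  factorisation is an equality.\<close>

lemma norm_sqrt_iter_step:
  assumes "norm x \<le> 1"
  shows "norm (sqrt_iter x (Suc n) - sqrt_iter x n)
    \<le> sqrt_iter (1::real) (Suc n) - sqrt_iter 1 n"
proof (induction n)
  case 0
  then show ?case using assms by simp
next
  case (Suc n)
  define y where "y = sqrt_iter x"
  define r where "r = sqrt_iter (1::real)"
  have comm: "y (Suc n) * y n = y n * y (Suc n)"
    unfolding y_def by (intro sqrt_iter_commute sqrt_iter_commute[symmetric]) simp
  have factor: "(y (Suc n) - y n) * (y (Suc n) + y n) = y (Suc n) * y (Suc n) - y n * y n"
    using comm by (simp add: algebra_simps)
  have step: "y (Suc (Suc n)) - y (Suc n) = (1/2) *\<^sub>R ((y (Suc n) - y n) * (y (Suc n) + y n))"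
    unfolding factor unfolding y_def sqrt_iter.simps(2)[of _ "Suc n"]
    by (simp add: sqrt_iter.simps(2)[of _ n] scaleR_right_diff_distrib[symmetric])
  have "norm ((y (Suc n) - y n) * (y (Suc n) + y n))
      \<le> norm (y (Suc n) - y n) * norm (y (Suc n) + y n)" by (rule norm_mult_ineq)
  also have "\<dots> \<le> (r (Suc n) - r n) * (r (Suc n) + r n)"
  proof (intro mult_mono)
    show "norm (y (Suc n) - y n) \<le> r (Suc n) - r n" using Suc by (simp add: y_def r_def)
    have "norm (y k) \<le> r k" for k
      using norm_sqrt_iter_le[OF assms] by (simp add: y_def r_def)
    then show "norm (y (Suc n) + y n) \<le> r (Suc n) + r n"
      by (meson add_mono norm_triangle_le)
  qed (use sqrt_iter_real[of n] in \<open>auto simp: r_def simp del: sqrt_iter.simps\<close>)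
  also have "\<dots> = 2 * (r (Suc (Suc n)) - r (Suc n))"
    unfolding r_def sqrt_iter.simps(2)[of _ "Suc n"]
    by (simp add: sqrt_iter.simps(2)[of _ n] algebra_simps)
  finally have "norm (y (Suc (Suc n)) - y (Suc n)) \<le> r (Suc (Suc n)) - r (Suc n)"
    unfolding step by simp
  then show ?case by (simp only: y_def r_def)
qed

lemma sqrt_iter_converges:
  fixes x :: "'a::{real_normed_algebra_1, banach}"
  assumes "norm x \<le> 1"
  shows "convergent (sqrt_iter x)"
proof -
  let ?r = "sqrt_iter (1::real)" and ?y = "sqrt_iter x"
  have inc: "incseq ?r" by (rule incseq_SucI) (use sqrt_iter_real in blast)
  have "convergent ?r"
    using inc sqrt_iter_real by (metis incseq_convergent convergentI)
  then have C: "Cauchy ?r" by (rule convergent_Cauchy)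
  \<comment> \<open>Telescoping the dominated increments bounds the distance of two iterates by that
    of the bounded increasing real ones.\<close>
  have tel: "norm (?y (n + k) - ?y n) \<le> ?r (n + k) - ?r n" for n k
  proof (induction k)
    case (Suc k)
    have "norm (?y (n + Suc k) - ?y n)
        \<le> norm (?y (Suc (n + k)) - ?y (n + k)) + norm (?y (n + k) - ?y n)"
      by (metis add_Suc_right diff_add_cancel add_diff_eq norm_triangle_ineq)
    also have "\<dots> \<le> (?r (Suc (n + k)) - ?r (n + k)) + (?r (n + k) - ?r n)"
      using Suc norm_sqrt_iter_step[OF assms] by (intro add_mono) auto
    finally show ?case by (simp only: add_Suc_right)
  qed simp
  have "Cauchy ?y"
  proof (rule CauchyI')
    fix e :: real assume "e > 0"
    then obtain M where M: "\<And>m n. m \<ge> M \<Longrightarrow> n \<ge> M \<Longrightarrow> norm (?r m - ?r n) < e"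
      using CauchyD[OF C] by blast
    have "dist (?y m) (?y n) < e" if "m \<ge> M" "n > m" for m n
    proof -
      obtain k where k: "n = m + k" using \<open>n > m\<close> less_imp_add_positive by blast
      have "dist (?y m) (?y n) = norm (?y n - ?y m)" by (simp add: dist_norm norm_minus_commute)
      also have "\<dots> \<le> ?r n - ?r m" unfolding k by (rule tel)
      also have "\<dots> < e" using M[of n m] that by auto
      finally show ?thesis .
    qed
    then show "\<exists>M. \<forall>m\<ge>M. \<forall>n>m. dist (?y m) (?y n) < e" by blast
  qed
  then show ?thesis by (rule Cauchy_convergent)
qed

lemma bounded_linear_star: "bounded_linear (star :: 'a::unital_cstar_algebra \<Rightarrow> 'a)"
  by (rule bounded_linear_intro[where K = 1]) (auto simp: star_add)

text \<open>The limit y of the iteration satisfies 2y = x + y^2, that is (1 - y)^2 = 1 - x, and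
  \<open>s\<close> is 1 - y. The last two conclusions do the work of functional calculus: the norm
  bound makes \<open>s\<close> positive, and \<open>s\<close> commutes with whatever commutes with
  \<open>x\<close>.\<close>

lemma sqrt_one_minus:
  fixes x :: "'a::unital_cstar_algebra"
  assumes "norm x \<le> 1" "star x = x"
  obtains s where "star s = s" "s * s = 1 - x" "norm (1 - s) \<le> 1"
    "\<And>z. z * x = x * z \<Longrightarrow> z * s = s * z"
proof -
  let ?y = "sqrt_iter x"
  obtain y where lim: "?y \<longlonglongrightarrow> y"
    using sqrt_iter_converges[OF assms(1)] by (auto simp: convergent_def)
  have "(\<lambda>n. ?y (Suc n)) \<longlonglongrightarrow> (1/2) *\<^sub>R (x + y * y)"
    unfolding sqrt_iter.simps by (intro tendsto_intros lim)
  then have eq: "y = (1/2) *\<^sub>R (x + y * y)"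
    using LIMSEQ_Suc[OF lim] LIMSEQ_unique by blast
  have "star (?y n) = ?y n" for n
    by (induction n) (auto simp: star_add star_mult assms)
  then have "?y \<longlonglongrightarrow> star y"
    using bounded_linear.tendsto[OF bounded_linear_star lim] by simp
  then have sa: "star y = y" using LIMSEQ_unique lim by blast
  have "norm (?y n) \<le> 1" for n
    using norm_sqrt_iter_le[OF assms(1), of n] sqrt_iter_real[of n] by linarith
  then have nrm: "norm y \<le> 1"
    using tendsto_norm[OF lim] by (intro LIMSEQ_le_const2) auto
  have comm: "z * y = y * z" if "z * x = x * z" for z
  proof (rule LIMSEQ_unique)
    show "(\<lambda>n. z * ?y n) \<longlonglongrightarrow> z * y" by (intro tendsto_intros lim)
    show "(\<lambda>n. z * ?y n) \<longlonglongrightarrow> y * z"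
      unfolding sqrt_iter_commute[OF that] by (intro tendsto_intros lim)
  qed
  have "2 *\<^sub>R y = x + y * y" by (subst eq) simp
  then have "(1 - y) * (1 - y) = 1 - x" by (simp add: algebra_simps scaleR_2)
  then show thesis
  proof (rule that[of "1 - y", rotated])
    show "star (1 - y) = 1 - y" using sa by (simp add: star_diff)
    show "norm (1 - (1 - y)) \<le> 1" using nrm by simp
    show "z * (1 - y) = (1 - y) * z" if "z * x = x * z" for z
      using comm[OF that] by (simp add: left_diff_distrib right_diff_distrib)
  qed
qed

section \<open>The positive cone\<close>

text \<open>Positivity without spectra: for self-adjoint \<open>p\<close> the bound says that the
  spectrum lies between 0 and 2t. In this form the sum of positive elements is positive by the
  triangle inequality.\<close>

definition pos :: "'a::unital_cstar_algebra \<Rightarrow> bool"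
  where "pos p \<longleftrightarrow> star p = p \<and> (\<exists>t\<ge>0. norm (t *\<^sub>R 1 - p) \<le> t)"

lemma pos_star: "pos p \<Longrightarrow> star p = p"
  by (simp add: pos_def)

lemma pos_zero [simp]: "pos 0"
  by (auto simp: pos_def)

lemma pos_add: "pos p \<Longrightarrow> pos q \<Longrightarrow> pos (p + q)"
proof -
  assume "pos p" "pos q"
  then obtain s t where st: "s \<ge> 0" "norm (s *\<^sub>R 1 - p) \<le> s" "t \<ge> 0" "norm (t *\<^sub>R 1 - q) \<le> t"
    "star p = p" "star q = q"
    unfolding pos_def by blast
  have "norm ((s + t) *\<^sub>R 1 - (p + q)) \<le> s + t"
    using norm_triangle_ineq[of "s *\<^sub>R 1 - p" "t *\<^sub>R 1 - q"] st by (simp add: algebra_simps)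
  then show ?thesis using st by (auto simp: pos_def star_add intro!: exI[of _ "s + t"])
qed

lemma pos_scaleR: "pos p \<Longrightarrow> r \<ge> 0 \<Longrightarrow> pos (r *\<^sub>R p)"
proof -
  assume "pos p" and r: "r \<ge> 0"
  then obtain t where t: "t \<ge> 0" "norm (t *\<^sub>R 1 - p) \<le> t" "star p = p"
    unfolding pos_def by blast
  have "norm ((r * t) *\<^sub>R 1 - r *\<^sub>R p) = r * norm (t *\<^sub>R 1 - p)"
    using r by (metis abs_of_nonneg norm_scaleR scaleR_right_diff_distrib scaleR_scaleR)
  with t r show ?thesis
    by (auto simp: pos_def intro!: exI[of _ "r * t"] mult_left_mono)
qed

lemma pos_if_norm_le: "star x = x \<Longrightarrow> norm x \<le> t \<Longrightarrow> pos (t *\<^sub>R 1 - x)"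
  using order_trans[OF norm_ge_zero[of x]] by (auto simp: pos_def star_diff intro!: exI[of _ t])

lemma pos_one [simp]: "pos 1"
  using pos_if_norm_le[of 0 1] by simp

text \<open>The witness t rescales \<open>p\<close>: 1 - p/t is a self-adjoint contraction, so
  \<open>sqrt_one_minus\<close> gives a root of p/t.\<close>

lemma pos_sqrt:
  assumes "pos p"
  obtains s where "pos s" "s * s = p" "\<And>z. z * p = p * z \<Longrightarrow> z * s = s * z"
proof -
  obtain t where t: "t \<ge> 0" "norm (t *\<^sub>R 1 - p) \<le> t" "star p = p"
    using assms unfolding pos_def by blast
  show thesis
  proof (cases "t = 0")
    case True
    with t have "p = 0" by simp
    then show thesis using that[of 0] by simp
  next
    case False
    with t have tp: "t > 0" by simp
    define x where "x = 1 - (1/t) *\<^sub>R p"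
    have "x = (1/t) *\<^sub>R (t *\<^sub>R 1 - p)" using tp by (simp add: x_def scaleR_right_diff_distrib)
    then have "norm x \<le> 1" using t tp by simp
    moreover have "star x = x" using t by (simp add: x_def star_diff)
    ultimately obtain s where s: "star s = s" "s * s = 1 - x" "norm (1 - s) \<le> 1"
      "\<And>z. z * x = x * z \<Longrightarrow> z * s = s * z"
      using sqrt_one_minus by blast
    have "pos s" using s(1,3) by (auto simp: pos_def intro!: exI[of _ 1])
    then have "pos (sqrt t *\<^sub>R s)" using tp by (intro pos_scaleR) auto
    moreover have "(sqrt t *\<^sub>R s) * (sqrt t *\<^sub>R s) = p" using tp by (simp add: s(2) x_def)
    moreover have "z * (sqrt t *\<^sub>R s) = (sqrt t *\<^sub>R s) * z" if "z * p = p * z" for z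
      using s(4)[of z] that by (simp add: x_def left_diff_distrib right_diff_distrib)
    ultimately show thesis using that by blast
  qed
qed

text \<open>As h and s commute, g = h + i s satisfies g* g = t^2 and has norm t by the C*-identity;
  h and s are its real and imaginary parts.\<close>

lemma unitary_cartesian:
  fixes h s :: "'a::unital_cstar_algebra"
  assumes "star h = h" "star s = s" "h * s = s * h" "h * h + s * s = (t * t) *\<^sub>R 1" "t \<ge> 0"
  shows "norm h \<le> t" "norm s \<le> t"
proof -
  define g where "g = h + \<i> *\<^sub>C s"
  have sg: "star g = h - \<i> *\<^sub>C s"
    using assms by (simp add: g_def star_add star_scaleC)
  have "star g * g = (t * t) *\<^sub>R 1"
  proof -
    have "star g * g = h * h + \<i> *\<^sub>C (h * s) - \<i> *\<^sub>C (s * h) - (\<i> * \<i>) *\<^sub>C (s * s)"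
      unfolding sg unfolding g_def
      by (simp add: algebra_simps mult_scaleC_left mult_scaleC_right scaleC_scaleC)
    also have "\<dots> = h * h + s * s" using assms(3) by (simp add: scaleC_minus_one)
    finally show ?thesis using assms by simp
  qed
  then have "(norm g)\<^sup>2 = t\<^sup>2" using cstar_identity[of g] by (simp add: power2_eq_square)
  then have ng: "norm g = t" using assms(5) by simp
  have "2 *\<^sub>R h = g + star g" unfolding sg unfolding g_def by (simp add: scaleR_2)
  then have "2 * norm h \<le> 2 * t"
    using norm_triangle_ineq[of g "star g"] ng by (metis abs_numeral norm_scaleR norm_star mult_2)
  then show "norm h \<le> t" by simp
  have "(2 * \<i>) *\<^sub>C s = \<i> *\<^sub>C s + \<i> *\<^sub>C s" by (simp only: mult_2 scaleC_add_left)
  also have "\<dots> = g - star g" unfolding sg unfolding g_def by simp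
  finally have "(2 * \<i>) *\<^sub>C s = g - star g" .
  then have "2 * norm s \<le> 2 * t"
    using norm_triangle_ineq4[of g "star g"] ng norm_scaleC[of "2 * \<i>" s]
    by (simp add: norm_mult)
  then show "norm s \<le> t" by simp
qed

text \<open>For a contraction h the root s of 1 - h^2 commutes with h, so h + i s is unitary and s
  is a contraction; then 1 - h^2 = s^2 has norm at most 1, which is positivity of h^2 with t =
  1.\<close>

lemma pos_square: "star h = h \<Longrightarrow> pos (h * h)" for h :: "'a::unital_cstar_algebra"
proof -
  have unit: "pos (h * h)" if sa: "star h = h" and n: "norm h \<le> 1" for h :: 'a
  proof -
    have "norm (h * h) \<le> 1" using norm_square_self_adjoint[OF sa] n by (simp add: power_le_one)
    moreover have "star (h * h) = h * h" using sa by (simp add: star_mult)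
    ultimately obtain s where s: "star s = s" "s * s = 1 - h * h"
      "\<And>z. z * (h * h) = h * h * z \<Longrightarrow> z * s = s * z" using sqrt_one_minus by blast
    have "norm s \<le> 1"
      by (rule unitary_cartesian[of h s]) (use sa s(1,2) s(3)[of h] in \<open>auto simp: mult.assoc\<close>)
    then have "norm (1 - h * h) \<le> 1"
      using norm_square_self_adjoint[OF s(1)] s(2) by (simp add: power_le_one)
    then show ?thesis using sa by (auto simp: pos_def star_mult intro!: exI[of _ 1])
  qed
  assume sa: "star h = h"
  show "pos (h * h)"
  proof (cases "h = 0")
    case False
    have "pos ((1 / norm h) *\<^sub>R h * (1 / norm h) *\<^sub>R h)"
      using sa False by (intro unit) auto
    then have "pos ((norm h * norm h) *\<^sub>R ((1 / norm h) *\<^sub>R h * (1 / norm h) *\<^sub>R h))"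
      by (rule pos_scaleR) auto
    then show ?thesis using False by simp
  qed simp
qed

text \<open>The square roots s and r commute with each other, so pq is the square of the
  self-adjoint element sr.\<close>

lemma pos_mult:
  assumes "pos p" "pos q" "p * q = q * p"
  shows "pos (p * q)"
proof -
  obtain s where s: "pos s" "s * s = p" "\<And>z. z * p = p * z \<Longrightarrow> z * s = s * z"
    using pos_sqrt[OF assms(1)] by blast
  obtain r where r: "pos r" "r * r = q" "\<And>z. z * q = q * z \<Longrightarrow> z * r = r * z"
    using pos_sqrt[OF assms(2)] by blast
  have "q * s = s * q" by (rule s(3)) (rule assms(3)[symmetric])
  then have sr: "s * r = r * s" by (intro r(3)) simp
  have "p * q = s * (s * r) * r" by (simp add: mult.assoc s(2)[symmetric] r(2)[symmetric])
  also have "\<dots> = s * (r * s) * r" by (simp only: sr)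
  also have "\<dots> = (s * r) * (s * r)" by (simp only: mult.assoc)
  finally have "p * q = (s * r) * (s * r)" .
  moreover have "star (s * r) = s * r" using pos_star[OF s(1)] pos_star[OF r(1)] sr by (simp add: star_mult)
  ultimately show ?thesis using pos_square by metis
qed

text \<open>The way back from order to norm: t^2 - x^2 is the product of the commuting positive
  elements t - x and t + x, and its root is the partner of \<open>x\<close> in
  \<open>unitary_cartesian\<close>.\<close>

lemma norm_le_if_pos:
  assumes "star x = x" "pos (t *\<^sub>R 1 - x)" "pos (t *\<^sub>R 1 + x)" "t \<ge> 0"
  shows "norm x \<le> t"
proof -
  have "(t *\<^sub>R 1 - x) * (t *\<^sub>R 1 + x) = (t *\<^sub>R 1 + x) * (t *\<^sub>R 1 - x)" by (simp add: algebra_simps)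
  from pos_mult[OF assms(2,3) this] have "pos ((t * t) *\<^sub>R 1 - x * x)" by (simp add: algebra_simps)
  then obtain s where s: "pos s" "s * s = (t * t) *\<^sub>R 1 - x * x"
    "\<And>z. z * ((t * t) *\<^sub>R 1 - x * x) = ((t * t) *\<^sub>R 1 - x * x) * z \<Longrightarrow> z * s = s * z"
    using pos_sqrt by blast
  show ?thesis
    by (rule unitary_cartesian(1)[of x s])
      (use assms s(1,2) s(3)[of x] in \<open>auto simp: pos_star algebra_simps\<close>)
qed

lemma norm_le_if_pos':
  assumes "pos x" "pos (t *\<^sub>R 1 - x)" "t \<ge> 0"
  shows "norm x \<le> t"
proof (rule norm_le_if_pos)
  show "pos (t *\<^sub>R 1 + x)" by (intro pos_add pos_scaleR assms) auto
qed (use assms in \<open>auto simp: pos_star\<close>)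

text \<open>Bernoulli's inequality. If E_m denotes the element in question, then E_(m+1) = E_m (1 +
  q) + m q^2, a sum of products of commuting positive elements.\<close>

lemma pos_bernoulli:
  assumes q: "pos q"
  shows "pos ((1 + q) ^ m - 1 - real m *\<^sub>R q)"
proof (induction m)
  case (Suc m)
  let ?E = "(1 + q) ^ m - 1 - real m *\<^sub>R q"
  have c: "(1 + q) ^ m * q = q * (1 + q) ^ m"
    by (rule power_commuting_commutes) (simp add: algebra_simps)
  have "?E * (1 + q) = (1 + q) * ?E"
    using c by (simp add: left_diff_distrib right_diff_distrib distrib_left distrib_right
      scaleR_right_distrib)
  then have "pos (?E * (1 + q))" using Suc q by (intro pos_mult pos_add) auto
  moreover have "pos (real m *\<^sub>R (q * q))" using q by (intro pos_scaleR pos_mult) auto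
  ultimately have "pos (?E * (1 + q) + real m *\<^sub>R (q * q))" by (rule pos_add)
  moreover have "?E * (1 + q) + real m *\<^sub>R (q * q) = (1 + q) ^ Suc m - 1 - real (Suc m) *\<^sub>R q"
    unfolding power_Suc2
    by (simp add: left_diff_distrib distrib_left distrib_right scaleR_left_distrib scaleR_right_distrib)
  ultimately show ?case by simp
qed simp

text \<open>Replaces the comparison of the spectra of b* b and b b*. After scaling, 1 + b* b is a
  contraction. With q = b b* the identity b (1 + b* b)^m = (1 + q)^m b bounds q (1 + q)^m by the
  squared norm of b for all m, whereas Bernoulli makes it at least m q^2. Hence q^2 = 0.\<close>

lemma eq_0_if_neg_cstar_square:
  assumes "pos (- (star b * b))"
  shows "b = 0"
proof -
  have contraction: "b = 0" if p: "pos (- (star b * b))" and n: "norm (1 + star b * b) \<le> 1" for b :: 'a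
  proof -
    define q where "q = b * star b"
    text \<open>With \<open>b = x + i y\<close> one has \<open>b b* = 2 (x\<^sup>2 + y\<^sup>2) - b* b\<close>.\<close>
    have q: "pos q"
    proof -
      define x where "x = b + star b"
      define y where "y = \<i> *\<^sub>C (star b - b)"
      have "star x = x" by (simp add: x_def star_add star_star add.commute)
      moreover have "star y = y"
        by (simp add: y_def star_diff star_scaleC star_star) 
          (metis minus_diff_eq mult_minus1 scaleC_minus_one scaleC_scaleC scaleC_minus_right)
      ultimately have "pos (x * x + y * y)" by (intro pos_add pos_square)
      then have "pos ((1/2) *\<^sub>R (x * x + y * y) + - (star b * b))"
        using p by (intro pos_add[OF pos_scaleR]) auto
      moreover have "x * x + y * y = 2 *\<^sub>R (q + star b * b)"
        by (simp add: x_def y_def q_def mult_scaleC_left mult_scaleC_right scaleC_scaleC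
            scaleC_minus_one algebra_simps scaleR_2)
      ultimately show ?thesis by simp
    qed
    define M where "M = (norm b)\<^sup>2"
    have swap: "b * (1 + star b * b) ^ m = (1 + q) ^ m * b" for m
    proof (induction m)
      case (Suc m)
      have "b * (1 + star b * b) ^ Suc m = (b * (1 + star b * b) ^ m) * (1 + star b * b)"
        by (simp only: power_Suc2 mult.assoc)
      also have "\<dots> = (1 + q) ^ m * (b * (1 + star b * b))" by (simp add: Suc mult.assoc)
      also have "b * (1 + star b * b) = (1 + q) * b" by (simp add: q_def algebra_simps)
      finally show ?case by (simp only: power_Suc2 mult.assoc)
    qed simp
    have bound: "real m * norm (q * q) \<le> M" for m
    proof -
      have B: "pos ((1 + q) ^ m - 1 - real m *\<^sub>R q)" "(1 + q) ^ m * q = q * (1 + q) ^ m"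
        using pos_bernoulli[OF q, of m]
        by (auto intro: power_commuting_commutes simp: distrib_left distrib_right)
      let ?E = "(1 + q) ^ m - 1 - real m *\<^sub>R q"
      have qE: "pos (q * ?E)" using q B by (intro pos_mult) (auto simp: algebra_simps)
      have pm: "pos (q * (1 + q) ^ m)"
      proof -
        have "pos (real m *\<^sub>R (q * q))" using q by (intro pos_scaleR pos_mult) auto
        from pos_add[OF pos_add[OF qE q] this] show ?thesis by (simp add: algebra_simps)
      qed
      have "norm ((1 + q) ^ m * q) = norm (b * (1 + star b * b) ^ m * star b)"
        by (simp add: swap q_def mult.assoc)
      also have "\<dots> \<le> norm (b * (1 + star b * b) ^ m) * norm (star b)"
        by (rule norm_mult_ineq)
      also have "\<dots> \<le> norm b * norm ((1 + star b * b) ^ m) * norm b"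
        unfolding norm_star by (intro mult_right_mono norm_mult_ineq norm_ge_zero)
      also have "\<dots> \<le> norm b * 1 * norm b"
        using order_trans[OF norm_power_ineq[of "1 + star b * b" m] power_le_one] n
        by (intro mult_right_mono mult_left_mono) auto
      finally have "norm (q * (1 + q) ^ m) \<le> M" using B by (simp add: M_def power2_eq_square)
      then have "pos (M *\<^sub>R 1 - q * (1 + q) ^ m)" using pm by (intro pos_if_norm_le) (auto simp: pos_star)
      \<comment> \<open>The terms add up to M - m q^2, because q E = q (1 + q)^m - q - m
        q^2.\<close>
      from pos_add[OF pos_add[OF this q] qE] have "pos (M *\<^sub>R 1 - real m *\<^sub>R (q * q))"
        by (simp add: algebra_simps)
      moreover have "pos (real m *\<^sub>R (q * q))" using q by (intro pos_scaleR pos_mult) auto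
      ultimately have "norm (real m *\<^sub>R (q * q)) \<le> M" by (intro norm_le_if_pos') (auto simp: M_def)
      then show ?thesis by simp
    qed
    have "norm (q * q) = 0"
    proof (rule ccontr)
      assume "norm (q * q) \<noteq> 0"
      then have "norm (q * q) > 0" by simp
      then obtain m where "M < real m * norm (q * q)" using reals_Archimedean3 by blast
      with bound[of m] show False by simp
    qed
    then have "q = 0" using self_adjoint_square_eq_0[of q] pos_star[OF q] by simp
    then have "star b = 0" using cstar_eq_0[of "star b"] by (simp add: q_def star_star)
    then show "b = 0" by (metis star_star star_zero)
  qed
  obtain t where t: "t \<ge> 0" "norm (t *\<^sub>R 1 + star b * b) \<le> t"
    using assms by (auto simp: pos_def)
  show ?thesis
  proof (cases "t = 0")
    case True
    with t show ?thesis using cstar_eq_0[of b] by simp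
  next
    case False
    then have tp: "t > 0" using t by simp
    \<comment> \<open>This scaling turns the bound t on the norm of t + b* b into the bound 1 on the
      norm of 1 + c* c.\<close>
    define c where "c = (1 / sqrt t) *\<^sub>R b"
    have cc: "star c * c = (1/t) *\<^sub>R (star b * b)" using tp by (simp add: c_def)
    have "pos ((1/t) *\<^sub>R (- (star b * b)))" using tp assms by (intro pos_scaleR) auto
    then have "pos (- (star c * c))" by (simp add: cc)
    moreover have "1 + star c * c = (1/t) *\<^sub>R (t *\<^sub>R 1 + star b * b)"
      unfolding cc using tp by (simp add: scaleR_right_distrib)
    then have "norm (1 + star c * c) \<le> 1" using t tp by simp
    ultimately have "c = 0" by (rule contraction)
    then show ?thesis using tp by (simp add: c_def)
  qed
qed

text \<open>With k the absolute value of h = a* a, the elements x = k - h and y = k + h are twice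
  the negative and twice the positive part of h, and x y = 0. Then (a x)* (a x) = x h x equals - x^3
  / 2 and is negative, so a x = 0, which forces x = 0 and h = k.\<close>

theorem pos_cstar_square: "pos (star a * a)"
proof -
  define h where "h = star a * a"
  have sh: "star h = h" by (simp add: h_def star_mult star_star)
  obtain k where k: "pos k" "k * k = h * h" "\<And>z. z * (h * h) = h * h * z \<Longrightarrow> z * k = k * z"
    using pos_sqrt[OF pos_square[OF sh]] by blast
  have hk: "h * k = k * h" using k(3)[of h] by (simp add: mult.assoc)
  define x where "x = k - h"
  define y where "y = k + h"
  have sx: "star x = x" using sh pos_star[OF k(1)] by (simp add: x_def star_diff)
  have xy: "x * y = 0" using hk k(2) by (simp add: x_def y_def algebra_simps)
  have kx: "k * x = x * k" using hk by (simp add: x_def algebra_simps)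
  have "pos ((x * x) * (2 *\<^sub>R k))"
  proof (rule pos_mult)
    show "pos (2 *\<^sub>R k)" using k(1) by (simp add: pos_scaleR)
    have "x * x * k = k * (x * x)" by (metis kx mult.assoc)
    then show "x * x * (2 *\<^sub>R k) = 2 *\<^sub>R k * (x * x)" by simp
  qed (rule pos_square[OF sx])
  moreover have "2 *\<^sub>R k = x + y" by (simp add: x_def y_def scaleR_2)
  ultimately have cube: "pos (x * x * x)" by (simp add: distrib_left mult.assoc xy)
  have "2 *\<^sub>R h = y - x" by (simp add: x_def y_def scaleR_2)
  then have "x * (2 *\<^sub>R h) * x = - (x * x * x)" by (simp add: right_diff_distrib xy)
  then have *: "x * x * x = 2 *\<^sub>R - (x * h * x)" by simp
  have "- (x * h * x) = (1/2) *\<^sub>R (x * x * x)" unfolding * by simp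
  then have "- (star (a * x) * (a * x)) = (1/2) *\<^sub>R (x * x * x)"
    by (simp add: star_mult sx h_def mult.assoc)
  then have "pos (- (star (a * x) * (a * x)))" using cube by (simp add: pos_scaleR)
  then have "a * x = 0" by (rule eq_0_if_neg_cstar_square)
  then have "x * (2 *\<^sub>R h) * x = 0" by (simp add: h_def mult.assoc)
  with \<open>x * (2 *\<^sub>R h) * x = - (x * x * x)\<close> have "x * x * x = 0" by simp
  then have "(x * x) * (x * x) = 0" by (simp add: mult.assoc)
  moreover have "star (x * x) = x * x" using sx by (simp add: star_mult)
  ultimately have "x * x = 0" by (metis self_adjoint_square_eq_0)
  then have "x = 0" by (metis self_adjoint_square_eq_0 sx)
  then have "h = k" by (simp add: x_def)
  then show ?thesis using k(1) by (simp add: h_def)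
qed

section \<open>States\<close>

definition sublinear :: "('v::real_vector \<Rightarrow> real) \<Rightarrow> bool"
  where "sublinear q \<longleftrightarrow> (\<forall>x y. q (x + y) \<le> q x + q y) \<and> (\<forall>t x. t > 0 \<longrightarrow> q (t *\<^sub>R x) = t * q x)"

lemma sublinear_zero: "sublinear q \<Longrightarrow> q 0 = 0"
proof -
  assume "sublinear q"
  then have "q ((2::real) *\<^sub>R 0) = 2 * q 0" unfolding sublinear_def by (meson zero_less_numeral)
  then show "q 0 = 0" by simp
qed

lemma sublinear_norm: "sublinear norm"
  by (auto simp: sublinear_def norm_triangle_ineq)

text \<open>Infimal convolution of \<open>q\<close> with a cone \<open>G\<close> of pairs, a pair
  (m, r) being the constraint that the value at m be at most r. The hypothesis on
  \<open>r + q (- m)\<close> keeps the infimum finite.\<close>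

lemma sublinear_cone:
  fixes q :: "'v::real_vector \<Rightarrow> real"
  assumes q: "sublinear q" and zero: "(0, 0) \<in> G"
    and add: "\<And>m r m' r'. (m, r) \<in> G \<Longrightarrow> (m', r') \<in> G \<Longrightarrow> (m + m', r + r') \<in> G"
    and scale: "\<And>m r t. (m, r) \<in> G \<Longrightarrow> t > 0 \<Longrightarrow> (t *\<^sub>R m, t * r) \<in> G"
    and bound: "\<And>m r. (m, r) \<in> G \<Longrightarrow> 0 \<le> r + q (- m)"
  obtains q' where "sublinear q'" "\<And>x. q' x \<le> q x" "\<And>m r. (m, r) \<in> G \<Longrightarrow> q' m \<le> r"
proof -
  define q' where "q' x = (INF g\<in>G. q (x - fst g) + snd g)" for x
  have sub: "q (x + y) \<le> q x + q y" and hom: "t > 0 \<Longrightarrow> q (t *\<^sub>R x) = t * q x" for x y t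
    using q by (auto simp: sublinear_def)
  have ne: "G \<noteq> {}" using zero by auto
  have bdd: "bdd_below ((\<lambda>g. q (x - fst g) + snd g) ` G)" for x
  proof (rule bdd_belowI2)
    fix g assume "g \<in> G"
    then show "- q (- x) \<le> q (x - fst g) + snd g"
      using bound[of "fst g" "snd g"] sub[of "x - fst g" "- x"] by simp
  qed
  have low: "q' x \<le> q (x - m) + r" if "(m, r) \<in> G" for x m r
    using cINF_lower[OF bdd that, of x] by (simp add: q'_def)
  have great: "c \<le> q' x" if "\<And>m r. (m, r) \<in> G \<Longrightarrow> c \<le> q (x - m) + r" for c x
    unfolding q'_def using that by (intro cINF_greatest ne) auto
  have "q' (x + y) \<le> q' x + q' y" for x y
  proof -
    have "q' (x + y) - q' y \<le> q (x - m) + r" if g: "(m, r) \<in> G" for m r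
    proof -
      have "q' (x + y) - (q (x - m) + r) \<le> q (y - m') + r'" if g': "(m', r') \<in> G" for m' r'
        using low[OF add[OF g g'], of "x + y"] sub[of "x - m" "y - m'"] by (simp add: algebra_simps)
      then have "q' (x + y) - (q (x - m) + r) \<le> q' y" by (rule great)
      then show ?thesis by simp
    qed
    then have "q' (x + y) - q' y \<le> q' x" by (rule great)
    then show ?thesis by simp
  qed
  moreover have le: "q' (t *\<^sub>R x) \<le> t * q' x" if t: "t > 0" for t x
  proof -
    have "q' (t *\<^sub>R x) / t \<le> q (x - m) + r" if g: "(m, r) \<in> G" for m r
      using low[OF scale[OF g t], of "t *\<^sub>R x"] hom[OF t, of "x - m"] t
      by (simp add: field_simps scaleR_right_diff_distrib)
    then have "q' (t *\<^sub>R x) / t \<le> q' x" by (rule great)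
    then show ?thesis using t by (simp add: field_simps)
  qed
  moreover have "t * q' x \<le> q' (t *\<^sub>R x)" if t: "t > 0" for t x
    using le[of "1 / t" "t *\<^sub>R x"] t by (simp add: field_simps)
  ultimately have "sublinear q'" by (auto simp: sublinear_def intro: antisym)
  moreover have "q' x \<le> q x" for x using low[OF zero, of x] by simp
  moreover have "q' m \<le> r" if "(m, r) \<in> G" for m r
    using low[OF that, of m] sublinear_zero[OF q] by simp
  ultimately show thesis using that by blast
qed

text \<open>The common upper bound \<open>p\<close> gives a lower one: from 0 \<le> q x + q (- x)
  follows - p (- x) \<le> q x. For subadditivity of the infimum, the smaller of two members of the
  chain serves for both summands.\<close>

lemma sublinear_chain:
  assumes ne: "C \<noteq> {}" and sl: "\<And>q. q \<in> C \<Longrightarrow> sublinear q"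
    and chain: "\<And>q q'. q \<in> C \<Longrightarrow> q' \<in> C \<Longrightarrow> q \<le> q' \<or> q' \<le> q"
    and below: "\<And>q x. q \<in> C \<Longrightarrow> q x \<le> p x"
  shows "sublinear (\<lambda>x. INF q\<in>C. q x)" "\<And>q x. q \<in> C \<Longrightarrow> (INF q\<in>C. q x) \<le> q x"
proof -
  have bdd: "bdd_below ((\<lambda>q. q x) ` C)" for x
  proof (rule bdd_belowI2)
    fix q assume q: "q \<in> C"
    have "q 0 \<le> q x + q (- x)" using sl[OF q] by (metis sublinear_def add.right_inverse)
    then show "- p (- x) \<le> q x" using below[OF q, of "- x"] sublinear_zero[OF sl[OF q]] by linarith
  qed
  show low: "(INF q\<in>C. q x) \<le> q x" if "q \<in> C" for q x
    using that by (intro cINF_lower bdd)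
  have great: "c \<le> (INF q\<in>C. q x)" if "\<And>q. q \<in> C \<Longrightarrow> c \<le> q x" for c x
    using that by (intro cINF_greatest ne)
  have sum: "(INF q\<in>C. q (x + y)) \<le> q x + q' y" if qq: "q \<in> C" "q' \<in> C" for q q' x y
  proof -
    obtain r where "r \<in> C" "r \<le> q" "r \<le> q'" using chain[OF qq] qq by blast
    then have "r (x + y) \<le> q x + q' y"
      using sl[of r] by (smt (verit) le_funD sublinear_def)
    then show ?thesis using low[OF \<open>r \<in> C\<close>, of "x + y"] by linarith
  qed
  have "(INF q\<in>C. q (x + y)) \<le> (INF q\<in>C. q x) + (INF q\<in>C. q y)" for x y
  proof -
    have "(INF q\<in>C. q (x + y)) - (INF q\<in>C. q y) \<le> q x" if "q \<in> C" for q
    proof -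
      have "(INF q\<in>C. q (x + y)) - q x \<le> (INF q\<in>C. q y)"
        by (rule great) (use sum[OF that] in \<open>simp add: algebra_simps\<close>)
      then show ?thesis by simp
    qed
    then have "(INF q\<in>C. q (x + y)) - (INF q\<in>C. q y) \<le> (INF q\<in>C. q x)" by (rule great)
    then show ?thesis by simp
  qed
  moreover have le: "(INF q\<in>C. q (t *\<^sub>R x)) \<le> t * (INF q\<in>C. q x)" if t: "t > 0" for t x
  proof -
    have "(INF q\<in>C. q (t *\<^sub>R x)) / t \<le> (INF q\<in>C. q x)"
    proof (rule great)
      fix q assume q: "q \<in> C"
      have "q (t *\<^sub>R x) = t * q x" using sl[OF q] t by (auto simp: sublinear_def)
      then show "(INF q\<in>C. q (t *\<^sub>R x)) / t \<le> q x"
        using low[OF q, of "t *\<^sub>R x"] t by (simp add: field_simps)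
    qed
    then show ?thesis using t by (simp add: field_simps)
  qed
  moreover have "t * (INF q\<in>C. q x) \<le> (INF q\<in>C. q (t *\<^sub>R x))" if t: "t > 0" for t x
    using le[of "1 / t" "t *\<^sub>R x"] t by (simp add: field_simps)
  ultimately show "sublinear (\<lambda>x. INF q\<in>C. q x)"
    unfolding sublinear_def by (auto intro: antisym)
qed

text \<open>A minimal sublinear functional \<open>q\<close> below \<open>p\<close> is linear: the
  cone spanned by (- v, - q v) yields a sublinear functional below \<open>q\<close>, which must be
  \<open>q\<close> itself, so q (- v) \<le> - q v. An odd sublinear functional is linear.\<close>

lemma sublinear_dominates_linear:
  fixes p :: "'v::real_vector \<Rightarrow> real"
  assumes p: "sublinear p"
  obtains f where "linear f" "\<And>x. f x \<le> p x"
proof -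
  define A where "A = {q :: 'v \<Rightarrow> real. sublinear q \<and> q \<le> p}"
  \<comment> \<open>The order is reversed, so that the maximal element from Zorn's lemma is a
    minimal functional.\<close>
  define P where "P = (\<lambda>a b :: 'v \<Rightarrow> real. b \<le> a)"
  have po: "partial_order_on A (relation_of P A)"
    by (auto simp: partial_order_on_def preorder_on_def relation_of_def P_def refl_on_def
        intro!: transI antisymI)
  have "\<exists>u\<in>A. \<forall>a\<in>C. P a u" if C: "C \<in> Chains (relation_of P A)" for C
  proof (cases "C = {}")
    case True
    then show ?thesis using p by (auto simp: A_def)
  next
    case False
    have CA: "q \<in> A" if "q \<in> C" for q using C that by (auto simp: Chains_def relation_of_def)
    have ch: "q \<le> q' \<or> q' \<le> q" if "q \<in> C" "q' \<in> C" for q q'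
      using C that by (auto simp: Chains_def relation_of_def P_def)
    have sl: "sublinear q" "q x \<le> p x" if "q \<in> C" for q x
      using CA[OF that] by (auto simp: A_def le_fun_def)
    have inf: "sublinear (\<lambda>x. INF q\<in>C. q x)" "\<And>q x. q \<in> C \<Longrightarrow> (INF q\<in>C. q x) \<le> q x"
      by (rule sublinear_chain[where p = p]; use False sl ch in blast)+
    obtain q where q: "q \<in> C" using False by blast
    have "(\<lambda>x. INF q\<in>C. q x) \<le> p"
      using order_trans[OF inf(2)[OF q] sl(2)[OF q]] by (auto simp: le_fun_def)
    then have "(\<lambda>x. INF q\<in>C. q x) \<in> A" using inf(1) by (simp add: A_def)
    moreover have "\<forall>a\<in>C. P a (\<lambda>x. INF q\<in>C. q x)" using inf(2) by (auto simp: P_def le_fun_def)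
    ultimately show ?thesis by blast
  qed
  from predicate_Zorn[OF po this] obtain q where q: "q \<in> A" and min: "\<And>a. a \<in> A \<Longrightarrow> a \<le> q \<Longrightarrow> a = q"
    unfolding P_def by blast
  have sq: "sublinear q" and qp: "q x \<le> p x" for x using q by (auto simp: A_def le_fun_def)
  have sub: "q (x + y) \<le> q x + q y" and hom: "t > 0 \<Longrightarrow> q (t *\<^sub>R x) = t * q x" for x y t
    using sq by (auto simp: sublinear_def)
  have odd: "q (- v) = - q v" for v
  proof -
    define G where "G = {(- t *\<^sub>R v, - t * q v) | t. t \<ge> 0}"
    have z: "(0, 0) \<in> G" by (auto simp: G_def intro!: exI[of _ 0])
    have a: "(m + m', r + r') \<in> G" if mr: "(m, r) \<in> G" "(m', r') \<in> G" for m r m' r'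
    proof -
      obtain t t' where "m = - t *\<^sub>R v" "r = - t * q v" "t \<ge> 0" "m' = - t' *\<^sub>R v" "r' = - t' * q v" "t' \<ge> 0"
        using mr unfolding G_def by blast
      then show ?thesis by (auto simp: G_def algebra_simps intro!: exI[of _ "t + t'"])
    qed
    have s: "(t *\<^sub>R m, t * r) \<in> G" if mr: "(m, r) \<in> G" "t > 0" for m r t
    proof -
      obtain t' where "m = - t' *\<^sub>R v" "r = - t' * q v" "t' \<ge> 0"
        using mr by (auto simp: G_def)
      then show ?thesis using mr(2) by (auto simp: G_def intro!: exI[of _ "t * t'"])
    qed
    have b: "0 \<le> r + q (- m)" if mr: "(m, r) \<in> G" for m r
    proof -
      obtain t where t: "m = - t *\<^sub>R v" "r = - t * q v" "t \<ge> 0"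
        using mr by (auto simp: G_def)
      have "q (t *\<^sub>R v) = t * q v" using hom[of t v] t sublinear_zero[OF sq] by (cases "t = 0") auto
      then show ?thesis by (simp add: t)
    qed
    obtain q' where q': "sublinear q'" "\<And>x. q' x \<le> q x" "\<And>m r. (m, r) \<in> G \<Longrightarrow> q' m \<le> r"
      using sublinear_cone[OF sq z a s b] by blast
    have "q' \<in> A" using q'(1) order_trans[OF q'(2) qp] by (simp add: A_def le_fun_def)
    then have "q' = q" using min q' by (auto simp: le_fun_def)
    moreover have "(- v, - q v) \<in> G" by (auto simp: G_def intro!: exI[of _ 1])
    ultimately have "q (- v) \<le> - q v" using q'(3) by blast
    moreover have "0 \<le> q v + q (- v)" using sub[of v "- v"] sublinear_zero[OF sq] by simp
    ultimately show ?thesis by simp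
  qed
  have "linear q"
  proof (rule linearI)
    show "q (x + y) = q x + q y" for x y
      using sub[of x y] sub[of "x + y" "- y"] odd[of y] by simp
    show "q (r *\<^sub>R x) = r *\<^sub>R q x" for r x
      using hom[of r x] hom[of "- r" x] odd[of "r *\<^sub>R x"] sublinear_zero[OF sq]
      by (cases r "0::real" rule: linorder_cases) auto
  qed
  then show thesis using that qp by blast
qed

text \<open>Values are prescribed by a relation instead of a functional on a subspace. This suits
  tensors represented by lists, where independence of the representative would otherwise have to
  come first. If \<open>G\<close> is closed under negation, the inequalities become
  equalities.\<close>

lemma hahn_banach_cone:
  fixes G :: "('v::real_normed_vector \<times> real) set"
  assumes "(0, 0) \<in> G"
    and "\<And>m r m' r'. (m, r) \<in> G \<Longrightarrow> (m', r') \<in> G \<Longrightarrow> (m + m', r + r') \<in> G"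
    and "\<And>m r t. (m, r) \<in> G \<Longrightarrow> t > 0 \<Longrightarrow> (t *\<^sub>R m, t * r) \<in> G"
    and "\<And>m r. (m, r) \<in> G \<Longrightarrow> - r \<le> norm m"
  obtains f where "linear f" "\<And>x. f x \<le> norm x" "\<And>m r. (m, r) \<in> G \<Longrightarrow> f m \<le> r"
proof -
  obtain q where q: "sublinear q" "\<And>x. q x \<le> norm x" "\<And>m r. (m, r) \<in> G \<Longrightarrow> q m \<le> r"
    by (rule sublinear_cone[OF sublinear_norm assms(1-3)])
      (use assms(4) in \<open>fastforce+\<close>)
  obtain f where "linear f" "\<And>x. f x \<le> q x" using sublinear_dominates_linear[OF q(1)] by blast
  then show thesis using that q by (meson order_trans)
qed

section \<open>Complex functionals and states\<close>

abbreviation cfunctional :: "('a::unital_cstar_algebra \<Rightarrow> complex) \<Rightarrow> bool"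
  where "cfunctional \<equiv> Vector_Spaces.linear scaleC (*)"

lemma vector_space_complex: "vector_space ((*) :: complex \<Rightarrow> complex \<Rightarrow> complex)"
  by unfold_locales (auto simp: algebra_simps)

lemma cfunctionalI:
  fixes f :: "'a::unital_cstar_algebra \<Rightarrow> complex"
  assumes "\<And>x y. f (x + y) = f x + f y" "\<And>c x. f (c *\<^sub>C x) = c * f x"
  shows "cfunctional f"
  using assms vector_space_scaleC vector_space_complex
  by (auto simp: Vector_Spaces.linear_def module_hom_def module_hom_axioms_def module_iff_vector_space)

lemma cfunctionalD:
  assumes "cfunctional f"
  shows "f (x + y) = f x + f y" "f (c *\<^sub>C x) = c * f x" "f 0 = 0" "f (- x) = - f x"
    "f (x - y) = f x - f y" "f (r *\<^sub>R x) = of_real r * f x" "f (sum g A) = (\<Sum>i\<in>A. f (g i))"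
proof -
  interpret Vector_Spaces.linear scaleC "(*)" f by fact
  show "f (x + y) = f x + f y" "f (c *\<^sub>C x) = c * f x" "f 0 = 0" "f (- x) = - f x"
    "f (x - y) = f x - f y" "f (sum g A) = (\<Sum>i\<in>A. f (g i))"
    by (rule add scale zero neg diff sum)+
  show "f (r *\<^sub>R x) = of_real r * f x" by (simp add: scaleR_conv_scaleC scale)
qed

text \<open>The complex functional with real part f is f x - i f (i x). Its modulus at x is its real
  part at c x, where the phase c rotates the value onto the positive axis, so the bound on f carries
  over.\<close>

lemma complexify:
  fixes f :: "'a::unital_cstar_algebra \<Rightarrow> real"
  assumes f: "linear f" and le: "\<And>x. f x \<le> norm x"
  obtains \<phi> where "cfunctional \<phi>" "\<And>x. Re (\<phi> x) = f x" "\<And>x. cmod (\<phi> x) \<le> norm x"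
proof -
  define \<phi> where "\<phi> x = Complex (f x) (- f (\<i> *\<^sub>C x))" for x
  note [simp] = linear_add[OF f] linear_diff[OF f] linear_scale[OF f] linear_0[OF f] linear_neg[OF f]
  have split: "c *\<^sub>C x = Re c *\<^sub>R x + Im c *\<^sub>R (\<i> *\<^sub>C x)" for c and x :: 'a
    by (subst complex_eq[of c])
      (simp add: scaleC_add_left scaleR_conv_scaleC scaleC_scaleC mult.commute)
  have ii: "\<i> *\<^sub>C \<i> *\<^sub>C x = - x" for x :: 'a by (simp add: scaleC_scaleC scaleC_minus_one)
  have "\<phi> (x + y) = \<phi> x + \<phi> y" for x y by (simp add: \<phi>_def scaleC_add_right complex_eq_iff)
  moreover have scale: "\<phi> (c *\<^sub>C x) = c * \<phi> x" for c x
  proof -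
    have "\<i> *\<^sub>C c *\<^sub>C x = Re c *\<^sub>R (\<i> *\<^sub>C x) - Im c *\<^sub>R x"
    proof -
      have "\<i> *\<^sub>C c *\<^sub>C x = c *\<^sub>C \<i> *\<^sub>C x" by (simp add: scaleC_scaleC mult.commute)
      also have "\<dots> = Re c *\<^sub>R (\<i> *\<^sub>C x) - Im c *\<^sub>R x"
        by (subst split[of c "\<i> *\<^sub>C x"]) (simp add: ii)
      finally show ?thesis .
    qed
    then show ?thesis by (simp add: \<phi>_def split[of c x] complex_eq_iff)
  qed
  ultimately have lin: "cfunctional \<phi>" by (rule cfunctionalI)
  have "cmod (\<phi> x) \<le> norm x" for x
  proof (cases "\<phi> x = 0")
    case False
    define c where "c = cnj (sgn (\<phi> x))"
    have cn: "cmod c = 1" using False by (simp add: c_def norm_sgn)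
    have "c * \<phi> x = of_real (cmod (\<phi> x))"
      using False unfolding c_def sgn_div_norm
      by (simp add: scaleR_conv_of_real field_simps complex_norm_square[symmetric] power2_eq_square)
    then have "cmod (\<phi> x) = Re (\<phi> (c *\<^sub>C x))" using scale[of c x] by simp
    also have "\<dots> = f (c *\<^sub>C x)" by (simp add: \<phi>_def)
    also have "\<dots> \<le> norm (c *\<^sub>C x)" by (rule le)
    finally show ?thesis using cn by (simp add: norm_scaleC)
  qed simp
  with lin show thesis using that[of \<phi>] by (simp add: \<phi>_def)
qed

lemma self_adjoint_cartesian:
  fixes x :: "'a::unital_cstar_algebra"
  obtains h k where "star h = h" "star k = k" "x = h + \<i> *\<^sub>C k"
proof (rule that[of "(1/2) *\<^sub>R (x + star x)" "(1/2) *\<^sub>R (\<i> *\<^sub>C (star x - x))"])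
  show "star ((1/2) *\<^sub>R (x + star x)) = (1/2) *\<^sub>R (x + star x)"
    by (simp add: star_add star_star add.commute)
  have "(- \<i>) *\<^sub>C (x - star x) = \<i> *\<^sub>C (star x - x)"
    by (simp add: scaleC_diff_right)
  then show "star ((1/2) *\<^sub>R (\<i> *\<^sub>C (star x - x))) = (1/2) *\<^sub>R (\<i> *\<^sub>C (star x - x))"
    by (simp add: star_scaleC star_diff star_star)
  have "\<i> *\<^sub>C (1/2) *\<^sub>R \<i> *\<^sub>C (star x - x) = (1/2) *\<^sub>R (x - star x)"
    by (simp add: scaleR_conv_scaleC scaleC_scaleC scaleC_diff_right)
  then show "x = (1/2) *\<^sub>R (x + star x) + \<i> *\<^sub>C (1/2) *\<^sub>R \<i> *\<^sub>C (star x - x)"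
    by (simp add: scaleR_right_distrib scaleR_right_diff_distrib flip: scaleR_left_distrib)
qed

text \<open>Hahn-Banach controls only the norm; this recovers positivity. The real part is handled
  by the distance of p from t in the definition of \<open>pos\<close>, the imaginary part by
  shifting p along the imaginary axis.\<close>

lemma state_if_contractive:
  assumes lin: "cfunctional \<phi>" and one: "\<phi> 1 = 1" and le: "\<And>x. cmod (\<phi> x) \<le> norm x"
  shows "state \<phi>"
proof -
  note [simp] = cfunctionalD[OF lin] one
  have "\<phi> p \<in> \<real>\<^sub>\<ge>\<^sub>0" if p: "pos p" for p
  proof -
    have sa: "star p = p" using p by (rule pos_star)
    have "Im (\<phi> p) = 0"
    proof -
      text \<open>\<open>\<parallel>p + i t\<parallel>\<^sup>2 \<le> \<parallel>p\<parallel>\<^sup>2 + t\<^sup>2\<close> for real \<open>t\<close>, whereas \<open>\<phi> (p + i t) = \<phi> p + i t\<close>.\<close>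
      have key: "2 * t * Im (\<phi> p) \<le> (norm p)\<^sup>2" for t :: real
      proof -
        define g where "g = p + (\<i> * complex_of_real t) *\<^sub>C 1"
        have sg: "star g = p - (\<i> * complex_of_real t) *\<^sub>C 1"
          using sa cvec.scale_minus_left[of "\<i> * complex_of_real t" "1 :: 'a"]
          by (simp add: g_def star_add star_scaleC)
        have "star g * g = p * p + (t * t) *\<^sub>R 1"
          unfolding sg unfolding g_def
          by (simp add: algebra_simps mult_scaleC_left mult_scaleC_right scaleC_scaleC
              scaleR_conv_scaleC)
        then have "(norm g)\<^sup>2 \<le> (norm p)\<^sup>2 + t\<^sup>2"
          using cstar_identity[of g] norm_triangle_ineq[of "p * p" "(t * t) *\<^sub>R 1"]
            norm_square_self_adjoint[OF sa] by (simp add: power2_eq_square)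
        moreover have "cmod (\<phi> g) ^ 2 \<le> (norm g)\<^sup>2" using le by (intro power_mono) auto
        moreover have "\<phi> g = \<phi> p + \<i> * complex_of_real t" by (simp add: g_def)
        then have "cmod (\<phi> g) ^ 2 = (Re (\<phi> p))\<^sup>2 + (Im (\<phi> p) + t)\<^sup>2" by (simp add: cmod_power2)
        moreover have "(Im (\<phi> p) + t)\<^sup>2 = (Im (\<phi> p))\<^sup>2 + 2 * t * Im (\<phi> p) + t\<^sup>2"
          by (simp add: power2_sum)
        ultimately show ?thesis by (smt (verit) zero_le_power2)
      qed
      show ?thesis
      proof (rule ccontr)
        assume "Im (\<phi> p) \<noteq> 0"
        then have "2 * (((norm p)\<^sup>2 + 1) / (2 * Im (\<phi> p))) * Im (\<phi> p) = (norm p)\<^sup>2 + 1" by simp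
        with key[of "((norm p)\<^sup>2 + 1) / (2 * Im (\<phi> p))"] show False by simp
      qed
    qed
    moreover obtain t where t: "t \<ge> 0" "norm (t *\<^sub>R 1 - p) \<le> t" using p by (auto simp: pos_def)
    have "\<phi> (t *\<^sub>R 1 - p) = of_real t - \<phi> p" by simp
    then have "t - Re (\<phi> p) \<le> t"
      using le[of "t *\<^sub>R 1 - p"] t complex_Re_le_cmod[of "of_real t - \<phi> p"] by simp
    ultimately show ?thesis by (simp add: complex_nonneg_Reals_iff)
  qed
  then show ?thesis using lin by (simp add: state_def pos_cstar_square)
qed

lemma stateD:
  assumes "state \<phi>"
  shows "cfunctional \<phi>" "\<phi> 1 = 1" "\<phi> (star a * a) \<in> \<real>\<^sub>\<ge>\<^sub>0" "0 \<le> Re (\<phi> (star a * a))"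
    "Im (\<phi> (star a * a)) = 0"
  using assms by (auto simp: state_def complex_nonneg_Reals_iff)

lemmas state_linear = cfunctionalD[OF stateD(1)]

lemma state_self_adjoint:
  assumes "state \<phi>" "star h = h"
  shows "Im (\<phi> h) = 0"
proof -
  have "star (h + 1) * (h + 1) - star (h - 1) * (h - 1) = h + h + h + h"
    using assms(2) by (simp add: star_add star_diff algebra_simps)
  also have "\<dots> = (1 + 1 + 1 + 1) *\<^sub>R h" by (simp only: scaleR_left_distrib scaleR_one)
  finally have "4 *\<^sub>R h = star (h + 1) * (h + 1) - star (h - 1) * (h - 1)" by simp
  then have "\<phi> (4 *\<^sub>R h) = \<phi> (star (h + 1) * (h + 1)) - \<phi> (star (h - 1) * (h - 1))"
    by (simp only: state_linear[OF assms(1)])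
  then have "Im (\<phi> (4 *\<^sub>R h)) = 0" using stateD(5)[OF assms(1)] by simp
  then show ?thesis by (simp add: state_linear[OF assms(1)])
qed

lemma state_star: "state \<phi> \<Longrightarrow> \<phi> (star x) = cnj (\<phi> x)"
proof -
  assume \<phi>: "state \<phi>"
  obtain h k where hk: "star h = h" "star k = k" "x = h + \<i> *\<^sub>C k" by (rule self_adjoint_cartesian)
  have "cnj (\<phi> h) = \<phi> h" "cnj (\<phi> k) = \<phi> k"
    using state_self_adjoint[OF \<phi> hk(1)] state_self_adjoint[OF \<phi> hk(2)] by (auto simp: complex_eq_iff)
  then show ?thesis by (simp add: hk star_add star_scaleC state_linear[OF \<phi>])
qed

text \<open>The squared norm of \<open>a\<close> minus a* a is positive, hence the square of a
  self-adjoint element. Stated for unnormalised \<open>f\<close>, since it is later applied to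
  functionals whose value at 1 is the squared length of a vector.\<close>

lemma positive_functional_le:
  assumes f: "cfunctional f" and pos: "\<And>a. 0 \<le> Re (f (star a * a))"
  shows "Re (f (star a * a)) \<le> (norm a)\<^sup>2 * Re (f 1)"
proof -
  have "norm (star a * a) = (norm a)\<^sup>2" by (rule cstar_identity)
  moreover have "star (star a * a) = star a * a" by (simp add: star_mult star_star)
  ultimately have "pos ((norm a)\<^sup>2 *\<^sub>R 1 - star a * a)" by (simp add: pos_if_norm_le)
  then obtain s where "pos s" "s * s = (norm a)\<^sup>2 *\<^sub>R 1 - star a * a" by (rule pos_sqrt)
  then have "0 \<le> Re (f ((norm a)\<^sup>2 *\<^sub>R 1 - star a * a))" using pos[of s] by (simp add: pos_star)
  then show ?thesis by (simp add: cfunctionalD[OF f])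
qed

lemma state_cauchy_schwarz_one:
  assumes \<phi>: "state \<phi>"
  shows "(cmod (\<phi> x))\<^sup>2 \<le> Re (\<phi> (star x * x))"
proof -
  \<comment> \<open>Subtracting the mean makes \<open>\<phi> (star z * z)\<close> the variance of
    \<open>x\<close>.\<close>
  define z where "z = x - \<phi> x *\<^sub>C 1"
  have "star z * z = star x * x - \<phi> x *\<^sub>C star x - cnj (\<phi> x) *\<^sub>C x + (cnj (\<phi> x) * \<phi> x) *\<^sub>C 1"
    by (simp add: z_def star_diff star_scaleC algebra_simps mult_scaleC_left mult_scaleC_right
        scaleC_scaleC)
  then have "\<phi> (star z * z) = \<phi> (star x * x) - cnj (\<phi> x) * \<phi> x"
    by (simp add: state_linear[OF \<phi>] state_star[OF \<phi>] stateD(2)[OF \<phi>])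
  moreover have "Re (cnj (\<phi> x) * \<phi> x) = (cmod (\<phi> x))\<^sup>2" unfolding cmod_power2 by (simp add: power2_eq_square)
  ultimately show ?thesis using stateD(4)[OF \<phi>, of z] by simp
qed

lemma state_contractive: "state \<phi> \<Longrightarrow> cmod (\<phi> x) \<le> norm x"
proof -
  assume \<phi>: "state \<phi>"
  have "(cmod (\<phi> x))\<^sup>2 \<le> Re (\<phi> (star x * x))" by (rule state_cauchy_schwarz_one[OF \<phi>])
  also have "\<dots> \<le> (norm x)\<^sup>2"
    using positive_functional_le[OF stateD(1,4)[OF \<phi>], of x] by (simp add: stateD(2)[OF \<phi>])
  finally show ?thesis by (rule power2_le_imp_le) simp
qed

text \<open>Cauchy-Schwarz for a null vector: at y* - l z, with l equal to t times the conjugate of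
  \<phi> (y z), the nonnegative value is M - 2 t c. It decreases without bound in t unless c = 0;
  the chosen t makes it -1.\<close>

lemma state_null_left_kernel:
  assumes \<phi>: "state \<phi>" and null: "\<phi> (star z * z) = 0"
  shows "\<phi> (y * z) = 0"
proof (rule ccontr)
  assume nz: "\<phi> (y * z) \<noteq> 0"
  define M where "M = Re (\<phi> (y * star y))"
  define c where "c = cmod (\<phi> (y * z)) ^ 2"
  have c: "c > 0" using nz by (simp add: c_def)
  have "2 * t * c \<le> M * 1" if t: "t = (M + 1) / (2 * c)" for t
  proof -
    define l where "l = of_real t * cnj (\<phi> (y * z))"
    define w where "w = star y - l *\<^sub>C z"
    have "star w * w = y * star y - l *\<^sub>C (y * z) - cnj l *\<^sub>C star (y * z) + (cnj l * l) *\<^sub>C (star z * z)"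
      by (simp add: w_def star_diff star_scaleC star_star star_mult algebra_simps mult_scaleC_left
          mult_scaleC_right scaleC_scaleC)
    then have "\<phi> (star w * w) = \<phi> (y * star y) - l * \<phi> (y * z) - cnj (l * \<phi> (y * z))"
      by (simp add: state_linear[OF \<phi>] state_star[OF \<phi>] null)
    moreover have "l * \<phi> (y * z) = of_real (t * c)"
      by (simp add: l_def c_def complex_norm_square[of "\<phi> (y * z)"] mult.commute mult.left_commute del: of_real_power)
    ultimately have "Re (\<phi> (star w * w)) = M - 2 * (t * c)" by (simp add: M_def)
    then show ?thesis using stateD(4)[OF \<phi>, of w] by simp
  qed
  from this[OF refl] show False using c by simp
qed

text \<open>One of 1 + h and 1 - h has norm 2: otherwise both are at most some s < 2 in the order,
  and h has norm at most s - 1 < 1. A functional of norm at most 1 with real part 2 at 1 + e h must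
  be 1 at 1, so it is a state, and its real part at h is e.\<close>

lemma state_exists_norming:
  assumes sa: "star h = h" and n: "norm h = 1"
  obtains \<phi> where "state \<phi>" "\<phi> h \<noteq> 0"
proof -
  have "norm (1 + h) = 2 \<or> norm (1 - h) = 2"
  proof (rule ccontr)
    assume neg: "\<not> ?thesis"
    have le: "norm (1 + h) \<le> 2" "norm (1 - h) \<le> 2"
      using norm_triangle_ineq[of 1 h] norm_triangle_ineq4[of 1 h] n by auto
    define s where "s = max (norm (1 + h)) (norm (1 - h))"
    have s: "s < 2" using neg le by (auto simp: s_def)
    have "(1 + h) + (1 - h) = 2" by simp
    then have "2 \<le> norm (1 + h) + norm (1 - h)"
      using norm_triangle_ineq[of "1 + h" "1 - h"] by (metis norm_numeral)
    then have s1: "1 \<le> s" by (auto simp: s_def)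
    have "pos (s *\<^sub>R 1 - (1 + h))" "pos (s *\<^sub>R 1 - (1 - h))"
      using sa by (auto intro!: pos_if_norm_le simp: star_add star_diff s_def)
    then have "norm h \<le> s - 1"
      using s1 sa by (intro norm_le_if_pos) (auto simp: algebra_simps)
    then show False using n s by simp
  qed
  then obtain e :: real where e: "abs e = 1" and en: "norm (1 + e *\<^sub>R h) = 2"
    by (metis abs_1 abs_minus_cancel scaleR_minus1_left scaleR_one diff_conv_add_uminus)
  define v where "v = 1 + e *\<^sub>R h"
  define G where "G = {(t *\<^sub>R v, t * 2) | t. True}"
  obtain f where f: "linear f" "\<And>x. f x \<le> norm x" "\<And>m r. (m, r) \<in> G \<Longrightarrow> f m \<le> r"
  proof (rule hahn_banach_cone[of G])
    show "(0, 0) \<in> G" by (auto simp: G_def intro!: exI[of _ 0])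
    show "(m + m', r + r') \<in> G" if "(m, r) \<in> G" "(m', r') \<in> G" for m r m' r'
      using that by (auto simp: G_def scaleR_left_distrib[symmetric] distrib_right[symmetric] simp del: distrib_right_numeral)
    show "(t *\<^sub>R m, t * r) \<in> G" if "(m, r) \<in> G" "t > 0" for m r t
      using that by (auto simp: G_def)
    show "- r \<le> norm m" if "(m, r) \<in> G" for m r
      using that en by (auto simp: G_def v_def)
  qed (use that in blast)
  obtain \<phi> where \<phi>: "cfunctional \<phi>" "\<And>x. Re (\<phi> x) = f x" "\<And>x. cmod (\<phi> x) \<le> norm x"
    using complexify[OF f(1,2)] by blast
  have "f (- v) \<le> - 2" using f(3)[of "- v" "- 2"] by (auto simp: G_def intro!: exI[of _ "-1"])
  then have "2 \<le> Re (\<phi> 1) + e * Re (\<phi> h)"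
    by (simp add: \<phi>(2) v_def linear_neg[OF f(1)] linear_add[OF f(1)] linear_diff[OF f(1)] linear_scale[OF f(1)])
  moreover have "Re (\<phi> 1) \<le> cmod (\<phi> 1)" "cmod (\<phi> 1) \<le> 1" using \<phi>(3)[of 1] complex_Re_le_cmod by auto
  moreover have "e * Re (\<phi> h) \<le> 1"
    using \<phi>(3)[of h] n abs_Re_le_cmod[of "\<phi> h"] e by (metis abs_le_D1 abs_mult mult_1 order_trans)
  ultimately have r1: "Re (\<phi> 1) = 1" and rh: "Re (\<phi> h) \<noteq> 0" and "cmod (\<phi> 1) \<le> 1" by auto
  then have "(cmod (\<phi> 1))\<^sup>2 \<le> 1" by (simp add: power_le_one)
  then have "Im (\<phi> 1) = 0" using r1 unfolding cmod_power2 by simp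
  then have "\<phi> 1 = 1" using r1 by (simp add: complex_eq_iff)
  then have "state \<phi>" using \<phi> by (intro state_if_contractive)
  then show thesis using that rh by force
qed

lemma states_separate_points:
  assumes z: "\<And>\<phi>. state \<phi> \<Longrightarrow> \<phi> x = 0"
  shows "x = 0"
proof -
  have sa: "h = 0" if h: "star h = h" "\<And>\<phi>. state \<phi> \<Longrightarrow> \<phi> h = 0" for h :: 'a
  proof (rule ccontr)
    assume "h \<noteq> 0"
    then obtain \<phi> where "state \<phi>" "\<phi> ((1 / norm h) *\<^sub>R h) \<noteq> 0"
      using state_exists_norming[of "(1 / norm h) *\<^sub>R h"] h(1) by auto
    then show False using h(2) by (simp add: state_linear)
  qed
  obtain h k where hk: "star h = h" "star k = k" "x = h + \<i> *\<^sub>C k" by (rule self_adjoint_cartesian)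
  have "\<phi> h = 0 \<and> \<phi> k = 0" if \<phi>: "state \<phi>" for \<phi>
  proof -
    have "Re (\<phi> h) = 0" "Re (\<phi> k) = 0"
      using z[OF \<phi>] state_self_adjoint[OF \<phi> hk(1)] state_self_adjoint[OF \<phi> hk(2)]
      by (auto simp: hk(3) state_linear[OF \<phi>] complex_eq_iff)
    then show ?thesis
      using state_self_adjoint[OF \<phi> hk(1)] state_self_adjoint[OF \<phi> hk(2)] by (auto simp: complex_eq_iff)
  qed
  then have "h = 0" "k = 0" using sa hk by blast+
  then show ?thesis by (simp add: hk(3))
qed

section \<open>Product states\<close>

definition tensor_form ::
    "('a::unital_cstar_algebra \<Rightarrow> complex) \<Rightarrow> ('b::unital_cstar_algebra \<Rightarrow> complex) \<Rightarrow>
     ('a \<times> 'b) list \<Rightarrow> ('a \<times> 'b) list \<Rightarrow> complex"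
  where "tensor_form \<phi> \<psi> xs ys = (\<Sum>(a, b)\<leftarrow>xs. \<Sum>(c, d)\<leftarrow>ys. \<phi> (star a * c) * \<psi> (star b * d))"

lemma product_functional_simps [simp]:
  "product_functional \<phi> \<psi> [] = 0"
  "product_functional \<phi> \<psi> ((a, b) # xs) = \<phi> a * \<psi> b + product_functional \<phi> \<psi> xs"
  "product_functional \<phi> \<psi> (xs @ ys) = product_functional \<phi> \<psi> xs + product_functional \<phi> \<psi> ys"
  by (auto simp: product_functional_def)

lemma alg_mult_simps:
  "alg_mult [] ys = []"
  "alg_mult ((a, b) # xs) ys = map (\<lambda>(c, d). (a * c, b * d)) ys @ alg_mult xs ys"
  by (auto simp: alg_mult_def)

lemma alg_star_simps:
  "alg_star [] = []"
  "alg_star ((a, b) # xs) = (star a, star b) # alg_star xs"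
  by (auto simp: alg_star_def)

lemma product_functional_star_mult:
  "product_functional \<phi> \<psi> (alg_mult (alg_star xs) ys) = tensor_form \<phi> \<psi> xs ys"
proof (induction xs)
  case (Cons p xs)
  obtain a b where "p = (a, b)" by fastforce
  with Cons show ?case
    by (simp add: alg_star_simps alg_mult_simps tensor_form_def product_functional_def comp_def
        case_prod_unfold)
qed (simp add: alg_star_simps alg_mult_simps tensor_form_def)

lemma tensor_form_Nil [simp]: "tensor_form \<phi> \<psi> [] ys = 0" "tensor_form \<phi> \<psi> xs [] = 0"
  by (induction xs) (auto simp: tensor_form_def)

lemma tensor_form_append:
  "tensor_form \<phi> \<psi> (xs @ ys) zs = tensor_form \<phi> \<psi> xs zs + tensor_form \<phi> \<psi> ys zs"
  "tensor_form \<phi> \<psi> zs (xs @ ys) = tensor_form \<phi> \<psi> zs xs + tensor_form \<phi> \<psi> zs ys"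
  by (induction zs) (auto simp: tensor_form_def)

lemma tensor_form_single:
  "tensor_form \<phi> \<psi> [(a, b)] [(c, d)] = \<phi> (star a * c) * \<psi> (star b * d)"
  by (simp add: tensor_form_def)

lemma tensor_form_Cons:
  "tensor_form \<phi> \<psi> (x # xs) zs = tensor_form \<phi> \<psi> [x] zs + tensor_form \<phi> \<psi> xs zs"
  "tensor_form \<phi> \<psi> zs (x # xs) = tensor_form \<phi> \<psi> zs [x] + tensor_form \<phi> \<psi> zs xs"
  using tensor_form_append[of \<phi> \<psi> "[x]" xs] tensor_form_append(2)[of \<phi> \<psi> zs "[x]" xs] by auto

locale two_states =
  fixes \<phi> :: "'a::unital_cstar_algebra \<Rightarrow> complex" and \<psi> :: "'b::unital_cstar_algebra \<Rightarrow> complex"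
  assumes \<phi>: "state \<phi>" and \<psi>: "state \<psi>"
begin

lemmas [simp] = state_linear[OF \<phi>] state_linear[OF \<psi>] stateD(2)[OF \<phi>] stateD(2)[OF \<psi>]

abbreviation B where "B \<equiv> tensor_form \<phi> \<psi>"

lemma form_hermitian: "B ys xs = cnj (B xs ys)"
proof (induction xs)
  case (Cons x xs)
  obtain a b where x: "x = (a, b)" by fastforce
  have "B ys [x] = cnj (B [x] ys)"
  proof (induction ys)
    case (Cons y ys)
    obtain c d where y: "y = (c, d)" by fastforce
    have "B [y] [x] = cnj (B [x] [y])"
      unfolding x y tensor_form_single
      using state_star[OF \<phi>, of "star a * c"] state_star[OF \<psi>, of "star b * d"]
      by (simp add: star_mult star_star)
    with Cons show ?case
      using tensor_form_Cons(1)[of \<phi> \<psi> y ys "[x]"] tensor_form_Cons(2)[of \<phi> \<psi> "[x]" y ys] by simp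
  qed simp
  with Cons show ?case
    using tensor_form_Cons(2)[of \<phi> \<psi> ys x xs] tensor_form_Cons(1)[of \<phi> \<psi> x xs ys] by simp
qed simp

text \<open>Lists with the same pairings are the same vector for the form; hermiticity carries the
  hypothesis over to the other argument. This permits replacing a list by another expression for the
  same tensor.\<close>

lemma form_cong:
  assumes "\<And>z. B z xs = B z ys"
  shows "B xs xs = B ys ys"
  by (metis assms form_hermitian)

definition pairing where "pairing z a b = B z [(a, b)]"

lemma form_eq_pairing: "B z xs = (\<Sum>(a, b)\<leftarrow>xs. pairing z a b)"
proof (induction xs)
  case (Cons p xs)
  then show ?case using tensor_form_Cons(2)[of \<phi> \<psi> z p xs] by (cases p) (simp add: pairing_def)
qed simp

lemma pairing_bilinear: "cfunctional (\<lambda>a. pairing z a b)" "cfunctional (pairing z a)"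
proof -
  show "cfunctional (\<lambda>a. pairing z a b)"
    by (rule cfunctionalI; induction z)
      (auto simp: pairing_def tensor_form_def algebra_simps mult_scaleC_right)
  show "cfunctional (pairing z a)"
    by (rule cfunctionalI; induction z)
      (auto simp: pairing_def tensor_form_def algebra_simps mult_scaleC_right)
qed

lemmas pairing_simps = cfunctionalD[OF pairing_bilinear(1)] cfunctionalD[OF pairing_bilinear(2)]

text \<open>Bilinearity: for each pair (c, d) the part \<open>l d *\<^sub>C b\<close> of d is moved
  into the first factor of the leading pair.\<close>

lemma form_shift:
  "B z ((a, b) # ys) =
   B z ((a + (\<Sum>(c, d)\<leftarrow>ys. l d *\<^sub>C c), b) # map (\<lambda>(c, d). (c, d - l d *\<^sub>C b)) ys)"
  unfolding form_eq_pairing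
  by (induction ys) (auto simp: pairing_simps)

text \<open>
  Positivity of the product functional (the Schur product theorem) by Gram--Schmidt
  orthogonalisation in the second factor.
\<close>

lemma form_nonneg: "0 \<le> Re (B xs xs)"
\<comment> \<open>The induction is on the length, because orthogonalisation alters the tail.\<close>
proof (induction "length xs" arbitrary: xs)
  case 0
  then show ?case by simp
next
  case (Suc n)
  then obtain a b ys where xs: "xs = (a, b) # ys" by (cases xs) auto
  \<comment> \<open>The coefficient of the projection of \<open>d\<close> onto \<open>b\<close>. If
    \<open>\<psi> (star b * b)\<close> vanishes, the quotient is 0 by convention, and orthogonality
    holds because \<open>b\<close> is a null vector.\<close>
  define l where "l d = \<psi> (star b * d) / \<psi> (star b * b)" for d
  define \<alpha> where "\<alpha> = a + (\<Sum>(c, d)\<leftarrow>ys. l d *\<^sub>C c)"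
  define ys' where "ys' = map (\<lambda>(c, d). (c, d - l d *\<^sub>C b)) ys"
  have "B z xs = B z ((\<alpha>, b) # ys')" for z
    unfolding xs \<alpha>_def ys'_def by (rule form_shift)
  then have "B xs xs = B ((\<alpha>, b) # ys') ((\<alpha>, b) # ys')" by (rule form_cong)
  also have "\<dots> = B [(\<alpha>, b)] [(\<alpha>, b)] + B [(\<alpha>, b)] ys' + (B ys' [(\<alpha>, b)] + B ys' ys')"
    using tensor_form_Cons(1)[of \<phi> \<psi> "(\<alpha>, b)" ys'] tensor_form_Cons(2)[of \<phi> \<psi> _ "(\<alpha>, b)" ys']
    by simp
  also have "B [(\<alpha>, b)] ys' = 0"
  proof -
    have orth: "\<psi> (star b * (d - l d *\<^sub>C b)) = 0" for d
      using state_null_left_kernel[OF \<psi>, of b "star d"]  state_star[OF \<psi>, of "star d * b"]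
      by (cases "\<psi> (star b * b) = 0")
        (auto simp: right_diff_distrib mult_scaleC_right l_def star_mult star_star)
    show ?thesis unfolding ys'_def
      by (induction ys) (auto simp: tensor_form_def orth)
  qed
  also have "B ys' [(\<alpha>, b)] = 0" using form_hermitian[of ys' "[(\<alpha>, b)]"] \<open>B [(\<alpha>, b)] ys' = 0\<close> by simp
  finally have "B xs xs = \<phi> (star \<alpha> * \<alpha>) * \<psi> (star b * b) + B ys' ys'"
    by (simp add: tensor_form_single)
  moreover have "0 \<le> Re (\<phi> (star \<alpha> * \<alpha>) * \<psi> (star b * b))"
    using stateD(4,5)[OF \<phi>, of \<alpha>] stateD(4,5)[OF \<psi>, of b] by simp
  moreover have "0 \<le> Re (B ys' ys')" using Suc by (simp add: ys'_def xs)
  ultimately show ?case by simp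
qed

lemma form_map_left:
  "B (map (\<lambda>(c, d). (a * c, d)) xs) ys = B xs (map (\<lambda>(c, d). (star a * c, d)) ys)"
  "B (map (\<lambda>(c, d). (c, b * d)) xs) ys = B xs (map (\<lambda>(c, d). (c, star b * d)) ys)"
  by (simp_all add: tensor_form_def comp_def case_prod_unfold star_mult mult.assoc)

text \<open>Letting a act on the first factors of the second argument makes B y y a positive
  functional of a, with value B y y at a = 1, so \<open>positive_functional_le\<close> applies;
  likewise for the second factors.\<close>

lemma form_mult_le:
  "Re (B (map (\<lambda>(c, d). (a * c, d)) y) (map (\<lambda>(c, d). (a * c, d)) y)) \<le> (norm a)\<^sup>2 * Re (B y y)"
  "Re (B (map (\<lambda>(c, d). (c, b * d)) y) (map (\<lambda>(c, d). (c, b * d)) y)) \<le> (norm b)\<^sup>2 * Re (B y y)"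
proof -
  have "cfunctional (\<lambda>a. B z (map (\<lambda>(c, d). (a * c, d)) y))" for z
    unfolding form_eq_pairing
    by (rule cfunctionalI; induction y)
      (auto simp: pairing_simps distrib_left distrib_right mult_scaleC_left)
  moreover have "B y (map (\<lambda>(c, d). (star a * a * c, d)) y) =
      B (map (\<lambda>(c, d). (a * c, d)) y) (map (\<lambda>(c, d). (a * c, d)) y)" for a
    unfolding form_map_left by (simp add: comp_def case_prod_unfold mult.assoc)
  ultimately show "Re (B (map (\<lambda>(c, d). (a * c, d)) y) (map (\<lambda>(c, d). (a * c, d)) y))
      \<le> (norm a)\<^sup>2 * Re (B y y)"
    using positive_functional_le[of "\<lambda>a. B y (map (\<lambda>(c, d). (a * c, d)) y)" a] form_nonneg
    by (simp add: case_prod_unfold)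
  have "cfunctional (\<lambda>a. B z (map (\<lambda>(c, d). (c, a * d)) y))" for z
    unfolding form_eq_pairing
    by (rule cfunctionalI; induction y)
      (auto simp: pairing_simps distrib_left distrib_right mult_scaleC_left)
  moreover have "B y (map (\<lambda>(c, d). (c, star b * b * d)) y) =
      B (map (\<lambda>(c, d). (c, b * d)) y) (map (\<lambda>(c, d). (c, b * d)) y)" for b
    unfolding form_map_left by (simp add: comp_def case_prod_unfold mult.assoc)
  ultimately show "Re (B (map (\<lambda>(c, d). (c, b * d)) y) (map (\<lambda>(c, d). (c, b * d)) y))
      \<le> (norm b)\<^sup>2 * Re (B y y)"
    using positive_functional_le[of "\<lambda>b. B y (map (\<lambda>(c, d). (c, b * d)) y)" b] form_nonneg
    by (simp add: case_prod_unfold)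
qed

text \<open>Nonnegativity of the form at xs - ys; \<open>n\<close> represents - ys, with the sign
  put into the first factors.\<close>

lemma form_parallelogram_le: "Re (B (xs @ ys) (xs @ ys)) \<le> 2 * Re (B xs xs) + 2 * Re (B ys ys)"
proof -
  define n where "n = map (\<lambda>(c, d :: 'b). (- 1 * c :: 'a, d)) ys"
  have neg: "B z n = - B z ys" for z
    unfolding n_def form_eq_pairing by (induction ys) (auto simp: pairing_simps)
  have neg': "B n z = - B ys z" for z
    using form_hermitian[of n z] form_hermitian[of ys z] neg[of z] by simp
  show ?thesis
    using form_nonneg[of "xs @ n"] by (simp add: tensor_form_append neg neg')
qed

text \<open>Cauchy-Schwarz against the unit vector 1 \<otimes> 1, obtained from nonnegativity at xs
  minus its component along that vector.\<close>

lemma form_functional_le: "(cmod (product_functional \<phi> \<psi> xs))\<^sup>2 \<le> Re (B xs xs)"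
proof -
  define p where "p = product_functional \<phi> \<psi> xs"
  have 1: "B [(1, 1)] xs = p"
    unfolding p_def product_functional_star_mult[symmetric]
    by (simp add: alg_star_simps alg_mult_simps)
  have "B z [((- p) *\<^sub>C 1, 1)] = - p * B z [(1, 1)]" for z
    by (simp add: form_eq_pairing pairing_simps)
  moreover from this have "B [((- p) *\<^sub>C 1, 1)] z = - cnj p * B [(1, 1)] z" for z
    using form_hermitian[of "[((- p) *\<^sub>C 1, 1)]" z] form_hermitian[of "[(1, 1)]" z] by simp
  moreover have "B xs [(1, 1)] = cnj p" using form_hermitian[of xs "[(1, 1)]"] 1 by simp
  moreover have "B [(1, 1)] [(1, 1)] = 1" by (simp add: tensor_form_single)
  ultimately have "B (xs @ [((- p) *\<^sub>C 1, 1)]) (xs @ [((- p) *\<^sub>C 1, 1)]) = B xs xs - p * cnj p"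
    by (simp add: tensor_form_append 1)
  then have "0 \<le> Re (B xs xs) - Re (p * cnj p)" using form_nonneg by (metis minus_complex.simps(1))
  moreover have "Re (p * cnj p) = (cmod p)\<^sup>2" unfolding cmod_power2 by (simp add: power2_eq_square)
  ultimately show ?thesis by (simp add: p_def)
qed

end

text \<open>The constant depends on \<open>xs\<close> only and is uniform in the states and in
  \<open>y\<close>. It bounds the set in \<open>spatial_norm\<close>, whose \<open>Sup\<close> says
  nothing about the members of an unbounded set.\<close>

lemma form_mult_bounded:
  fixes xs :: "('a::unital_cstar_algebra \<times> 'b::unital_cstar_algebra) list"
  shows "\<exists>K. \<forall>\<phi> \<psi> y. state \<phi> \<longrightarrow> state \<psi> \<longrightarrow>
    Re (tensor_form \<phi> \<psi> (alg_mult xs y) (alg_mult xs y)) \<le> K * Re (tensor_form \<phi> \<psi> y y)"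
  proof (induction xs)
    case Nil
    then show ?case by (intro exI[of _ 0]) (simp add: alg_mult_simps)
  next
    case (Cons p xs)
    then obtain K where K: "\<And>\<phi> \<psi> y. state \<phi> \<Longrightarrow> state \<psi> \<Longrightarrow>
      Re (tensor_form \<phi> \<psi> (alg_mult xs y) (alg_mult xs y)) \<le> K * Re (tensor_form \<phi> \<psi> y y)" by blast
    obtain a b where p: "p = (a, b)" by fastforce
    define L where "L = 2 * ((norm a)\<^sup>2 * (norm b)\<^sup>2) + 2 * K"
    have "Re (tensor_form \<phi> \<psi> (alg_mult (p # xs) y) (alg_mult (p # xs) y)) \<le> L * Re (tensor_form \<phi> \<psi> y y)"
      if \<phi>\<psi>: "state \<phi>" "state \<psi>" for \<phi> \<psi> y
    proof -
      interpret two_states \<phi> \<psi> using \<phi>\<psi> by unfold_locales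
      define y1 where "y1 = map (\<lambda>(c, d). (c, b * d)) y"
      define y2 where "y2 = map (\<lambda>(c, d). (a * c, d)) y1"
      have y2: "map (\<lambda>(c, d). (a * c, b * d)) y = y2" by (simp add: y1_def y2_def case_prod_unfold)
      have "Re (B y2 y2) \<le> (norm a)\<^sup>2 * Re (B y1 y1)" unfolding y2_def by (rule form_mult_le)
      also have "\<dots> \<le> (norm a)\<^sup>2 * ((norm b)\<^sup>2 * Re (B y y))"
        unfolding y1_def by (intro mult_left_mono form_mult_le) auto
      finally show ?thesis
        using form_parallelogram_le[of y2 "alg_mult xs y"] K[OF \<phi>\<psi>, of y]
        unfolding p alg_mult_simps y2 by (simp add: L_def distrib_right mult.assoc)
    qed
    then show ?case by blast
  qed

text \<open>The unit vector 1 \<otimes> 1 is admissible in \<open>spatial_norm\<close> and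
  contributes the length of \<open>xs\<close>, which dominates the functional by
  Cauchy-Schwarz.\<close>

lemma functional_le_spatial_norm:
  fixes xs :: "('a::unital_cstar_algebra \<times> 'b::unital_cstar_algebra) list"
  assumes "state \<phi>" "state \<psi>"
  shows "cmod (product_functional \<phi> \<psi> xs) \<le> spatial_norm xs"
proof -
  interpret two_states \<phi> \<psi> using assms by unfold_locales
  let ?X = "{sqrt (Re (tensor_form \<phi> \<psi> (alg_mult xs y) (alg_mult xs y))) | \<phi> \<psi> y.
            state \<phi> \<and> state \<psi> \<and> tensor_form \<phi> \<psi> y y = 1}"
  obtain K where K: "\<And>\<phi> \<psi> y. state \<phi> \<Longrightarrow> state \<psi> \<Longrightarrow>
    Re (tensor_form \<phi> \<psi> (alg_mult xs y) (alg_mult xs y)) \<le> K * Re (tensor_form \<phi> \<psi> y y)"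
    using form_mult_bounded[of xs] by blast
  have "bdd_above ?X"
  proof (rule bdd_aboveI)
    fix r assume "r \<in> ?X"
    then obtain \<phi> \<psi> y where "state \<phi>" "state \<psi>" "tensor_form \<phi> \<psi> y y = 1"
      "r = sqrt (Re (tensor_form \<phi> \<psi> (alg_mult xs y) (alg_mult xs y)))" by blast
    then show "r \<le> sqrt K" using K[of \<phi> \<psi> y] by simp
  qed
  moreover have "alg_mult xs [(1, 1)] = xs"
    by (induction xs) (auto simp: alg_mult_simps)
  then have "sqrt (Re (B xs xs)) \<in> ?X"
    using assms by (auto simp: tensor_form_single intro!: exI[of _ \<phi>] exI[of _ \<psi>] exI[of _ "[(1, 1)]"])
  ultimately have "sqrt (Re (B xs xs)) \<le> Sup ?X" by (intro cSup_upper)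
  then have "sqrt (Re (B xs xs)) \<le> spatial_norm xs"
    unfolding spatial_norm_def product_functional_star_mult .
  then show ?thesis
    using real_sqrt_le_mono[OF form_functional_le[of xs]] by simp
qed

section \<open>Product states on the minimal tensor product\<close>

locale min_tensor =
  fixes tens :: "'a::unital_cstar_algebra \<Rightarrow> 'b::unital_cstar_algebra \<Rightarrow> 't::unital_cstar_algebra"
  assumes tensor: "minimal_tensor_product tens"
begin

lemma tens_linear: "clinear (\<lambda>a. tens a b)" "clinear (tens a)"
  using tensor by (auto simp: minimal_tensor_product_def)

lemma tens_simps:
  "tens (a + a') b = tens a b + tens a' b" "tens a (b + b') = tens a b + tens a b'"
  "tens (c *\<^sub>C a) b = c *\<^sub>C tens a b" "tens a (c *\<^sub>C b) = c *\<^sub>C tens a b"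
  "tens (sum f A) b = (\<Sum>i\<in>A. tens (f i) b)" "tens a (sum g A) = (\<Sum>i\<in>A. tens a (g i))"
  "tens 0 b = 0" "tens a 0 = 0" "tens (- a) b = - tens a b" "tens (r *\<^sub>R a) b = r *\<^sub>R tens a b"
proof -
  interpret l: Vector_Spaces.linear scaleC scaleC "\<lambda>a. tens a b" by (rule tens_linear)
  interpret r: Vector_Spaces.linear scaleC scaleC "tens a" by (rule tens_linear)
  show "tens (a + a') b = tens a b + tens a' b" "tens (c *\<^sub>C a) b = c *\<^sub>C tens a b"
    "tens (sum f A) b = (\<Sum>i\<in>A. tens (f i) b)" "tens 0 b = 0" "tens (- a) b = - tens a b"
    by (rule l.add l.scale l.sum l.zero l.neg)+
  show "tens (r *\<^sub>R a) b = r *\<^sub>R tens a b" by (simp add: scaleR_conv_scaleC l.scale)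
  show "tens a (b + b') = tens a b + tens a b'" "tens a (c *\<^sub>C b) = c *\<^sub>C tens a b"
    "tens a (sum g A) = (\<Sum>i\<in>A. tens a (g i))" "tens a 0 = 0"
    by (rule r.add r.scale r.sum r.zero)+
qed

lemma tens_mult: "tens a b * tens c d = tens (a * c) (b * d)"
  and tens_star: "star (tens a b) = tens (star a) (star b)"
  and tens_norm: "norm (\<Sum>(a, b)\<leftarrow>xs. tens a b) = spatial_norm xs"
  and tens_dense: "closure (cvec.span {tens a b | a b. True}) = UNIV"
  using tensor unfolding minimal_tensor_product_def by blast+

text \<open>The element 1 \<otimes> 1 is a left unit on elementary tensors, hence on everything by
  density and continuity, in particular on 1.\<close>

lemma tens_one: "tens 1 1 = 1"
proof -
  define e where "e = tens 1 1"
  have "cvec.span {tens a b | a b. True} \<subseteq> {x. e * x = x}"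
  proof (rule cvec.span_minimal)
    show "{tens a b | a b. True} \<subseteq> {x. e * x = x}" by (auto simp: e_def tens_mult)
    show "cvec.subspace {x. e * x = x}"
      by (auto simp: cvec.subspace_def distrib_left mult_scaleC_right)
  qed
  moreover have "closed {x. e * x = x}"
    by (intro closed_Collect_eq continuous_intros)
  ultimately have "closure (cvec.span {tens a b | a b. True}) \<subseteq> {x. e * x = x}"
    by (rule closure_minimal)
  then have "e * 1 = 1" unfolding tens_dense by blast
  then show ?thesis by (simp add: e_def)
qed

text \<open>The constraints prescribe the product functional on lists. They are consistent because
  it is bounded by \<open>spatial_norm\<close>, the norm of the represented tensor. The extension is
  contractive and unital, hence a state.\<close>

lemma product_state_exists:
  assumes "state \<phi>" "state \<psi>"
  obtains \<tau> where "state \<tau>" "\<And>a b. \<tau> (tens a b) = \<phi> a * \<psi> b"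
proof -
  interpret two_states \<phi> \<psi> using assms by unfold_locales
  let ?t = "\<lambda>xs. \<Sum>(a, b)\<leftarrow>xs. tens a b" and ?p = "product_functional \<phi> \<psi>"
  define G where "G = {(?t xs, Re (?p xs)) | xs. True}"
  obtain f where f: "linear f" "\<And>x. f x \<le> norm x" "\<And>m r. (m, r) \<in> G \<Longrightarrow> f m \<le> r"
  proof (rule hahn_banach_cone[of G])
    show "(0, 0) \<in> G" by (auto simp: G_def intro!: exI[of _ "[]"])
    show "(m + m', r + r') \<in> G" if mr: "(m, r) \<in> G" "(m', r') \<in> G" for m r m' r'
    proof -
      obtain xs ys where "m = ?t xs" "r = Re (?p xs)" "m' = ?t ys" "r' = Re (?p ys)"
        using mr by (auto simp: G_def)
      then show ?thesis by (auto simp: G_def intro!: exI[of _ "xs @ ys"])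
    qed
    show "(t *\<^sub>R m, t * r) \<in> G" if mr: "(m, r) \<in> G" "t > 0" for m r t
    proof -
      obtain xs where xs: "m = ?t xs" "r = Re (?p xs)" using mr by (auto simp: G_def)
      have "?t (map (\<lambda>(a, b). (t *\<^sub>R a, b)) xs) = t *\<^sub>R m"
        unfolding xs by (induction xs) (auto simp: tens_simps scaleR_right_distrib)
      moreover have "Re (?p (map (\<lambda>(a, b). (t *\<^sub>R a, b)) xs)) = t * r"
        unfolding xs by (induction xs) (auto simp: algebra_simps)
      ultimately show ?thesis unfolding G_def by (auto intro!: exI[of _ "map (\<lambda>(a, b). (t *\<^sub>R a, b)) xs"])
    qed
    show "- r \<le> norm m" if mr: "(m, r) \<in> G" for m r
    proof -
      obtain xs where xs: "m = ?t xs" "r = Re (?p xs)" using mr by (auto simp: G_def)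
      have "cmod (?p xs) \<le> norm m"
        unfolding xs tens_norm by (rule functional_le_spatial_norm[OF assms])
      then show ?thesis using abs_Re_le_cmod[of "?p xs"] xs by linarith
    qed
  qed (use that in blast)
  obtain \<tau> where \<tau>: "cfunctional \<tau>" "\<And>x. Re (\<tau> x) = f x" "\<And>x. cmod (\<tau> x) \<le> norm x"
    using complexify[OF f(1,2)] by blast
  have le: "Re (\<tau> (tens a b)) \<le> Re (\<phi> a * \<psi> b)" for a b
    using f(3)[of "tens a b" "Re (\<phi> a * \<psi> b)"] unfolding \<tau>(2)
    by (force simp: G_def intro: exI[of _ "[(a, b)]"])
  \<comment> \<open>The inequality at -a makes the real parts equal; that equality at i a then
    settles the imaginary parts.\<close>
  have re: "Re (\<tau> (tens a b)) = Re (\<phi> a * \<psi> b)" for a b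
    using le[of a b] le[of "(-1) *\<^sub>C a" b] by (simp add: tens_simps cfunctionalD[OF \<tau>(1)])
  have "\<tau> (tens a b) = \<phi> a * \<psi> b" for a b
    using re[of a b] re[of "\<i> *\<^sub>C a" b] by (simp add: tens_simps cfunctionalD[OF \<tau>(1)] complex_eq_iff)
  moreover from this have "state \<tau>"
    using \<tau> tens_one by (intro state_if_contractive) (auto, metis mult_1 stateD(2) \<phi> \<psi>)
  ultimately show thesis using that by blast
qed

text \<open>A choice is enough: only the state property and the values on elementary tensors are
  used.\<close>

definition product_state :: "('a \<Rightarrow> complex) \<Rightarrow> ('b \<Rightarrow> complex) \<Rightarrow> 't \<Rightarrow> complex"
  where "product_state \<phi> \<psi> = (SOME \<tau>. state \<tau> \<and> (\<forall>a b. \<tau> (tens a b) = \<phi> a * \<psi> b))"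

lemma product_state:
  assumes "state \<phi>" "state \<psi>"
  shows "state (product_state \<phi> \<psi>)" "product_state \<phi> \<psi> (tens a b) = \<phi> a * \<psi> b"
proof -
  have "\<exists>\<tau>. state \<tau> \<and> (\<forall>a b. \<tau> (tens a b) = \<phi> a * \<psi> b)"
    by (rule product_state_exists[OF assms]) (rule exI, rule conjI, assumption, rule allI, rule allI)
  from someI_ex[OF this, folded product_state_def]
  show "state (product_state \<phi> \<psi>)" "product_state \<phi> \<psi> (tens a b) = \<phi> a * \<psi> b" by blast+
qed

end

section \<open>Convolution and the Haar state\<close>

lemma state_average:
  assumes "finite R" "R \<noteq> {}" "\<And>r. r \<in> R \<Longrightarrow> state (g r)"
  shows "state (\<lambda>a. (\<Sum>r\<in>R. g r a) / of_nat (card R))"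
proof -
  note lin = state_linear[OF assms(3)]
  have "cfunctional (\<lambda>a. (\<Sum>r\<in>R. g r a) / of_nat (card R))"
    by (rule cfunctionalI)
      (auto simp: lin sum.distrib add_divide_distrib sum_distrib_left cong: sum.cong)
  moreover have "(\<Sum>r\<in>R. g r (star a * a)) / of_nat (card R) \<in> \<real>\<^sub>\<ge>\<^sub>0" for a
    by (intro nonneg_Reals_divide_I nonneg_Reals_of_nat_I)
      (auto simp: complex_nonneg_Reals_iff stateD(4,5)[OF assms(3)] intro!: sum_nonneg sum.neutral)
  moreover have "card R \<noteq> 0" using assms by simp
  ultimately show ?thesis by (simp add: state_def stateD(2)[OF assms(3)] cong: sum.cong)
qed

text \<open>Banach-Alaoglu: functions carry the topology of pointwise convergence, contractivity
  places the states in a product of discs, and their defining conditions are closed.\<close>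

lemma compact_states: "compact {\<phi> :: 'a::unital_cstar_algebra \<Rightarrow> complex. state \<phi>}"
proof -
  let ?P = "PiE UNIV (\<lambda>a :: 'a. cball (0 :: complex) (norm a))"
  have "compactin (product_topology (\<lambda>_. euclidean) UNIV) ?P"
    unfolding compactin_PiE by simp
  then have "compact ?P" by (simp add: euclidean_product_topology)
  moreover have cont: "continuous_on UNIV (\<lambda>\<phi> :: 'a \<Rightarrow> complex. \<phi> a)" for a
    by (rule continuous_on_product_coordinates)
  have "{\<phi> :: 'a \<Rightarrow> complex. state \<phi>} = {\<phi>. (\<forall>a b. \<phi> (a + b) = \<phi> a + \<phi> b) \<and> (\<forall>c a. \<phi> (c *\<^sub>C a) = c * \<phi> a)
      \<and> (\<forall>a. 0 \<le> Re (\<phi> (star a * a))) \<and> (\<forall>a. Im (\<phi> (star a * a)) = 0) \<and> \<phi> 1 = 1}"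
    by (auto simp: state_def complex_nonneg_Reals_iff intro: cfunctionalI cfunctionalD)
  moreover have "closed \<dots>"
    by (intro closed_Collect_conj closed_Collect_all closed_Collect_eq closed_Collect_le
        continuous_intros cont)
  moreover have "{\<phi>. state \<phi>} \<subseteq> ?P" using state_contractive by auto
  ultimately show ?thesis by (metis compact_Int_closed inf.absorb_iff2)
qed

section \<open>Corepresentations and convolution of states\<close>

locale comultiplication = min_tensor tens
  for tens :: "'a::unital_cstar_algebra \<Rightarrow> 'a \<Rightarrow> 't::unital_cstar_algebra" +
  fixes \<Phi> :: "'a \<Rightarrow> 't"
  assumes hom: "star_hom \<Phi>" and unital: "\<Phi> 1 = 1"
begin

lemma comult_mult: "\<Phi> (a * b) = \<Phi> a * \<Phi> b" and comult_star: "\<Phi> (star a) = star (\<Phi> a)"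
  using hom by (auto simp: star_hom_def)

lemma comult_linear:
  "\<Phi> (a + b) = \<Phi> a + \<Phi> b" "\<Phi> (c *\<^sub>C a) = c *\<^sub>C \<Phi> a" "\<Phi> (sum f A) = (\<Sum>i\<in>A. \<Phi> (f i))"
proof -
  interpret Vector_Spaces.linear scaleC scaleC \<Phi> using hom by (simp add: star_hom_def)
  show "\<Phi> (a + b) = \<Phi> a + \<Phi> b" "\<Phi> (c *\<^sub>C a) = c *\<^sub>C \<Phi> a" "\<Phi> (sum f A) = (\<Sum>i\<in>A. \<Phi> (f i))"
    by (rule add scale sum)+
qed

definition conv :: "('a \<Rightarrow> complex) \<Rightarrow> ('a \<Rightarrow> complex) \<Rightarrow> 'a \<Rightarrow> complex"
  where "conv \<phi> \<psi> a = product_state \<phi> \<psi> (\<Phi> a)"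

lemma conv_state:
  assumes "state \<phi>" "state \<psi>"
  shows "state (conv \<phi> \<psi>)"
proof -
  note ps = product_state(1)[OF assms]
  have "cfunctional (conv \<phi> \<psi>)"
    by (rule cfunctionalI) (auto simp: conv_def comult_linear state_linear[OF ps])
  then show ?thesis
    by (simp add: state_def conv_def comult_mult comult_star stateD[OF ps] unital)
qed

definition corep :: "'i set \<Rightarrow> ('i \<Rightarrow> 'i \<Rightarrow> 'a) \<Rightarrow> bool"
  where "corep I w \<longleftrightarrow> finite I \<and> (\<forall>i\<in>I. \<forall>j\<in>I. \<Phi> (w i j) = (\<Sum>k\<in>I. tens (w i k) (w k j)))"

lemma corep_finite: "corep I w \<Longrightarrow> finite I"
  and corepD: "corep I w \<Longrightarrow> i \<in> I \<Longrightarrow> j \<in> I \<Longrightarrow> \<Phi> (w i j) = (\<Sum>k\<in>I. tens (w i k) (w k j))"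
  by (auto simp: corep_def)

lemma corep_mult:
  assumes w: "corep I w" and v: "corep J v"
  shows "corep (I \<times> J) (\<lambda>p q. w (fst p) (fst q) * v (snd p) (snd q))"
  unfolding corep_def
proof (intro conjI ballI)
  show "finite (I \<times> J)" using w v by (simp add: corep_finite)
  fix p q assume "p \<in> I \<times> J" "q \<in> I \<times> J"
  then show "\<Phi> (w (fst p) (fst q) * v (snd p) (snd q)) =
      (\<Sum>k\<in>I \<times> J. tens (w (fst p) (fst k) * v (snd p) (snd k)) (w (fst k) (fst q) * v (snd k) (snd q)))"
    by (auto simp: comult_mult corepD[OF w] corepD[OF v] sum_product tens_mult sum.cartesian_product
        case_prod_unfold)
qed

lemma corep_star: "corep I w \<Longrightarrow> corep I (\<lambda>i j. star (w i j))"
  by (auto simp: corep_def comult_star star_sum tens_star)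

lemma corep_reindex:
  assumes w: "corep I w" and b: "bij_betw g J I" and J: "finite J"
  shows "corep J (\<lambda>m n. w (g m) (g n))"
  unfolding corep_def
proof (intro conjI ballI J)
  fix m n assume "m \<in> J" "n \<in> J"
  then have "g m \<in> I" "g n \<in> I" using b by (auto simp: bij_betw_def)
  then show "\<Phi> (w (g m) (g n)) = (\<Sum>k\<in>J. tens (w (g m) (g k)) (w (g k) (g n)))"
    using sum.reindex_bij_betw[OF b, of "\<lambda>k. tens (w (g m) k) (w k (g n))"] by (simp add: corepD[OF w])
qed

text \<open>A predicate on single elements needs one index type for all corepresentations; finite
  sets of natural numbers provide every size.\<close>

definition coefficient :: "'a \<Rightarrow> bool"
  where "coefficient a \<longleftrightarrow> (\<exists>(I :: nat set) w i j. corep I w \<and> i \<in> I \<and> j \<in> I \<and> a = w i j)"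

lemma coefficientI:
  assumes "corep I w" "i \<in> I" "j \<in> I"
  shows "coefficient (w i j)"
proof -
  have "finite I" using assms by (simp add: corep_finite)
  then obtain g where g: "bij_betw g {0..<card I} I" using ex_bij_betw_nat_finite by blast
  then have "I = g ` {0..<card I}" by (simp add: bij_betw_def)
  then obtain m n where "m < card I" "g m = i" "n < card I" "g n = j"
    using assms(2,3) by (metis (no_types, lifting) atLeastLessThan_iff imageE)
  then show ?thesis
    unfolding coefficient_def using corep_reindex[OF assms(1) g]
    by (intro exI[of _ "{0..<card I}"] exI[of _ "\<lambda>m n. w (g m) (g n)"] exI[of _ m] exI[of _ n]) auto
qed

lemma coefficient_star_mult:
  assumes "corep I w" "i \<in> I" "j \<in> I" "k \<in> I" "l \<in> I"
  shows "coefficient (star (w i j) * w k l)"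
  using coefficientI[OF corep_mult[OF corep_star[OF assms(1)] assms(1)], of "(i, k)" "(j, l)"] assms
  by simp

lemma product_functional_corep:
  assumes "state \<tau>" "\<And>a b. \<tau> (tens a b) = \<phi> a * \<psi> b" "corep I w" "i \<in> I" "j \<in> I"
  shows "\<tau> (\<Phi> (w i j)) = (\<Sum>k\<in>I. \<phi> (w i k) * \<psi> (w k j))"
  by (simp add: corepD[OF assms(3-5)] state_linear[OF assms(1)] assms(2))

text \<open>On matrix elements convolution is the product of the scalar matrices \<phi>(w) and
  \<psi>(w); associativity of convolution is used only in this form.\<close>

lemma conv_corep:
  assumes "state \<phi>" "state \<psi>" "corep I w" "i \<in> I" "j \<in> I"
  shows "conv \<phi> \<psi> (w i j) = (\<Sum>k\<in>I. \<phi> (w i k) * \<psi> (w k j))"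
  unfolding conv_def by (rule product_functional_corep) (use product_state assms in auto)

primrec conv_pow :: "('a \<Rightarrow> complex) \<Rightarrow> nat \<Rightarrow> 'a \<Rightarrow> complex" where
  "conv_pow \<psi> 0 = \<psi>"
| "conv_pow \<psi> (Suc n) = conv (conv_pow \<psi> n) \<psi>"

lemma conv_pow_state: "state \<psi> \<Longrightarrow> state (conv_pow \<psi> n)"
  by (induction n) (auto simp: conv_state)

lemma conv_pow_commute:
  assumes \<psi>: "state \<psi>" and w: "corep I w"
  shows "i \<in> I \<Longrightarrow> j \<in> I \<Longrightarrow> (\<Sum>k\<in>I. \<psi> (w i k) * conv_pow \<psi> n (w k j)) = conv_pow \<psi> (Suc n) (w i j)"
proof (induction n arbitrary: i j)
  case 0
  then show ?case by (simp add: conv_corep[OF \<psi> \<psi> w])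
next
  case (Suc n)
  have "(\<Sum>k\<in>I. \<psi> (w i k) * conv_pow \<psi> (Suc n) (w k j))
      = (\<Sum>k\<in>I. \<Sum>l\<in>I. \<psi> (w i k) * conv_pow \<psi> n (w k l) * \<psi> (w l j))"
    using Suc.prems by (simp add: conv_corep[OF conv_pow_state[OF \<psi>] \<psi> w] sum_distrib_left mult.assoc)
  also have "\<dots> = (\<Sum>l\<in>I. (\<Sum>k\<in>I. \<psi> (w i k) * conv_pow \<psi> n (w k l)) * \<psi> (w l j))"
    by (subst sum.swap) (simp add: sum_distrib_right)
  also have "\<dots> = (\<Sum>l\<in>I. conv_pow \<psi> (Suc n) (w i l) * \<psi> (w l j))"
    using Suc by (intro sum.cong) auto
  also have "\<dots> = conv_pow \<psi> (Suc (Suc n)) (w i j)"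
    using Suc.prems conv_corep[OF conv_pow_state[OF \<psi>, of "Suc n"] \<psi> w] by simp
  finally show ?case .
qed

text \<open>A cluster point of the Cesaro means of the convolution powers of \<open>\<psi>\<close> is \<open>\<psi>\<close>-invariant.\<close>

lemma invariant_state_exists:
  assumes \<psi>: "state \<psi>"
  obtains h where "state h"
    "\<And>(I :: nat set) w i j. corep I w \<Longrightarrow> i \<in> I \<Longrightarrow> j \<in> I \<Longrightarrow> (\<Sum>k\<in>I. h (w i k) * \<psi> (w k j)) = h (w i j)"
    "\<And>(I :: nat set) w i j. corep I w \<Longrightarrow> i \<in> I \<Longrightarrow> j \<in> I \<Longrightarrow> (\<Sum>k\<in>I. \<psi> (w i k) * h (w k j)) = h (w i j)"
proof -
  let ?s = "conv_pow \<psi>"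
  define m where "m n a = (\<Sum>k<Suc n. ?s k a) / of_nat (Suc n)" for n a
  have ms: "state (m n)" for n
    unfolding m_def using state_average[of "{..<Suc n}" ?s] conv_pow_state[OF \<psi>] by auto
  define F where "F = filtermap m sequentially"
  have "\<exists>h\<in>{h. state h}. inf (nhds h) F \<noteq> bot"
    using compact_states ms unfolding compact_filter F_def
    by (metis (mono_tags, lifting) always_eventually eventually_filtermap filtermap_bot_iff mem_Collect_eq
        sequentially_bot)
  then obtain h where h: "state h" and nb: "inf (nhds h) F \<noteq> bot" by auto
  \<comment> \<open>The state space need not be metrizable, so the limit is taken along a filter; a
    continuous quantity that tends to 0 along the means vanishes at their cluster point.\<close>
  have cluster: "g h = 0"
    if cont: "continuous_on UNIV g" and lim: "(\<lambda>n. g (m n)) \<longlonglongrightarrow> 0" for g :: "('a \<Rightarrow> complex) \<Rightarrow> complex"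
  proof (rule tendsto_unique[OF nb])
    have "(g \<longlongrightarrow> g h) (nhds h)"
      using cont unfolding continuous_on_def by (simp add: tendsto_at_iff_tendsto_nhds)
    then show "(g \<longlongrightarrow> g h) (inf (nhds h) F)" by (rule tendsto_mono[rotated]) simp
    have "(g \<longlongrightarrow> 0) F" using lim by (simp add: F_def filterlim_filtermap)
    then show "(g \<longlongrightarrow> 0) (inf (nhds h) F)" by (rule tendsto_mono[rotated]) simp
  qed
  \<comment> \<open>Convolving a mean with \<psi> shifts every power by one, so the difference
    telescopes to two states divided by n + 1.\<close>
  have tele: "(\<lambda>n. (\<Sum>k<Suc n. ?s (Suc k) a - ?s k a) / of_nat (Suc n)) \<longlonglongrightarrow> 0" for a
  proof (rule Lim_null_comparison)
    show "(\<lambda>n. (2 * norm a) / real (Suc n)) \<longlonglongrightarrow> 0" by (rule LIMSEQ_Suc) (rule lim_const_over_n)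
    have tel: "(\<Sum>k<Suc n. ?s (Suc k) a - ?s k a) = ?s (Suc n) a - ?s 0 a" for n
      by (rule sum_lessThan_telescope)
    have "cmod (?s (Suc n) a - ?s 0 a) \<le> 2 * norm a" for n
      using norm_triangle_ineq4[of "?s (Suc n) a" "?s 0 a"] state_contractive[OF conv_pow_state[OF \<psi>], of "Suc n" a]
        state_contractive[OF conv_pow_state[OF \<psi>], of 0 a] by linarith
    then have "cmod (\<Sum>k<Suc n. ?s (Suc k) a - ?s k a) \<le> 2 * norm a" for n
      by (simp only: tel)
    then show "\<forall>\<^sub>F n in sequentially. cmod ((\<Sum>k<Suc n. ?s (Suc k) a - ?s k a) / of_nat (Suc n))
        \<le> (2 * norm a) / real (Suc n)"
      by (intro always_eventually allI) (simp only: norm_divide norm_of_nat divide_right_mono of_nat_0_le_iff)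
  qed
  have pull: "(\<Sum>k\<in>I. f k * (\<Sum>n\<in>N. s n k) / d) = (\<Sum>n\<in>N. \<Sum>k\<in>I. f k * s n k) / d"
    for I :: "nat set" and N :: "nat set" and f :: "nat \<Rightarrow> complex" and s d
    by (subst sum.swap) (simp add: sum_distrib_left sum_divide_distrib)
  have cont: "continuous_on UNIV (\<lambda>\<phi> :: 'a \<Rightarrow> complex. \<phi> a)" for a
    by (rule continuous_on_product_coordinates)
  show thesis
  proof (rule that[OF h])
    fix I :: "nat set" and w i j
    assume w: "corep I w" and ij: "i \<in> I" "j \<in> I"
    have "(\<Sum>k\<in>I. \<psi> (w k j) * m n (w i k)) - m n (w i j)
        = (\<Sum>k<Suc n. ?s (Suc k) (w i j) - ?s k (w i j)) / of_nat (Suc n)" for n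
      unfolding m_def sum_subtractf diff_divide_distrib times_divide_eq_right pull
      using conv_corep[OF conv_pow_state[OF \<psi>] \<psi> w ij] by (simp add: mult.commute)
    then have "(\<lambda>n. (\<Sum>k\<in>I. \<psi> (w k j) * m n (w i k)) - m n (w i j)) \<longlonglongrightarrow> 0"
      using tele[of "w i j"] by (simp only:)
    then have "(\<Sum>k\<in>I. \<psi> (w k j) * h (w i k)) - h (w i j) = 0"
      by (intro cluster continuous_intros cont)
    then show "(\<Sum>k\<in>I. h (w i k) * \<psi> (w k j)) = h (w i j)" by (simp add: mult.commute)
    have "(\<Sum>k\<in>I. \<psi> (w i k) * m n (w k j)) - m n (w i j)
        = (\<Sum>k<Suc n. ?s (Suc k) (w i j) - ?s k (w i j)) / of_nat (Suc n)" for n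
      unfolding m_def sum_subtractf diff_divide_distrib times_divide_eq_right pull
      by (simp only: conv_pow_commute[OF \<psi> w ij])
    then have "(\<lambda>n. (\<Sum>k\<in>I. \<psi> (w i k) * m n (w k j)) - m n (w i j)) \<longlonglongrightarrow> 0"
      using tele[of "w i j"] by (simp only:)
    then have "(\<Sum>k\<in>I. \<psi> (w i k) * h (w k j)) - h (w i j) = 0"
      by (intro cluster continuous_intros cont)
    then show "(\<Sum>k\<in>I. \<psi> (w i k) * h (w k j)) = h (w i j)" by simp
  qed
qed

text \<open>
  For \<open>F = (h \<otimes> id) \<Phi>(w\<^sub>i\<^sub>j)\<close> invariance gives \<open>(\<psi> \<otimes> h)(z* z) = 0\<close> with \<open>z = \<Phi>(F) - 1 \<otimes> F\<close>. Hence
  \<open>(\<rho> \<otimes> h)(z* z) = 0\<close> for every \<open>\<rho>\<close> occurring in the average \<open>\<psi>\<close>, and Cauchy--Schwarz yields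
  \<open>(\<rho> \<otimes> h)((1 \<otimes> c) z) = 0\<close> for all \<open>c\<close>.
\<close>

lemma invariant_under_components:
  fixes I :: "nat set"
  assumes R: "finite R" "\<And>\<rho>. \<rho> \<in> R \<Longrightarrow> state \<rho>" and \<rho>: "\<rho> \<in> R"
    and h: "state h"
    and right: "\<And>(I :: nat set) w i j. corep I w \<Longrightarrow> i \<in> I \<Longrightarrow> j \<in> I \<Longrightarrow>
      (\<Sum>k\<in>I. h (w i k) * ((\<Sum>\<rho>\<in>R. \<rho> (w k j)) / of_nat (card R))) = h (w i j)"
    and left: "\<And>(I :: nat set) w i j. corep I w \<Longrightarrow> i \<in> I \<Longrightarrow> j \<in> I \<Longrightarrow>
      (\<Sum>k\<in>I. ((\<Sum>\<rho>\<in>R. \<rho> (w i k)) / of_nat (card R)) * h (w k j)) = h (w i j)"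
    and w: "corep I w"
    and t: "\<And>i k. i \<in> I \<Longrightarrow> k \<in> I \<Longrightarrow> (\<Sum>j\<in>I. t i j * w k j) = (if i = k then 1 else 0)"
    and il: "i \<in> I" "l \<in> I"
  shows "(\<Sum>k\<in>I. h (w i k) * \<rho> (w k l)) = h (w i l)"
proof -
  define \<psi> where "\<psi> a = (\<Sum>\<rho>\<in>R. \<rho> a) / of_nat (card R)" for a
  \<comment> \<open>This extension of \<psi> \<otimes> h is built as an average of product states,
    so that vanishing on a positive element passes to each term of the average.\<close>
  define \<sigma> where "\<sigma> s = (\<Sum>\<rho>\<in>R. product_state \<rho> h s) / of_nat (card R)" for s
  have card: "card R \<noteq> 0" using R \<rho> by auto
  have \<psi>: "state \<psi>" unfolding \<psi>_def using state_average[of R "\<lambda>\<rho>. \<rho>"] R \<rho> by auto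
  have \<sigma>: "state \<sigma>" unfolding \<sigma>_def
    using state_average[of R "\<lambda>\<rho>. product_state \<rho> h"] R \<rho> product_state(1) h by auto
  have \<sigma>t: "\<sigma> (tens a b) = \<psi> a * h b" for a b
    using R(2) h by (simp add: \<sigma>_def \<psi>_def product_state(2) sum_distrib_right[symmetric] cong: sum.cong)
  note \<sigma>_lin = state_linear[OF \<sigma>] and h_lin = state_linear[OF h]
  define H where "H k = h (w i k)" for k
  have H: "(\<Sum>k\<in>I. H k * \<psi> (w k j)) = H j" if "j \<in> I" for j
    using right[OF w il(1) that] by (simp add: H_def \<psi>_def)
  have coef: "\<sigma> (\<Phi> a) = h a" if a: "coefficient a" for a
  proof -
    obtain J :: "nat set" and v i j where v: "corep J v" "i \<in> J" "j \<in> J" "a = v i j"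
      using a unfolding coefficient_def by blast
    show ?thesis unfolding v(4) product_functional_corep[OF \<sigma> \<sigma>t v(1-3)]
      using left[OF v(1-3)] by (simp add: \<psi>_def)
  qed
  define F where "F j = (\<Sum>k\<in>I. H k *\<^sub>C w k j)" for j
  have \<Phi>F: "\<Phi> (F j) = (\<Sum>k\<in>I. \<Sum>l\<in>I. H k *\<^sub>C tens (w k l) (w l j))" if "j \<in> I" for j
    using that by (simp add: F_def comult_linear corepD[OF w] scaleC_sum_right)
  \<comment> \<open>Used twice: for \<sigma> the bracket vanishes by invariance under \<psi>; for
    the product state of a single component it is the defect that has to be shown to vanish.\<close>
  have tau: "\<tau> (tens 1 c * (\<Phi> (F j) - tens 1 (F j))) =
      (\<Sum>l\<in>I. ((\<Sum>k\<in>I. H k * \<rho> (w k l)) - H l) * h (c * w l j))"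
    if \<tau>: "state \<tau>" "\<And>a b. \<tau> (tens a b) = \<rho> a * h b" and j: "j \<in> I" and "\<rho> 1 = 1" for \<tau> \<rho> c j
  proof -
    have "\<tau> (tens 1 c * \<Phi> (F j)) = (\<Sum>k\<in>I. \<Sum>l\<in>I. H k * (\<rho> (w k l) * h (c * w l j)))"
      by (simp add: \<Phi>F[OF j] sum_distrib_left mult_scaleC_right tens_mult state_linear[OF \<tau>(1)] \<tau>(2))
    also have "\<dots> = (\<Sum>l\<in>I. (\<Sum>k\<in>I. H k * \<rho> (w k l)) * h (c * w l j))"
      by (subst sum.swap) (simp add: sum_distrib_right mult.assoc)
    finally have 1: "\<tau> (tens 1 c * \<Phi> (F j)) = \<dots>" .
    have 2: "\<tau> (tens 1 c * tens 1 (F j)) = (\<Sum>l\<in>I. H l * h (c * w l j))"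
      using \<open>\<rho> 1 = 1\<close>
      by (simp add: F_def tens_mult \<tau>(2) sum_distrib_left mult_scaleC_right h_lin)
    show ?thesis
      by (simp add: right_diff_distrib state_linear[OF \<tau>(1)] 1 2 left_diff_distrib sum_subtractf)
  qed
  define z where "z j = \<Phi> (F j) - tens 1 (F j)" for j
  have null: "\<sigma> (star (z j) * z j) = 0" if j: "j \<in> I" for j
  proof -
    have "star (F j) * F j = (\<Sum>k\<in>I. \<Sum>l\<in>I. (cnj (H k) * H l) *\<^sub>C (star (w k j) * w l j))"
      by (simp add: F_def star_sum star_scaleC sum_product mult_scaleC_left mult_scaleC_right
          scaleC_scaleC mult.commute)
    then have FF: "\<sigma> (\<Phi> (star (F j) * F j)) = h (star (F j) * F j)"
      using coef[OF coefficient_star_mult[OF w]] j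
      by (simp add: comult_linear \<sigma>_lin h_lin)
    have a: "\<sigma> (tens 1 (star (F j)) * z j) = 0"
      unfolding z_def tau[OF \<sigma> \<sigma>t j stateD(2)[OF \<psi>]] using H by (intro sum.neutral) simp
    have "\<sigma> (star (\<Phi> (F j)) * z j) = \<sigma> (\<Phi> (star (F j) * F j)) - \<sigma> (star (\<Phi> (F j)) * tens 1 (F j))"
      by (simp add: z_def right_diff_distrib \<sigma>_lin comult_mult comult_star)
    moreover have "\<sigma> (star (\<Phi> (F j)) * tens 1 (F j)) = cnj (\<sigma> (tens 1 (star (F j)) * \<Phi> (F j)))"
      unfolding state_star[OF \<sigma>, symmetric] by (simp add: star_mult star_star tens_star)
    moreover have "\<sigma> (tens 1 (star (F j)) * \<Phi> (F j)) = h (star (F j) * F j)"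
      using a by (simp add: z_def right_diff_distrib \<sigma>_lin tens_mult \<sigma>t stateD(2)[OF \<psi>])
    moreover have "cnj (h (star (F j) * F j)) = h (star (F j) * F j)"
      unfolding state_star[OF h, symmetric] by (simp add: star_mult star_star)
    ultimately have "\<sigma> (star (\<Phi> (F j)) * z j) = 0" by (simp add: FF)
    moreover have "star (z j) * z j = star (\<Phi> (F j)) * z j - tens 1 (star (F j)) * z j"
      by (simp add: z_def star_diff tens_star left_diff_distrib)
    ultimately show ?thesis by (simp add: \<sigma>_lin a)
  qed
  let ?\<tau> = "product_state \<rho> h"
  have \<tau>: "state ?\<tau>" "\<And>a b. ?\<tau> (tens a b) = \<rho> a * h b" using product_state R(2)[OF \<rho>] h by auto
  have zero: "?\<tau> (star (z j) * z j) = 0" if j: "j \<in> I" for j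
  proof -
    have "(\<Sum>\<rho>\<in>R. product_state \<rho> h (star (z j) * z j)) = 0"
      using null[OF j] card by (simp add: \<sigma>_def)
    then have "(\<Sum>\<rho>\<in>R. Re (product_state \<rho> h (star (z j) * z j))) = 0" by (metis Re_sum zero_complex.simps(1))
    then have "Re (?\<tau> (star (z j) * z j)) = 0"
      using sum_nonneg_eq_0_iff[OF R(1)] stateD(4)[OF product_state(1)] R(2) h \<rho> by (metis (no_types, lifting))
    then show ?thesis using stateD(5)[OF \<tau>(1)] by (simp add: complex_eq_iff)
  qed
  define K where "K l = (\<Sum>k\<in>I. H k * \<rho> (w k l)) - H l" for l
  have K: "(\<Sum>l'\<in>I. K l' * h (c * w l' j)) = 0" if j: "j \<in> I" for c j
    using state_null_left_kernel[OF \<tau>(1) zero[OF j], of "tens 1 c"]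
    unfolding z_def tau[OF \<tau> j stateD(2)[OF R(2)[OF \<rho>]]] K_def .
  \<comment> \<open>Choosing c = \<open>t l j\<close> and summing over \<open>j\<close>, the inverse
    of the transpose isolates the single defect \<open>K l\<close>.\<close>
  have "0 = (\<Sum>j\<in>I. \<Sum>l'\<in>I. K l' * h (t l j * w l' j))" using K by simp
  also have "\<dots> = (\<Sum>l'\<in>I. K l' * h (\<Sum>j\<in>I. t l j * w l' j))"
    by (subst sum.swap) (simp add: h_lin sum_distrib_left)
  also have "\<dots> = (\<Sum>l'\<in>I. if l = l' then K l' else 0)"
    using t[OF il(2)] by (intro sum.cong) (auto simp: h_lin stateD(2)[OF h])
  also have "\<dots> = K l" using il corep_finite[OF w] by simp
  finally show ?thesis by (simp add: K_def H_def)
qed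

text \<open>For finitely many states, an invariant state of their average is invariant under each of
  them; compactness of the state space and the finite intersection property then give one state
  invariant under all.\<close>

lemma haar_state_exists:
  obtains h where "state h"
    "\<And>(I :: nat set) w t \<rho> i l. corep I w \<Longrightarrow>
      (\<And>i k. i \<in> I \<Longrightarrow> k \<in> I \<Longrightarrow> (\<Sum>j\<in>I. t i j * w k j) = (if i = k then 1 else 0)) \<Longrightarrow>
      state \<rho> \<Longrightarrow> i \<in> I \<Longrightarrow> l \<in> I \<Longrightarrow> (\<Sum>k\<in>I. h (w i k) * \<rho> (w k l)) = h (w i l)"
proof -
  define T where "T I w \<longleftrightarrow> corep I w \<and> (\<exists>t. \<forall>i\<in>I. \<forall>k\<in>I. (\<Sum>j\<in>I. t i j * w k j) = (if i = k then 1 else 0))"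
    for I :: "nat set" and w :: "nat \<Rightarrow> nat \<Rightarrow> 'a"
  define S where "S \<rho> = {h :: 'a \<Rightarrow> complex. \<forall>I w i l. T I w \<longrightarrow> i \<in> I \<longrightarrow> l \<in> I \<longrightarrow>
    (\<Sum>k\<in>I. h (w i k) * \<rho> (w k l)) = h (w i l)}" for \<rho>
  have "{h. state h} \<inter> (\<Inter>\<rho>\<in>{\<rho>. state \<rho>}. S \<rho>) \<noteq> {}"
  proof (rule compact_imp_fip_image[OF compact_states])
    have cont: "continuous_on UNIV (\<lambda>\<phi> :: 'a \<Rightarrow> complex. \<phi> a)" for a
      by (rule continuous_on_product_coordinates)
    show "closed (S \<rho>)" for \<rho>
      unfolding S_def imp_conv_disj
      by (intro closed_Collect_all closed_Collect_disj closed_Collect_const closed_Collect_eq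
          continuous_intros cont)
    fix R assume R: "finite R" "R \<subseteq> {\<rho> :: 'a \<Rightarrow> complex. state \<rho>}"
    obtain \<phi>0 :: "'a \<Rightarrow> complex" where "state \<phi>0"
      using state_exists_norming[of "1 :: 'a"] by auto
    show "{h. state h} \<inter> (\<Inter>\<rho>\<in>R. S \<rho>) \<noteq> {}"
    proof (cases "R = {}")
      case True
      then show ?thesis using \<open>state \<phi>0\<close> by auto
    next
      case False
      have "state (\<lambda>a. (\<Sum>\<rho>\<in>R. \<rho> a) / of_nat (card R))"
        using state_average[of R "\<lambda>\<rho>. \<rho>"] R False by auto
      then obtain h where h: "state h"
        "\<And>(I :: nat set) w i j. corep I w \<Longrightarrow> i \<in> I \<Longrightarrow> j \<in> I \<Longrightarrow>
          (\<Sum>k\<in>I. h (w i k) * ((\<Sum>\<rho>\<in>R. \<rho> (w k j)) / of_nat (card R))) = h (w i j)"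
        "\<And>(I :: nat set) w i j. corep I w \<Longrightarrow> i \<in> I \<Longrightarrow> j \<in> I \<Longrightarrow>
          (\<Sum>k\<in>I. ((\<Sum>\<rho>\<in>R. \<rho> (w i k)) / of_nat (card R)) * h (w k j)) = h (w i j)"
        using invariant_state_exists by blast
      have "h \<in> S \<rho>" if "\<rho> \<in> R" for \<rho>
      proof -
        have "(\<Sum>k\<in>I. h (w i k) * \<rho> (w k l)) = h (w i l)" if Tw: "T I w" and il: "i \<in> I" "l \<in> I" for I w i l
        proof -
          obtain t where w: "corep I w"
            and t: "\<And>i k. i \<in> I \<Longrightarrow> k \<in> I \<Longrightarrow> (\<Sum>j\<in>I. t i j * w k j) = (if i = k then 1 else 0)"
            using Tw unfolding T_def by blast
          show ?thesis
            by (rule invariant_under_components[OF R(1) _ \<open>\<rho> \<in> R\<close> h w t il]) (use R in auto)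
        qed
        then show ?thesis unfolding S_def by blast
      qed
      then show ?thesis using h(1) by blast
    qed
  qed
  then obtain h where h: "state h" "\<And>\<rho>. state \<rho> \<Longrightarrow> h \<in> S \<rho>" by blast
  show thesis
  proof (rule that[OF h(1)])
    fix I :: "nat set" and w t and \<rho> :: "'a \<Rightarrow> complex" and i l
    assume "corep I w" and "\<And>i k. i \<in> I \<Longrightarrow> k \<in> I \<Longrightarrow> (\<Sum>j\<in>I. t i j * w k j) = (if i = k then 1 else 0)"
      and \<rho>: "state \<rho>" and il: "i \<in> I" "l \<in> I"
    then have "T I w" unfolding T_def by blast
    then show "(\<Sum>k\<in>I. h (w i k) * \<rho> (w k l)) = h (w i l)"
      using h(2)[OF \<rho>] il unfolding S_def by blast
  qed
qed

end

section \<open>Corepresentations with invertible transpose\<close>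

lemma sum_times_nested:
  fixes f f' g g' :: "_ \<Rightarrow> 'a::semiring_0"
  shows "(\<Sum>p\<in>I \<times> J. (g (snd p) * f (fst p)) * (f' (fst p) * g' (snd p)))
    = (\<Sum>b\<in>J. g b * (\<Sum>a\<in>I. f a * f' a) * g' b)"
proof -
  have "(\<Sum>p\<in>I \<times> J. (g (snd p) * f (fst p)) * (f' (fst p) * g' (snd p)))
    = (\<Sum>a\<in>I. \<Sum>b\<in>J. (g b * f a) * (f' a * g' b))"
    by (simp add: sum.cartesian_product case_prod_unfold)
  also have "\<dots> = (\<Sum>b\<in>J. \<Sum>a\<in>I. (g b * f a) * (f' a * g' b))" by (rule sum.swap)
  finally show ?thesis by (simp add: sum_distrib_left sum_distrib_right mult.assoc)
qed

lemma sum_times_nested':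
  fixes f f' g g' :: "_ \<Rightarrow> 'a::semiring_0"
  shows "(\<Sum>p\<in>I \<times> J. (f (fst p) * g (snd p)) * (g' (snd p) * f' (fst p)))
    = (\<Sum>a\<in>I. f a * (\<Sum>b\<in>J. g b * g' b) * f' a)"
proof -
  have "(\<Sum>p\<in>I \<times> J. (f (fst p) * g (snd p)) * (g' (snd p) * f' (fst p)))
    = (\<Sum>a\<in>I. \<Sum>b\<in>J. (f a * g b) * (g' b * f' a))"
    by (simp add: sum.cartesian_product case_prod_unfold)
  then show ?thesis by (simp add: sum_distrib_left sum_distrib_right mult.assoc)
qed

definition direct_sum :: "('i \<Rightarrow> 'i \<Rightarrow> 'a::zero) \<Rightarrow> ('j \<Rightarrow> 'j \<Rightarrow> 'a) \<Rightarrow> 'i + 'j \<Rightarrow> 'i + 'j \<Rightarrow> 'a"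
  where "direct_sum w w' p q = (case (p, q) of (Inl i, Inl j) \<Rightarrow> w i j | (Inr i, Inr j) \<Rightarrow> w' i j | _ \<Rightarrow> 0)"

lemma direct_sum_simps [simp]:
  "direct_sum w w' (Inl i) (Inl j) = w i j" "direct_sum w w' (Inr k) (Inr l) = w' k l"
  "direct_sum w w' (Inl i) (Inr l) = 0" "direct_sum w w' (Inr k) (Inl j) = 0"
  by (auto simp: direct_sum_def)

locale comultiplication_subalgebra = comultiplication tens \<Phi>
  for tens :: "'a::unital_cstar_algebra \<Rightarrow> 'a \<Rightarrow> 't::unital_cstar_algebra" and \<Phi> +
  fixes A0 :: "'a set"
  assumes A0: "star_subalgebra A0"
begin

lemma A0_closed:
  "0 \<in> A0" "a \<in> A0 \<Longrightarrow> b \<in> A0 \<Longrightarrow> a + b \<in> A0" "a \<in> A0 \<Longrightarrow> c *\<^sub>C a \<in> A0"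
  "a \<in> A0 \<Longrightarrow> b \<in> A0 \<Longrightarrow> a * b \<in> A0" "a \<in> A0 \<Longrightarrow> star a \<in> A0"
  "(\<And>i. i \<in> S \<Longrightarrow> f i \<in> A0) \<Longrightarrow> sum f S \<in> A0"
  using A0 by (auto simp: star_subalgebra_def cvec.subspace_0 cvec.subspace_add cvec.subspace_scale
      cvec.subspace_sum)

text \<open>
  \<open>v\<close> is the inverse of the corepresentation matrix \<open>w\<close> and \<open>t\<close> is the inverse of its transpose.
\<close>

definition good :: "'i set \<Rightarrow> ('i \<Rightarrow> 'i \<Rightarrow> 'a) \<Rightarrow> ('i \<Rightarrow> 'i \<Rightarrow> 'a) \<Rightarrow> ('i \<Rightarrow> 'i \<Rightarrow> 'a) \<Rightarrow> bool"
  where "good I w v t \<longleftrightarrow> corep I w \<and> (\<forall>i\<in>I. \<forall>j\<in>I.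
    w i j \<in> A0 \<and>
    (\<Sum>k\<in>I. v i k * w k j) = (if i = j then 1 else 0) \<and>
    (\<Sum>k\<in>I. w i k * v k j) = (if i = j then 1 else 0) \<and>
    (\<Sum>k\<in>I. t i k * w j k) = (if i = j then 1 else 0) \<and>
    (\<Sum>k\<in>I. w k i * t k j) = (if i = j then 1 else 0))"

lemma goodD:
  assumes "good I w v t"
  shows "corep I w" "finite I" "i \<in> I \<Longrightarrow> j \<in> I \<Longrightarrow> w i j \<in> A0"
    "i \<in> I \<Longrightarrow> j \<in> I \<Longrightarrow> (\<Sum>k\<in>I. v i k * w k j) = (if i = j then 1 else 0)"
    "i \<in> I \<Longrightarrow> j \<in> I \<Longrightarrow> (\<Sum>k\<in>I. w i k * v k j) = (if i = j then 1 else 0)"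
    "i \<in> I \<Longrightarrow> j \<in> I \<Longrightarrow> (\<Sum>k\<in>I. t i k * w j k) = (if i = j then 1 else 0)"
    "i \<in> I \<Longrightarrow> j \<in> I \<Longrightarrow> (\<Sum>k\<in>I. w k i * t k j) = (if i = j then 1 else 0)"
  using assms by (auto simp: good_def corep_finite)

text \<open>The conjugate matrix is inverted by the adjoint of \<open>t\<close>, and its transpose
  by the adjoint of \<open>v\<close>: conjugation exchanges the two kinds of inverse.\<close>

lemma good_star:
  assumes g: "good I w v t"
  shows "good I (\<lambda>i j. star (w i j)) (\<lambda>i j. star (t j i)) (\<lambda>i j. star (v j i))"
  unfolding good_def
proof (intro conjI ballI)
  fix i j assume ij: "i \<in> I" "j \<in> I"
  note D = goodD(3)[OF g ij(2,1)] goodD(4)[OF g ij(2,1)] goodD(5)[OF g ij(2,1)] goodD(6)[OF g ij(2,1)]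
    goodD(7)[OF g ij(2,1)]
  have s: "(\<Sum>k\<in>I. star (x k) * star (y k)) = star (\<Sum>k\<in>I. y k * x k)" for x y :: "_ \<Rightarrow> 'a"
    by (simp add: star_sum star_mult)
  show "star (w i j) \<in> A0" using goodD(3)[OF g ij] by (rule A0_closed)
  show "(\<Sum>k\<in>I. star (t k i) * star (w k j)) = (if i = j then 1 else 0)"
    "(\<Sum>k\<in>I. star (w i k) * star (t j k)) = (if i = j then 1 else 0)"
    "(\<Sum>k\<in>I. star (v k i) * star (w j k)) = (if i = j then 1 else 0)"
    "(\<Sum>k\<in>I. star (w k i) * star (v j k)) = (if i = j then 1 else 0)"
    unfolding s D(2-5) by auto
qed (use g in \<open>auto simp: good_def corep_star\<close>)

text \<open>Entries need not commute, so the inverse of the tensor product carries the factors in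
  reversed order, and the adjacent ones collapse first. This reversal becomes the
  antimultiplicativity of the antipode.\<close>

lemma good_mult:
  assumes g: "good I w v t" and g': "good J w' v' t'"
  shows "good (I \<times> J) (\<lambda>p q. w (fst p) (fst q) * w' (snd p) (snd q))
    (\<lambda>p q. v' (snd p) (snd q) * v (fst p) (fst q)) (\<lambda>p q. t' (snd p) (snd q) * t (fst p) (fst q))"
  unfolding good_def
proof (intro conjI ballI)
  show "corep (I \<times> J) (\<lambda>p q. w (fst p) (fst q) * w' (snd p) (snd q))"
    using g g' by (intro corep_mult goodD)
  fix p q assume "p \<in> I \<times> J" "q \<in> I \<times> J"
  then obtain i k j l where pq: "p = (i, k)" "q = (j, l)" "i \<in> I" "k \<in> J" "j \<in> I" "l \<in> J" by auto
  note D = goodD(3)[OF g pq(3,5)] goodD(4)[OF g pq(3,5)] goodD(5)[OF g pq(3,5)]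
    goodD(6)[OF g pq(3,5)] goodD(7)[OF g pq(3,5)]
    goodD(3)[OF g' pq(4,6)] goodD(4)[OF g' pq(4,6)] goodD(5)[OF g' pq(4,6)]
    goodD(6)[OF g' pq(4,6)] goodD(7)[OF g' pq(4,6)]
  show "w (fst p) (fst q) * w' (snd p) (snd q) \<in> A0" using D pq by (auto intro: A0_closed)
  show "(\<Sum>r\<in>I \<times> J. v' (snd p) (snd r) * v (fst p) (fst r) * (w (fst r) (fst q) * w' (snd r) (snd q)))
      = (if p = q then 1 else 0)"
    using sum_times_nested[where g = "v' k" and f = "v i" and f' = "\<lambda>a. w a j" and g' = "\<lambda>b. w' b l"
        and I = I and J = J] D by (auto simp: pq)
  show "(\<Sum>r\<in>I \<times> J. t' (snd p) (snd r) * t (fst p) (fst r) * (w (fst q) (fst r) * w' (snd q) (snd r)))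
      = (if p = q then 1 else 0)"
    using sum_times_nested[where g = "t' k" and f = "t i" and f' = "w j" and g' = "w' l"
        and I = I and J = J] D by (auto simp: pq)
  show "(\<Sum>r\<in>I \<times> J. w (fst p) (fst r) * w' (snd p) (snd r) * (v' (snd r) (snd q) * v (fst r) (fst q)))
      = (if p = q then 1 else 0)"
    using sum_times_nested'[where f = "w i" and g = "w' k" and g' = "\<lambda>b. v' b l" and f' = "\<lambda>a. v a j"
        and I = I and J = J] D by (auto simp: pq)
  show "(\<Sum>r\<in>I \<times> J. w (fst r) (fst p) * w' (snd r) (snd p) * (t' (snd r) (snd q) * t (fst r) (fst q)))
      = (if p = q then 1 else 0)"
    using sum_times_nested'[where f = "\<lambda>a. w a i" and g = "\<lambda>b. w' b k" and g' = "\<lambda>b. t' b l"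
        and f' = "\<lambda>a. t a j" and I = I and J = J] D by (auto simp: pq)
qed

lemma good_direct_sum:
  assumes g: "good I w v t" and g': "good J w' v' t'"
  shows "good (I <+> J) (direct_sum w w') (direct_sum v v') (direct_sum t t')"
proof -
  note [simp] = sum.Plus[OF goodD(2)[OF g] goodD(2)[OF g'], unfolded comp_def]
  note [simp] = goodD(2-7)[OF g] goodD(2-7)[OF g'] corepD[OF goodD(1)[OF g]] corepD[OF goodD(1)[OF g']]
  have z: "\<Phi> 0 = 0" using comult_linear(2)[of 0 0] by simp
  show ?thesis unfolding good_def corep_def
    by (auto simp: z tens_simps A0_closed)
qed

lemma good_reindex:
  assumes g: "good I w v t" and b: "bij_betw g J I" and J: "finite J"
  shows "good J (\<lambda>m n. w (g m) (g n)) (\<lambda>m n. v (g m) (g n)) (\<lambda>m n. t (g m) (g n))"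
  unfolding good_def
proof (intro conjI ballI)
  show "corep J (\<lambda>m n. w (g m) (g n))" using corep_reindex[OF goodD(1)[OF g] b J] .
  fix m n assume mn: "m \<in> J" "n \<in> J"
  then have I: "g m \<in> I" "g n \<in> I" using b by (auto simp: bij_betw_def)
  have eq: "(if g m = g n then 1 else 0) = (if m = n then 1 else 0 :: 'a)"
    using b mn by (auto simp: bij_betw_def inj_on_def)
  note D = goodD(3)[OF g I] goodD(4)[OF g I] goodD(5)[OF g I] goodD(6)[OF g I] goodD(7)[OF g I]
  show "w (g m) (g n) \<in> A0" by (rule D)
  show "(\<Sum>k\<in>J. v (g m) (g k) * w (g k) (g n)) = (if m = n then 1 else 0)"
    using sum.reindex_bij_betw[OF b, of "\<lambda>k. v (g m) k * w k (g n)"] D(2) eq by simp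
  show "(\<Sum>k\<in>J. w (g m) (g k) * v (g k) (g n)) = (if m = n then 1 else 0)"
    using sum.reindex_bij_betw[OF b, of "\<lambda>k. w (g m) k * v k (g n)"] D(3) eq by simp
  show "(\<Sum>k\<in>J. t (g m) (g k) * w (g n) (g k)) = (if m = n then 1 else 0)"
    using sum.reindex_bij_betw[OF b, of "\<lambda>k. t (g m) k * w (g n) k"] D(4) eq by simp
  show "(\<Sum>k\<in>J. w (g k) (g m) * t (g k) (g n)) = (if m = n then 1 else 0)"
    using sum.reindex_bij_betw[OF b, of "\<lambda>k. w k (g m) * t k (g n)"] D(5) eq by simp
qed

text \<open>
  The graph of the antipode: it sends the matrix elements of a corepresentation to those of the
  inverse matrix.
\<close>

definition antipode :: "'a \<Rightarrow> 'a \<Rightarrow> bool"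
  where "antipode a b \<longleftrightarrow> (\<exists>(I :: nat set) w v t f. good I w v t \<and>
    a = (\<Sum>i\<in>I. \<Sum>j\<in>I. f i j *\<^sub>C w i j) \<and> b = (\<Sum>i\<in>I. \<Sum>j\<in>I. f i j *\<^sub>C v i j))"

lemma antipodeI:
  assumes g: "good I w v t"
  shows "antipode (\<Sum>i\<in>I. \<Sum>j\<in>I. f i j *\<^sub>C w i j) (\<Sum>i\<in>I. \<Sum>j\<in>I. f i j *\<^sub>C v i j)"
proof -
  have "finite I" using g by (rule goodD)
  then obtain g where b: "bij_betw g {0..<card I} I" using ex_bij_betw_nat_finite by blast
  let ?J = "{0..<card I}"
  have r: "(\<Sum>i\<in>I. \<Sum>j\<in>I. F i j) = (\<Sum>m\<in>?J. \<Sum>n\<in>?J. F (g m) (g n))" for F :: "_ \<Rightarrow> _ \<Rightarrow> 'a"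
    using sum.reindex_bij_betw[OF b, of "\<lambda>i. \<Sum>j\<in>I. F i j"] sum.reindex_bij_betw[OF b, of "F _"]
    by simp
  have "good ?J (\<lambda>m n. w (g m) (g n)) (\<lambda>m n. v (g m) (g n)) (\<lambda>m n. t (g m) (g n))"
    using good_reindex[OF g b] by simp
  then show ?thesis unfolding antipode_def r by (intro exI conjI) (auto intro: exI[of _ "\<lambda>m n. f (g m) (g n)"])
qed

lemma antipode_entry:
  assumes g: "good I w v t" and "i \<in> I" "j \<in> I"
  shows "antipode (w i j) (v i j)"
proof -
  have "(\<Sum>k\<in>I. \<Sum>l\<in>I. (if k = i \<and> l = j then 1 else 0) *\<^sub>C x k l) = x i j" for x :: "_ \<Rightarrow> _ \<Rightarrow> 'a"
  proof -
    have "(\<Sum>k\<in>I. \<Sum>l\<in>I. (if k = i \<and> l = j then 1 else 0) *\<^sub>C x k l)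
        = (\<Sum>k\<in>I. if k = i then \<Sum>l\<in>I. if l = j then x k l else 0 else 0)"
      by (intro sum.cong refl) (auto intro!: sum.cong)
    then show ?thesis using assms goodD(2)[OF g] by simp
  qed
  then show ?thesis
    using antipodeI[OF g, of "\<lambda>k l. if k = i \<and> l = j then 1 else 0"] by simp
qed

text \<open>Two presentations over unrelated corepresentations are placed on a block diagonal, so
  additivity holds before the relation is known to be a function.\<close>

lemma antipode_add:
  assumes "antipode a b" "antipode a' b'"
  shows "antipode (a + a') (b + b')"
proof -
  obtain I :: "nat set" and w v t f where g: "good I w v t"
    and ab: "a = (\<Sum>i\<in>I. \<Sum>j\<in>I. f i j *\<^sub>C w i j)" "b = (\<Sum>i\<in>I. \<Sum>j\<in>I. f i j *\<^sub>C v i j)"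
    using assms(1) unfolding antipode_def by blast
  obtain J :: "nat set" and w' v' t' f' where g': "good J w' v' t'"
    and ab': "a' = (\<Sum>i\<in>J. \<Sum>j\<in>J. f' i j *\<^sub>C w' i j)" "b' = (\<Sum>i\<in>J. \<Sum>j\<in>J. f' i j *\<^sub>C v' i j)"
    using assms(2) unfolding antipode_def by blast
  show ?thesis
    using antipodeI[OF good_direct_sum[OF g g'], of "direct_sum f f'"]
    by (simp add: sum.Plus goodD(2)[OF g] goodD(2)[OF g'] comp_def ab ab')
qed

lemma antipode_scale:
  assumes "antipode a b"
  shows "antipode (c *\<^sub>C a) (c *\<^sub>C b)"
proof -
  obtain I :: "nat set" and w v t f where g: "good I w v t"
    and ab: "a = (\<Sum>i\<in>I. \<Sum>j\<in>I. f i j *\<^sub>C w i j)" "b = (\<Sum>i\<in>I. \<Sum>j\<in>I. f i j *\<^sub>C v i j)"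
    using assms unfolding antipode_def by blast
  show ?thesis using antipodeI[OF g, of "\<lambda>i j. c * f i j"]
    by (simp add: ab scaleC_sum_right scaleC_scaleC)
qed

lemma antipode_mult:
  assumes "antipode a b" "antipode a' b'"
  shows "antipode (a * a') (b' * b)"
proof -
  obtain I :: "nat set" and w v t f where g: "good I w v t"
    and ab: "a = (\<Sum>i\<in>I. \<Sum>j\<in>I. f i j *\<^sub>C w i j)" "b = (\<Sum>i\<in>I. \<Sum>j\<in>I. f i j *\<^sub>C v i j)"
    using assms(1) unfolding antipode_def by blast
  obtain J :: "nat set" and w' v' t' f' where g': "good J w' v' t'"
    and ab': "a' = (\<Sum>i\<in>J. \<Sum>j\<in>J. f' i j *\<^sub>C w' i j)" "b' = (\<Sum>i\<in>J. \<Sum>j\<in>J. f' i j *\<^sub>C v' i j)"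
    using assms(2) unfolding antipode_def by blast
  have quad: "(\<Sum>p\<in>I \<times> J. \<Sum>q\<in>I \<times> J. F (fst p) (fst q) (snd p) (snd q))
      = (\<Sum>i\<in>I. \<Sum>j\<in>I. \<Sum>k\<in>J. \<Sum>l\<in>J. F i j k l)" for F :: "nat \<Rightarrow> nat \<Rightarrow> nat \<Rightarrow> nat \<Rightarrow> 'a"
  proof -
    have "(\<Sum>p\<in>I \<times> J. \<Sum>q\<in>I \<times> J. F (fst p) (fst q) (snd p) (snd q))
      = (\<Sum>i\<in>I. \<Sum>k\<in>J. \<Sum>j\<in>I. \<Sum>l\<in>J. F i j k l)"
      by (simp add: sum.cartesian_product')
    also have "\<dots> = (\<Sum>i\<in>I. \<Sum>j\<in>I. \<Sum>k\<in>J. \<Sum>l\<in>J. F i j k l)"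
      by (intro sum.cong refl sum.swap)
    finally show ?thesis .
  qed
  have "a * a' = (\<Sum>i\<in>I. \<Sum>j\<in>I. (f i j *\<^sub>C w i j) * a')"
    by (simp only: ab sum_distrib_right)
  also have "\<dots> = (\<Sum>i\<in>I. \<Sum>j\<in>I. \<Sum>k\<in>J. \<Sum>l\<in>J. (f i j * f' k l) *\<^sub>C (w i j * w' k l))"
    by (simp only: ab' sum_distrib_left mult_scaleC_left mult_scaleC_right scaleC_scaleC)
      (simp add: mult.commute)
  finally have "a * a' = \<dots>" .
  moreover have "b' * b = (\<Sum>i\<in>I. \<Sum>j\<in>I. b' * (f i j *\<^sub>C v i j))"
    by (simp only: ab sum_distrib_left)
  moreover have "\<dots> = (\<Sum>i\<in>I. \<Sum>j\<in>I. \<Sum>k\<in>J. \<Sum>l\<in>J. (f i j * f' k l) *\<^sub>C (v' k l * v i j))"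
    by (simp only: ab' sum_distrib_right mult_scaleC_left mult_scaleC_right scaleC_scaleC scaleC_sum_right)
  ultimately show ?thesis
    using antipodeI[OF good_mult[OF g g'], of "\<lambda>p q. f (fst p) (fst q) * f' (snd p) (snd q)"]
      quad[of "\<lambda>i j k l. (f i j * f' k l) *\<^sub>C (w i j * w' k l)"]
      quad[of "\<lambda>i j k l. (f i j * f' k l) *\<^sub>C (v' k l * v i j)"] by simp
qed

text \<open>Only existence is claimed: the image of \<open>star a\<close> is built from
  \<open>t\<close> and not from \<open>b\<close>.\<close>

lemma antipode_star:
  assumes "antipode a b"
  shows "\<exists>c. antipode (star a) c"
proof -
  obtain I :: "nat set" and w v t f where g: "good I w v t"
    and ab: "a = (\<Sum>i\<in>I. \<Sum>j\<in>I. f i j *\<^sub>C w i j)" "b = (\<Sum>i\<in>I. \<Sum>j\<in>I. f i j *\<^sub>C v i j)"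
    using assms unfolding antipode_def by blast
  show ?thesis using antipodeI[OF good_star[OF g], of "\<lambda>i j. cnj (f i j)"]
    by (auto simp: ab star_sum star_scaleC)
qed

text \<open>By minimality of the entry algebra, this puts all of its elements into the domain of the
  relation.\<close>

lemma star_subalgebra_antipode_domain: "antipode 0 0 \<Longrightarrow> star_subalgebra {a. \<exists>b. antipode a b}"
  unfolding star_subalgebra_def cvec.subspace_def
  using antipode_add antipode_scale antipode_mult antipode_star by fast

lemma antipode_zero: "antipode 0 0"
  using antipodeI[of "{}" "\<lambda>_ _. 0" "\<lambda>_ _. 0" "\<lambda>_ _. 0"] by (simp add: good_def corep_def)

lemma invariant_on_antipode_domain:
  obtains h where "state h" "\<And>a b \<rho>. antipode a b \<Longrightarrow> state \<rho> \<Longrightarrow> conv h \<rho> a = h a"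
proof -
  obtain h where h: "state h"
    "\<And>(I :: nat set) w t \<rho> i l. corep I w \<Longrightarrow>
      (\<And>i k. i \<in> I \<Longrightarrow> k \<in> I \<Longrightarrow> (\<Sum>j\<in>I. t i j * w k j) = (if i = k then 1 else 0)) \<Longrightarrow>
      state \<rho> \<Longrightarrow> i \<in> I \<Longrightarrow> l \<in> I \<Longrightarrow> (\<Sum>k\<in>I. h (w i k) * \<rho> (w k l)) = h (w i l)"
    by (rule haar_state_exists) blast
  have "conv h \<rho> a = h a" if ab: "antipode a b" and \<rho>: "state \<rho>" for a b \<rho>
  proof -
    obtain I :: "nat set" and w v t f where g: "good I w v t"
      and a: "a = (\<Sum>i\<in>I. \<Sum>j\<in>I. f i j *\<^sub>C w i j)"
      using ab unfolding antipode_def by blast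
    have "conv h \<rho> (w i j) = h (w i j)" if "i \<in> I" "j \<in> I" for i j
      using h(2)[OF goodD(1)[OF g] goodD(6)[OF g] \<rho> that] conv_corep[OF h(1) \<rho> goodD(1)[OF g] that] by simp
    then show ?thesis
      by (simp add: a state_linear[OF h(1)] state_linear[OF conv_state[OF h(1) \<rho>]])
  qed
  then show thesis using that h(1) by blast
qed

text \<open>The slice of \<open>\<Phi> a\<close> by \<open>h\<close> in the first leg is the scalar
  \<open>h a\<close>, since all states agree on the two sides. Writing the slice through a finite
  decomposition avoids slice maps on the completion.\<close>

lemma right_invariance:
  assumes h: "state h" and inv: "\<And>\<rho>. state \<rho> \<Longrightarrow> conv h \<rho> a = h a"
    and a: "\<Phi> a = (\<Sum>s\<in>S. tens (x s) (y s))"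
  shows "(\<Sum>s\<in>S. h (x s) *\<^sub>C y s) = h a *\<^sub>C 1"
proof -
  have "(\<Sum>s\<in>S. h (x s) *\<^sub>C y s) - h a *\<^sub>C 1 = 0"
  proof (rule states_separate_points)
    fix \<rho> :: "'a \<Rightarrow> complex" assume \<rho>: "state \<rho>"
    have "conv h \<rho> a = (\<Sum>s\<in>S. h (x s) * \<rho> (y s))"
      by (simp add: conv_def a state_linear[OF product_state(1)[OF h \<rho>]] product_state(2)[OF h \<rho>])
    then show "\<rho> ((\<Sum>s\<in>S. h (x s) *\<^sub>C y s) - h a *\<^sub>C 1) = 0"
      using inv[OF \<rho>] by (simp add: state_linear[OF \<rho>] stateD(2)[OF \<rho>])
  qed
  then show ?thesis by simp
qed

end

section \<open>Matrices over a finite index set\<close>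

text \<open>A basis of \<open>W\<close> goes to an independent set of the same size; a vector of
  \<open>W\<close> outside the image could be added to it, exceeding the dimension.\<close>

lemma (in vector_space) surj_on_if_inj_on:
  assumes W: "subspace W" "W \<subseteq> span T" "finite T"
    and L: "Vector_Spaces.linear scale scale L" "L ` W \<subseteq> W" "inj_on L W" and y: "y \<in> W"
  shows "y \<in> L ` W"
proof -
  interpret pair: vector_space_pair scale scale by unfold_locales
  interpret L: Vector_Spaces.linear scale scale L by (rule L)
  obtain B where B: "B \<subseteq> W" "independent B" "W \<subseteq> span B"
    using maximal_independent_subset by blast
  have spanB: "span B = W" using B(1,3) span_minimal[OF _ W(1)] by blast
  have finB: "finite B" using independent_span_bound[OF W(3) B(2)] B(1) W(2) by blast
  have indep: "independent (L ` B)"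
    using L.independent_injective_image[OF B(2)] L(3) spanB by simp
  have image: "span (L ` B) = L ` W" using L.span_image[of B] spanB by simp
  show ?thesis
  proof (rule ccontr)
    assume n: "y \<notin> L ` W"
    then have ind: "independent (insert y (L ` B))" using indep image by (intro independent_insertI) auto
    have "insert y (L ` B) \<subseteq> span B" using y L(2) B(1) spanB by auto
    then have "card (insert y (L ` B)) \<le> card B"
      using independent_span_bound[OF finB ind] by blast
    moreover have "y \<notin> L ` B" using n B(1) by auto
    moreover have "card (L ` B) = card B" using L(3) B(1) by (meson card_image inj_on_subset)
    ultimately show False using finB by simp
  qed
qed

definition cfun_scale :: "complex \<Rightarrow> ('i \<Rightarrow> 'i \<Rightarrow> complex) \<Rightarrow> 'i \<Rightarrow> 'i \<Rightarrow> complex"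
  where "cfun_scale c x = (\<lambda>i j. c * x i j)"

interpretation cfun: vector_space cfun_scale
  by unfold_locales (auto simp: cfun_scale_def fun_eq_iff algebra_simps)

text \<open>Matrices are functions vanishing outside \<open>I \<times> I\<close>.\<close>

definition on_index :: "'i set \<Rightarrow> ('i \<Rightarrow> 'i \<Rightarrow> complex) \<Rightarrow> bool"
  where "on_index I x \<longleftrightarrow> (\<forall>i j. i \<notin> I \<or> j \<notin> I \<longrightarrow> x i j = 0)"

definition restrict_index :: "'i set \<Rightarrow> ('i \<Rightarrow> 'i \<Rightarrow> complex) \<Rightarrow> 'i \<Rightarrow> 'i \<Rightarrow> complex"
  where "restrict_index I x i j = (if i \<in> I \<and> j \<in> I then x i j else 0)"

definition mat_mul :: "'i set \<Rightarrow> ('i \<Rightarrow> 'i \<Rightarrow> complex) \<Rightarrow> ('i \<Rightarrow> 'i \<Rightarrow> complex) \<Rightarrow> 'i \<Rightarrow> 'i \<Rightarrow> complex"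
  where "mat_mul I x y = restrict_index I (\<lambda>i j. \<Sum>k\<in>I. x i k * y k j)"

definition mat_id :: "'i set \<Rightarrow> 'i \<Rightarrow> 'i \<Rightarrow> complex"
  where "mat_id I = restrict_index I (\<lambda>i j. if i = j then 1 else 0)"

definition mat_adj :: "('i \<Rightarrow> 'i \<Rightarrow> complex) \<Rightarrow> 'i \<Rightarrow> 'i \<Rightarrow> complex"
  where "mat_adj x i j = cnj (x j i)"

lemma on_index_intros [simp]:
  "on_index I (mat_mul I x y)" "on_index I (mat_id I)" "on_index I (restrict_index I z)"
  "on_index I x \<Longrightarrow> on_index I (mat_adj x)" "on_index I 0"
  "on_index I x \<Longrightarrow> on_index I y \<Longrightarrow> on_index I (x + y)"
  "on_index I x \<Longrightarrow> on_index I y \<Longrightarrow> on_index I (x - y)"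
  "on_index I x \<Longrightarrow> on_index I (cfun_scale c x)"
  by (auto simp: on_index_def mat_mul_def mat_id_def restrict_index_def mat_adj_def cfun_scale_def)

lemma on_index_eqI:
  assumes "on_index I x" "on_index I y" "\<And>i j. i \<in> I \<Longrightarrow> j \<in> I \<Longrightarrow> x i j = y i j"
  shows "x = y"
  using assms by (auto simp: on_index_def fun_eq_iff) metis

lemma mat_mul_entry: "i \<in> I \<Longrightarrow> j \<in> I \<Longrightarrow> mat_mul I x y i j = (\<Sum>k\<in>I. x i k * y k j)"
  by (simp add: mat_mul_def restrict_index_def)

lemma mat_mul_assoc: "mat_mul I (mat_mul I x y) z = mat_mul I x (mat_mul I y z)"
proof (rule on_index_eqI[of I])
  fix i j assume ij: "i \<in> I" "j \<in> I"
  have "mat_mul I (mat_mul I x y) z i j = (\<Sum>k\<in>I. \<Sum>l\<in>I. x i l * y l k * z k j)"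
    using ij by (simp add: mat_mul_entry sum_distrib_right)
  also have "\<dots> = (\<Sum>l\<in>I. \<Sum>k\<in>I. x i l * (y l k * z k j))"
    by (subst sum.swap) (simp add: mult.assoc)
  also have "\<dots> = mat_mul I x (mat_mul I y z) i j"
    using ij by (simp add: mat_mul_entry sum_distrib_left)
  finally show "mat_mul I (mat_mul I x y) z i j = mat_mul I x (mat_mul I y z) i j" .
qed simp_all

lemma mat_mul_id:
  assumes "finite I" "on_index I x"
  shows "mat_mul I (mat_id I) x = x" "mat_mul I x (mat_id I) = x"
proof -
  show "mat_mul I (mat_id I) x = x"
  proof (rule on_index_eqI[of I])
    fix i j assume ij: "i \<in> I" "j \<in> I"
    have "mat_mul I (mat_id I) x i j = (\<Sum>k\<in>I. if i = k then x k j else 0)"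
      using ij by (simp add: mat_mul_entry) (rule sum.cong, auto simp: mat_id_def restrict_index_def)
    then show "mat_mul I (mat_id I) x i j = x i j" using ij assms by simp
  qed (use assms in simp_all)
  show "mat_mul I x (mat_id I) = x"
  proof (rule on_index_eqI[of I])
    fix i j assume ij: "i \<in> I" "j \<in> I"
    have "mat_mul I x (mat_id I) i j = (\<Sum>k\<in>I. if k = j then x i k else 0)"
      using ij by (simp add: mat_mul_entry) (rule sum.cong, auto simp: mat_id_def restrict_index_def)
    then show "mat_mul I x (mat_id I) i j = x i j" using ij assms by simp
  qed (use assms in simp_all)
qed

lemma mat_mul_add:
  "mat_mul I (x + y) z = mat_mul I x z + mat_mul I y z" "mat_mul I z (x + y) = mat_mul I z x + mat_mul I z y"
  "mat_mul I (x - y) z = mat_mul I x z - mat_mul I y z" "mat_mul I z (x - y) = mat_mul I z x - mat_mul I z y"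
  "mat_mul I (cfun_scale c x) z = cfun_scale c (mat_mul I x z)"
  "mat_mul I z (cfun_scale c x) = cfun_scale c (mat_mul I z x)"
  by (auto simp: fun_eq_iff mat_mul_def restrict_index_def cfun_scale_def algebra_simps
      sum.distrib sum_subtractf sum_distrib_left)

lemma mat_mul_zero [simp]: "mat_mul I 0 x = 0" "mat_mul I x 0 = 0"
  by (auto simp: fun_eq_iff mat_mul_def restrict_index_def)

lemma mat_adj_mul: "mat_adj (mat_mul I x y) = mat_mul I (mat_adj y) (mat_adj x)"
  by (auto simp: fun_eq_iff mat_mul_def restrict_index_def mat_adj_def mult.commute)

lemma mat_adj_adj [simp]: "mat_adj (mat_adj x) = x"
  by (auto simp: mat_adj_def fun_eq_iff)

lemma mat_adj_id [simp]: "mat_adj (mat_id I) = mat_id I"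
  by (auto simp: fun_eq_iff mat_id_def restrict_index_def mat_adj_def)

lemma mat_adj_add: "mat_adj (x + y) = mat_adj x + mat_adj y"
  by (auto simp: fun_eq_iff mat_adj_def)

lemma sum_fun_apply: "sum f A x = (\<Sum>a\<in>A. f a x)"
  by (induction A rule: infinite_finite_induct) auto

lemma on_index_span:
  assumes "finite I"
  obtains T where "finite T" "{x. on_index I x} \<subseteq> cfun.span T"
proof
  let ?e = "\<lambda>p i j. if (i, j) = p then 1 else 0 :: complex"
  show "finite (?e ` (I \<times> I))" using assms by simp
  show "{x. on_index I x} \<subseteq> cfun.span (?e ` (I \<times> I))"
  proof
    fix x assume "x \<in> {x. on_index I x}"
    then have x: "on_index I x" by simp
    have eq: "x = (\<Sum>p\<in>I \<times> I. cfun_scale (x (fst p) (snd p)) (?e p))"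
    proof (intro ext)
      fix i j
      have "(\<Sum>p\<in>I \<times> I. cfun_scale (x (fst p) (snd p)) (?e p)) i j
          = (\<Sum>p\<in>I \<times> I. if (i, j) = p then x (fst p) (snd p) else 0)"
        unfolding sum_fun_apply cfun_scale_def by (rule sum.cong) auto
      also have "\<dots> = (if (i, j) \<in> I \<times> I then x i j else 0)"
        using assms by (simp only: sum.delta' finite_cartesian_product fst_conv snd_conv)
      also have "\<dots> = x i j" using x by (auto simp: on_index_def)
      finally show "x i j = (\<Sum>p\<in>I \<times> I. cfun_scale (x (fst p) (snd p)) (?e p)) i j" by simp
    qed
    have "(\<Sum>p\<in>I \<times> I. cfun_scale (x (fst p) (snd p)) (?e p)) \<in> cfun.span (?e ` (I \<times> I))"
      by (intro cfun.span_sum cfun.span_scale cfun.span_base imageI)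
    then show "x \<in> cfun.span (?e ` (I \<times> I))" by (simp only: eq[symmetric])
  qed
qed

text \<open>Serves twice: to invert Q among all matrices, and to solve e C = C inside the space of
  matrices h(b w).\<close>

lemma mat_surj_if_inj:
  assumes I: "finite I" and W: "cfun.subspace W" "\<And>x. x \<in> W \<Longrightarrow> on_index I x"
    and L: "\<And>x y. L (x + y) = L x + L y" "\<And>c x. L (cfun_scale c x) = cfun_scale c (L x)"
    and LW: "\<And>x. x \<in> W \<Longrightarrow> L x \<in> W" and inj: "\<And>x. x \<in> W \<Longrightarrow> L x = 0 \<Longrightarrow> x = 0" and y: "y \<in> W"
  obtains x where "x \<in> W" "L x = y"
proof -
  obtain T where T: "finite T" "{x. on_index I x} \<subseteq> cfun.span T" using on_index_span[OF I] by blast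
  have lin: "Vector_Spaces.linear cfun_scale cfun_scale L"
    using L cfun.vector_space_axioms by (simp add: Vector_Spaces.linear_iff)
  interpret L: Vector_Spaces.linear cfun_scale cfun_scale L by (rule lin)
  have "inj_on L W"
  proof (rule inj_onI)
    fix x y assume xy: "x \<in> W" "y \<in> W" "L x = L y"
    then have "x - y \<in> W" "L (x - y) = 0" by (auto simp: L.diff intro: cfun.subspace_diff[OF W(1)])
    then have "x - y = 0" by (rule inj)
    then show "x = y" by simp
  qed
  then have "y \<in> L ` W"
    using W(2) T LW y by (intro cfun.surj_on_if_inj_on[OF W(1) _ T(1) lin]) auto
  then show thesis using that by blast
qed

section \<open>The Gram matrix of the Haar state\<close>

context comultiplication_subalgebra
begin

text \<open>
  Below \<open>h\<close> is the Haar state, \<open>Q = h(w* w)\<close> satisfies \<open>w* Q w = Q\<close>, \<open>P\<close> is the inverse of \<open>Q\<close>, and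
  \<open>\<B> = {h(b w) | b \<in> A0}\<close>. The point is that \<open>\<B>\<close> contains the identity matrix, i.e. the counit is of
  the form \<open>h(b \<cdot>)\<close> on the matrix elements of \<open>w\<close>.
\<close>

definition gram :: "('a \<Rightarrow> complex) \<Rightarrow> 'i set \<Rightarrow> ('i \<Rightarrow> 'i \<Rightarrow> 'a) \<Rightarrow> 'i \<Rightarrow> 'i \<Rightarrow> complex"
  where "gram h I w = restrict_index I (\<lambda>i j. h (\<Sum>k\<in>I. star (w k i) * w k j))"

definition haar_matrices :: "('a \<Rightarrow> complex) \<Rightarrow> 'i set \<Rightarrow> ('i \<Rightarrow> 'i \<Rightarrow> 'a) \<Rightarrow> ('i \<Rightarrow> 'i \<Rightarrow> complex) set"
  where "haar_matrices h I w = {restrict_index I (\<lambda>i j. h (b * w i j)) | b. b \<in> A0}"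

end

locale haar_comultiplication = comultiplication_subalgebra tens \<Phi> A0
  for tens :: "'a::unital_cstar_algebra \<Rightarrow> 'a \<Rightarrow> 't::unital_cstar_algebra" and \<Phi> A0 +
  fixes h :: "'a \<Rightarrow> complex"
  assumes h: "state h" and invariant: "\<And>a \<rho>. a \<in> A0 \<Longrightarrow> state \<rho> \<Longrightarrow> conv h \<rho> a = h a"
    and domain: "\<And>a. a \<in> A0 \<Longrightarrow> \<exists>b. antipode a b"
begin

lemmas h_lin = state_linear[OF h]

text \<open>Expanding \<open>a\<close> in matrix elements shows that \<open>\<Phi> a\<close> is a
  finite sum with both legs in \<open>A0\<close>. The triples hold the row, the column and the
  summation index.\<close>

lemma comult_decompose:
  assumes "a \<in> A0"
  obtains S :: "(nat \<times> nat \<times> nat) set" and x y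
  where "\<And>s. s \<in> S \<Longrightarrow> x s \<in> A0" "\<And>s. s \<in> S \<Longrightarrow> y s \<in> A0" "\<Phi> a = (\<Sum>s\<in>S. tens (x s) (y s))"
proof -
  obtain I :: "nat set" and w v t f where g: "good I w v t"
    and a: "a = (\<Sum>i\<in>I. \<Sum>j\<in>I. f i j *\<^sub>C w i j)"
    using domain[OF assms] unfolding antipode_def by blast
  have "\<Phi> a = (\<Sum>i\<in>I. \<Sum>j\<in>I. \<Sum>k\<in>I. tens (f i j *\<^sub>C w i k) (w k j))"
    by (simp add: a comult_linear corepD[OF goodD(1)[OF g]] scaleC_sum_right tens_simps)
  also have "\<dots> = (\<Sum>s\<in>I \<times> I \<times> I. tens (f (fst s) (fst (snd s)) *\<^sub>C w (fst s) (snd (snd s)))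
      (w (snd (snd s)) (fst (snd s))))"
    by (simp add: sum.cartesian_product')
  finally show thesis
    by (rule that[rotated 2]) (auto intro!: A0_closed goodD(3)[OF g])
qed

lemma right_inv:
  assumes "a \<in> A0" "\<Phi> a = (\<Sum>s\<in>S. tens (x s) (y s))"
  shows "(\<Sum>s\<in>S. h (x s) *\<^sub>C y s) = h a *\<^sub>C 1"
  by (rule right_invariance[OF h invariant[OF assms(1)] assms(2)])

context
  fixes I :: "nat set" and w v t :: "nat \<Rightarrow> nat \<Rightarrow> 'a"
  assumes good: "good I w v t"
begin

abbreviation (input) Q where "Q \<equiv> gram h I w"
abbreviation (input) mm where "mm \<equiv> mat_mul I"

lemma fin: "finite I" by (rule goodD(2)[OF good])

lemma gram_entry: "i \<in> I \<Longrightarrow> j \<in> I \<Longrightarrow> Q i j = h (\<Sum>k\<in>I. star (w k i) * w k j)"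
  by (simp add: gram_def restrict_index_def)

lemma on_index_gram [simp]: "on_index I Q" by (simp add: gram_def)

lemma gram_hermitian: "mat_adj Q = Q"
proof (rule on_index_eqI[of I])
  fix i j assume "i \<in> I" "j \<in> I"
  then show "mat_adj Q i j = Q i j"
    by (simp add: mat_adj_def gram_entry state_star[OF h, symmetric] star_sum star_mult star_star)
qed simp_all

lemma gram_invariant:
  assumes ij: "i \<in> I" "j \<in> I"
  shows "(\<Sum>k\<in>I. \<Sum>l\<in>I. Q k l *\<^sub>C (star (w k i) * w l j)) = Q i j *\<^sub>C 1"
proof -
  note W = corepD[OF goodD(1)[OF good]]
  define a where "a = (\<Sum>m\<in>I. star (w m i) * w m j)"
  have "\<Phi> a = (\<Sum>m\<in>I. \<Sum>k\<in>I. \<Sum>l\<in>I. tens (star (w m k) * w m l) (star (w k i) * w l j))"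
    using ij by (simp add: a_def comult_linear comult_mult comult_star W star_sum tens_star sum_product tens_mult)
  also have "\<dots> = (\<Sum>s\<in>I \<times> I \<times> I. tens (star (w (fst s) (fst (snd s))) * w (fst s) (snd (snd s)))
      (star (w (fst (snd s)) i) * w (snd (snd s)) j))"
    by (simp add: sum.cartesian_product')
  finally have \<Phi>a: "\<Phi> a = \<dots>" .
  have "a \<in> A0" using ij unfolding a_def by (auto intro!: A0_closed goodD(3)[OF good])
  from right_inv[OF this \<Phi>a]
  have "(\<Sum>m\<in>I. \<Sum>k\<in>I. \<Sum>l\<in>I. h (star (w m k) * w m l) *\<^sub>C (star (w k i) * w l j)) = h a *\<^sub>C 1"
    by (simp add: sum.cartesian_product')
  moreover have "(\<Sum>m\<in>I. \<Sum>k\<in>I. \<Sum>l\<in>I. h (star (w m k) * w m l) *\<^sub>C (star (w k i) * w l j))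
     = (\<Sum>k\<in>I. \<Sum>l\<in>I. \<Sum>m\<in>I. h (star (w m k) * w m l) *\<^sub>C (star (w k i) * w l j))"
    by (subst sum.swap) (intro sum.cong refl sum.swap)
  ultimately show ?thesis
    using ij by (simp add: gram_entry a_def h_lin scaleC_sum_left)
qed

text \<open>In matrix form: \<open>w* Q = Q v\<close>.\<close>

lemma gram_inverse:
  assumes ij: "i \<in> I" "j \<in> I"
  shows "(\<Sum>k\<in>I. Q k j *\<^sub>C star (w k i)) = (\<Sum>m\<in>I. Q i m *\<^sub>C v m j)"
proof -
  have "(\<Sum>m\<in>I. Q i m *\<^sub>C v m j) = (\<Sum>m\<in>I. (Q i m *\<^sub>C 1) * v m j)"
    by (simp add: mult_scaleC_left)
  also have "\<dots> = (\<Sum>m\<in>I. \<Sum>k\<in>I. \<Sum>l\<in>I. Q k l *\<^sub>C (star (w k i) * w l m) * v m j)"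
    using gram_invariant[OF ij(1)] by (intro sum.cong refl) (simp add: sum_distrib_right[symmetric])
  also have "\<dots> = (\<Sum>k\<in>I. \<Sum>l\<in>I. \<Sum>m\<in>I. Q k l *\<^sub>C (star (w k i) * w l m) * v m j)"
    by (subst sum.swap) (intro sum.cong refl sum.swap)
  also have "\<dots> = (\<Sum>k\<in>I. \<Sum>l\<in>I. Q k l *\<^sub>C (star (w k i) * (\<Sum>m\<in>I. w l m * v m j)))"
    by (simp add: mult_scaleC_left mult.assoc sum_distrib_left scaleC_sum_right)
  also have "\<dots> = (\<Sum>k\<in>I. \<Sum>l\<in>I. if l = j then Q k l *\<^sub>C star (w k i) else 0)"
    using ij goodD(5)[OF good] by (intro sum.cong refl) auto
  also have "\<dots> = (\<Sum>k\<in>I. Q k j *\<^sub>C star (w k i))" using ij fin by simp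
  finally show ?thesis by simp
qed

text \<open>The quadratic form is the sum of the h(c_k* c_k) with c = w \<xi>. If it is not
  positive, every c_k is a null vector of \<open>h\<close>, so h(v_ik c_k) = 0, and summing over k
  gives \<xi>_i = 0 since v w = 1.\<close>

lemma gram_definite:
  assumes z: "Re (\<Sum>i\<in>I. \<Sum>j\<in>I. cnj (\<xi> i) * Q i j * \<xi> j) \<le> 0" and i: "i \<in> I"
  shows "\<xi> i = 0"
proof -
  define c where "c k = (\<Sum>j\<in>I. \<xi> j *\<^sub>C w k j)" for k
  have "(\<Sum>k\<in>I. h (star (c k) * c k)) = (\<Sum>k\<in>I. \<Sum>i\<in>I. \<Sum>j\<in>I. cnj (\<xi> i) * \<xi> j * h (star (w k i) * w k j))"
    by (simp add: c_def star_sum star_scaleC sum_product mult_scaleC_left mult_scaleC_right scaleC_scaleC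
        h_lin mult.commute mult.left_commute)
  also have "\<dots> = (\<Sum>i\<in>I. \<Sum>j\<in>I. \<Sum>k\<in>I. cnj (\<xi> i) * \<xi> j * h (star (w k i) * w k j))"
    by (subst sum.swap) (intro sum.cong refl sum.swap)
  also have "\<dots> = (\<Sum>i\<in>I. \<Sum>j\<in>I. cnj (\<xi> i) * Q i j * \<xi> j)"
    by (intro sum.cong refl) (simp add: gram_entry h_lin sum_distrib_left sum_distrib_right mult.assoc mult.commute mult.left_commute)
  finally have "(\<Sum>k\<in>I. Re (h (star (c k) * c k))) \<le> 0" using z by (metis Re_sum)
  moreover have nn: "\<And>k. k \<in> I \<Longrightarrow> 0 \<le> Re (h (star (c k) * c k))" using stateD(4)[OF h] by blast
  ultimately have "(\<Sum>k\<in>I. Re (h (star (c k) * c k))) = 0" by (intro antisym sum_nonneg nn)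
  then have "Re (h (star (c k) * c k)) = 0" if "k \<in> I" for k
    using sum_nonneg_eq_0_iff[OF fin, of "\<lambda>k. Re (h (star (c k) * c k))"] nn that by blast
  then have "h (star (c k) * c k) = 0" if "k \<in> I" for k
    using that stateD(5)[OF h] by (simp add: complex_eq_iff)
  then have hc: "h (v i k * c k) = 0" if "k \<in> I" for k
    using that by (simp add: state_null_left_kernel[OF h])
  have "0 = h (\<Sum>k\<in>I. v i k * c k)" using hc by (simp add: h_lin)
  also have "(\<Sum>k\<in>I. v i k * c k) = (\<Sum>k\<in>I. \<Sum>j\<in>I. \<xi> j *\<^sub>C (v i k * w k j))"
    by (simp add: c_def sum_distrib_left mult_scaleC_right)
  also have "\<dots> = (\<Sum>j\<in>I. \<xi> j *\<^sub>C (\<Sum>k\<in>I. v i k * w k j))"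
    by (subst sum.swap) (simp add: scaleC_sum_right)
  also have "\<dots> = (\<Sum>j\<in>I. if i = j then \<xi> j *\<^sub>C 1 else 0)"
    using goodD(4)[OF good i] by (intro sum.cong) auto
  also have "\<dots> = \<xi> i *\<^sub>C 1" using i fin by simp
  finally show ?thesis by (simp add: h_lin stateD(2)[OF h])
qed

text \<open>Definiteness makes multiplication by Q injective, which gives a right inverse; Q being
  hermitian, its adjoint is a left inverse and the two agree.\<close>

lemma gram_invertible:
  obtains P where "on_index I P" "mm P Q = mat_id I" "mm Q P = mat_id I" "mat_adj P = P"
proof -
  have "\<exists>P\<in>{x. on_index I x}. mm Q P = mat_id I"
  proof (rule mat_surj_if_inj[OF fin])
    show "cfun.subspace {x. on_index I x}" by (auto simp: cfun.subspace_def)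
    show "x = 0" if x: "x \<in> {x. on_index I x}" and 0: "mm Q x = 0" for x
    proof (rule on_index_eqI[of I])
      fix i j assume ij: "i \<in> I" "j \<in> I"
      have "(\<Sum>k\<in>I. Q i k * x k j) = 0" if "i \<in> I" for i
        using 0 mat_mul_entry[OF that ij(2), of Q x] by simp
      then have "(\<Sum>i\<in>I. \<Sum>k\<in>I. cnj (x i j) * Q i k * x k j) = 0"
        by (simp add: mult.assoc sum_distrib_left[symmetric])
      then show "x i j = 0 i j" using gram_definite[of "\<lambda>i. x i j" i] ij by simp
    qed (use x in simp_all)
  qed (auto simp: mat_mul_add)
  then obtain P where P: "on_index I P" "mm Q P = mat_id I" by blast
  have "mm (mat_adj P) Q = mat_id I"
    using arg_cong[OF P(2), of mat_adj] by (simp add: mat_adj_mul gram_hermitian)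
  then have "mat_adj P = P"
    using mat_mul_assoc[of I "mat_adj P" Q P] P by (simp add: mat_mul_id[OF fin])
  with \<open>mm (mat_adj P) Q = mat_id I\<close> P show thesis using that by simp
qed

text \<open>The relation w* Q = Q v gives v = P w* Q, whose entries are combinations of adjoints of
  entries of \<open>w\<close>.\<close>

lemma inverse_in_subalgebra:
  assumes ij: "i \<in> I" "j \<in> I"
  shows "v i j \<in> A0"
proof -
  obtain P where P: "on_index I P" "mm P Q = mat_id I" by (rule gram_invertible)
  have "(\<Sum>k\<in>I. P i k *\<^sub>C (\<Sum>l\<in>I. Q l j *\<^sub>C star (w l k))) = (\<Sum>k\<in>I. P i k *\<^sub>C (\<Sum>m\<in>I. Q k m *\<^sub>C v m j))"
    by (intro sum.cong refl) (simp only: gram_inverse[OF _ ij(2)])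
  also have "\<dots> = (\<Sum>m\<in>I. mm P Q i m *\<^sub>C v m j)"
    unfolding scaleC_sum_right scaleC_scaleC
    by (subst sum.swap) (use ij in \<open>simp add: mat_mul_entry scaleC_sum_left\<close>)
  also have "\<dots> = (\<Sum>m\<in>I. if i = m then v m j else 0)"
    unfolding P using ij by (intro sum.cong) (auto simp: mat_id_def restrict_index_def)
  also have "\<dots> = v i j" using ij fin by simp
  finally have "(\<Sum>k\<in>I. P i k *\<^sub>C (\<Sum>l\<in>I. Q l j *\<^sub>C star (w l k))) = v i j" .
  moreover have "(\<Sum>k\<in>I. P i k *\<^sub>C (\<Sum>l\<in>I. Q l j *\<^sub>C star (w l k))) \<in> A0"
    by (intro A0_closed(6) A0_closed(3) A0_closed(5) goodD(3)[OF good])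
  ultimately show ?thesis by simp
qed

end

lemma transpose_inverse_in_subalgebra:
  fixes I :: "nat set"
  assumes good: "good I w v t" and ij: "i \<in> I" "j \<in> I"
  shows "t i j \<in> A0"
proof -
  have "star (t i j) \<in> A0" using inverse_in_subalgebra[OF good_star[OF good] ij(2,1)] .
  then show ?thesis using A0_closed(5)[of "star (t i j)"] by (simp add: star_star)
qed


section \<open>The counit among the Haar functionals\<close>

context
  fixes I :: "nat set" and w v t :: "nat \<Rightarrow> nat \<Rightarrow> 'a" and P
  assumes good: "good I w v t"
    and P: "on_index I P" "mat_mul I P (gram h I w) = mat_id I" "mat_mul I (gram h I w) P = mat_id I"
      "mat_adj P = P"
begin

abbreviation (input) gr ("\<Q>") where "\<Q> \<equiv> gram h I w"
abbreviation (input) hm ("\<B>") where "\<B> \<equiv> haar_matrices h I w"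
abbreviation (input) prod_mat (infixl "\<bullet>\<bullet>" 70) where "(\<bullet>\<bullet>) \<equiv> mat_mul I"
text \<open>The adjoint of \<open>y\<close> for the inner product with Gram matrix Q.\<close>

definition circ where "circ y = mat_mul I P (mat_mul I (mat_adj y) (gram h I w))"

lemmas finite_index = goodD(2)[OF good]

lemma on_index_haar_matrices: "x \<in> \<B> \<Longrightarrow> on_index I x"
  by (auto simp: haar_matrices_def)

lemma subspace_haar_matrices: "cfun.subspace \<B>"
  unfolding cfun.subspace_def
proof (intro conjI ballI allI)
  show "0 \<in> \<B>"
    unfolding haar_matrices_def using A0_closed(1)
    by (auto simp: restrict_index_def fun_eq_iff h_lin intro!: exI[of _ 0])
  show "x + y \<in> \<B>" if "x \<in> \<B>" "y \<in> \<B>" for x y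
  proof -
    obtain b c where "b \<in> A0" "c \<in> A0" "x = restrict_index I (\<lambda>i j. h (b * w i j))"
      "y = restrict_index I (\<lambda>i j. h (c * w i j))"
      using \<open>x \<in> \<B>\<close> \<open>y \<in> \<B>\<close> by (auto simp: haar_matrices_def)
    then show ?thesis
      unfolding haar_matrices_def using A0_closed(2)[of b c]
      by (auto simp: restrict_index_def fun_eq_iff h_lin distrib_right intro!: exI[of _ "b + c"])
  qed
  show "cfun_scale c x \<in> \<B>" if "x \<in> \<B>" for c x
  proof -
    obtain b where "b \<in> A0" "x = restrict_index I (\<lambda>i j. h (b * w i j))"
      using \<open>x \<in> \<B>\<close> by (auto simp: haar_matrices_def)
    then show ?thesis
      unfolding haar_matrices_def using A0_closed(3)[of b c]
      by (auto simp: restrict_index_def cfun_scale_def fun_eq_iff h_lin mult_scaleC_left intro!: exI[of _ "c *\<^sub>C b"])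
  qed
qed

text \<open>Right invariance applied to \<open>b w\<^sub>i\<^sub>j\<close>, multiplied by the inverse matrix.\<close>

lemma strong_invariance:
  assumes b: "b \<in> A0" "\<Phi> b = (\<Sum>s\<in>S. tens (x s) (y s))" and im: "i \<in> I" "m \<in> I"
  shows "(\<Sum>j\<in>I. h (b * w i j) *\<^sub>C v j m) = (\<Sum>s\<in>S. h (x s * w i m) *\<^sub>C y s)"
proof -
  have inv: "h (b * w i j) *\<^sub>C 1 = (\<Sum>s\<in>S. \<Sum>k\<in>I. h (x s * w i k) *\<^sub>C (y s * w k j))" if j: "j \<in> I" for j
  proof -
    have "\<Phi> (b * w i j) = (\<Sum>s\<in>S. \<Sum>k\<in>I. tens (x s * w i k) (y s * w k j))"
      using im j by (simp add: comult_mult b(2) corepD[OF goodD(1)[OF good]] sum_product tens_mult)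
    also have "\<dots> = (\<Sum>p\<in>S \<times> I. tens (x (fst p) * w i (snd p)) (y (fst p) * w (snd p) j))"
      by (simp add: sum.cartesian_product')
    finally have "\<Phi> (b * w i j) = \<dots>" .
    from right_inv[OF _ this] show ?thesis
      using b(1) im j by (simp add: A0_closed(4) goodD(3)[OF good] sum.cartesian_product')
  qed
  have "(\<Sum>j\<in>I. h (b * w i j) *\<^sub>C v j m) = (\<Sum>j\<in>I. (h (b * w i j) *\<^sub>C 1) * v j m)"
    by (simp add: mult_scaleC_left)
  also have "\<dots> = (\<Sum>j\<in>I. \<Sum>s\<in>S. \<Sum>k\<in>I. h (x s * w i k) *\<^sub>C (y s * (w k j * v j m)))"
    by (intro sum.cong refl) (simp add: inv sum_distrib_right mult_scaleC_left mult.assoc)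
  also have "\<dots> = (\<Sum>s\<in>S. \<Sum>k\<in>I. \<Sum>j\<in>I. h (x s * w i k) *\<^sub>C (y s * (w k j * v j m)))"
    by (subst sum.swap) (intro sum.cong refl sum.swap)
  also have "\<dots> = (\<Sum>s\<in>S. \<Sum>k\<in>I. h (x s * w i k) *\<^sub>C (y s * (\<Sum>j\<in>I. w k j * v j m)))"
    by (simp add: scaleC_sum_right sum_distrib_left)
  also have "\<dots> = (\<Sum>s\<in>S. \<Sum>k\<in>I. if k = m then h (x s * w i k) *\<^sub>C y s else 0)"
    using im goodD(5)[OF good] by (intro sum.cong refl) auto
  also have "\<dots> = (\<Sum>s\<in>S. h (x s * w i m) *\<^sub>C y s)" using im finite_index by simp
  finally show ?thesis .
qed

text \<open>Because w* Q = Q v, the adjoint with respect to Q trades \<open>w\<close> for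
  \<open>v\<close>. The resulting factors \<open>v i j\<close> are what
  \<open>strong_invariance\<close> can absorb.\<close>

lemma circ_eq:
  "circ (restrict_index I (\<lambda>i j. h (c * w i j))) = restrict_index I (\<lambda>i j. h (v i j * star c))"
  (is "circ ?y = ?z")
proof -
  have "\<Q> \<bullet>\<bullet> ?z = mat_adj ?y \<bullet>\<bullet> \<Q>"
  proof (rule on_index_eqI[of I])
    fix i j assume ij: "i \<in> I" "j \<in> I"
    have "(\<Q> \<bullet>\<bullet> ?z) i j = (\<Sum>m\<in>I. \<Q> i m * h (v m j * star c))"
      using ij by (simp add: mat_mul_entry restrict_index_def)
    also have "\<dots> = h ((\<Sum>m\<in>I. \<Q> i m *\<^sub>C v m j) * star c)"
      by (simp add: sum_distrib_right mult_scaleC_left h_lin)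
    also have "\<dots> = h ((\<Sum>k\<in>I. \<Q> k j *\<^sub>C star (w k i)) * star c)"
      by (simp only: gram_inverse[OF good ij])
    also have "\<dots> = (\<Sum>k\<in>I. \<Q> k j * h (star (c * w k i)))"
      by (simp add: sum_distrib_right mult_scaleC_left h_lin star_mult)
    also have "\<dots> = (mat_adj ?y \<bullet>\<bullet> \<Q>) i j"
      using ij by (simp add: mat_mul_entry mat_adj_def restrict_index_def state_star[OF h] mult.commute)
    finally show "(\<Q> \<bullet>\<bullet> ?z) i j = (mat_adj ?y \<bullet>\<bullet> \<Q>) i j" .
  qed simp_all
  then have "circ ?y = (P \<bullet>\<bullet> \<Q>) \<bullet>\<bullet> ?z" unfolding circ_def by (simp add: mat_mul_assoc)
  then show ?thesis by (simp add: P mat_mul_id[OF finite_index])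
qed

text \<open>Strong invariance turns the product into the matrix of \<open>b'\<close>, the slice by
  \<open>h\<close> in the second leg of \<open>\<Phi> b\<close> times 1 \<otimes>
  \<open>star c\<close>.\<close>

lemma mult_circ_in_haar_matrices:
  assumes "x \<in> \<B>" "y \<in> \<B>"
  shows "x \<bullet>\<bullet> circ y \<in> \<B>"
proof -
  obtain b where b: "b \<in> A0" "x = restrict_index I (\<lambda>i j. h (b * w i j))"
    using assms(1) unfolding haar_matrices_def by blast
  obtain c where c: "c \<in> A0" "y = restrict_index I (\<lambda>i j. h (c * w i j))"
    using assms(2) unfolding haar_matrices_def by blast
  obtain S :: "(nat \<times> nat \<times> nat) set" and r s
    where S: "\<And>k. k \<in> S \<Longrightarrow> r k \<in> A0" "\<Phi> b = (\<Sum>k\<in>S. tens (r k) (s k))"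
    using comult_decompose[OF b(1)] by metis
  define b' where "b' = (\<Sum>k\<in>S. h (s k * star c) *\<^sub>C r k)"
  have "x \<bullet>\<bullet> circ y = restrict_index I (\<lambda>i j. h (b' * w i j))"
  proof (rule on_index_eqI[of I])
    fix i m assume im: "i \<in> I" "m \<in> I"
    have "(x \<bullet>\<bullet> circ y) i m = (\<Sum>j\<in>I. h (b * w i j) * h (v j m * star c))"
      using im unfolding c(2) circ_eq b(2) by (simp add: mat_mul_entry restrict_index_def)
    also have "\<dots> = h ((\<Sum>j\<in>I. h (b * w i j) *\<^sub>C v j m) * star c)"
      by (simp add: sum_distrib_right mult_scaleC_left h_lin)
    also have "\<dots> = h ((\<Sum>k\<in>S. h (r k * w i m) *\<^sub>C s k) * star c)"
      by (simp only: strong_invariance[OF b(1) S(2) im])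
    also have "\<dots> = h (b' * w i m)"
      by (simp add: b'_def sum_distrib_right mult_scaleC_left h_lin mult.commute)
    finally show "(x \<bullet>\<bullet> circ y) i m = restrict_index I (\<lambda>i j. h (b' * w i j)) i m"
      using im by (simp add: restrict_index_def)
  qed simp_all
  moreover have "b' \<in> A0" unfolding b'_def by (intro A0_closed(6) A0_closed(3) S(1))
  ultimately show ?thesis unfolding haar_matrices_def by blast
qed

lemma circ_add: "circ (x + y) = circ x + circ y"
  by (simp add: circ_def mat_adj_add mat_mul_add)

lemma circ_sum: "circ (sum f A) = (\<Sum>a\<in>A. circ (f a))"
proof -
  have "circ 0 = 0" using circ_add[of 0 0] by simp
  then show ?thesis
  proof (induction A rule: infinite_finite_induct)
    case (infinite A)
    then show ?case by (simp only: sum.infinite[OF infinite(1)])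
  next
    case (insert a A)
    then show ?case by (simp only: sum.insert[OF insert(1,2)] circ_add)
  qed (simp only: sum.empty)
qed

text \<open>A matrix times its adjoint for Q is self-adjoint for Q.\<close>

lemma circ_mult_circ: "on_index I x \<Longrightarrow> circ (x \<bullet>\<bullet> circ x) = x \<bullet>\<bullet> circ x"
proof -
  assume x: "on_index I x"
  have "circ (x \<bullet>\<bullet> circ x) = (P \<bullet>\<bullet> \<Q>) \<bullet>\<bullet> x \<bullet>\<bullet> P \<bullet>\<bullet> mat_adj x \<bullet>\<bullet> \<Q>"
    by (simp add: circ_def mat_adj_mul gram_hermitian[OF good] P(4) mat_mul_assoc)
  then show ?thesis using x by (simp add: P mat_mul_id[OF finite_index] circ_def mat_mul_assoc)
qed

lemma mat_mul_sum: "x \<bullet>\<bullet> sum f A = (\<Sum>a\<in>A. x \<bullet>\<bullet> f a)" "sum f A \<bullet>\<bullet> x = (\<Sum>a\<in>A. f a \<bullet>\<bullet> x)"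
  by (induction A rule: infinite_finite_induct) (auto simp: mat_mul_add)

lemma gram_form_nonneg: "0 \<le> Re (\<Sum>i\<in>I. \<Sum>j\<in>I. cnj (\<xi> i) * \<Q> i j * \<xi> j)"
proof (rule ccontr)
  assume n: "\<not> ?thesis"
  then have "\<xi> i = 0" if "i \<in> I" for i using gram_definite[OF good _ that, of \<xi>] by linarith
  then have "(\<Sum>i\<in>I. \<Sum>j\<in>I. cnj (\<xi> i) * \<Q> i j * \<xi> j) = 0" by (intro sum.neutral) simp
  with n show False by simp
qed

text \<open>Multiplying on the right by P x* turns the sum into a sum of matrices Z* Q Z with Z = P
  (x f)*, whose diagonal entries are nonnegative. As they add up to 0, definiteness of Q gives Z = 0
  for every term.\<close>

lemma mult_circ_sum_eq_0:
  assumes x: "on_index I x" and fA: "finite A" and f: "\<And>a. a \<in> A \<Longrightarrow> on_index I (f a)"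
    and z: "x \<bullet>\<bullet> (\<Sum>a\<in>A. f a \<bullet>\<bullet> circ (f a)) = 0" and a: "a \<in> A"
  shows "x \<bullet>\<bullet> f a = 0"
proof -
  define Z where "Z a = P \<bullet>\<bullet> mat_adj (x \<bullet>\<bullet> f a)" for a
  define N where "N a = mat_adj (Z a) \<bullet>\<bullet> (\<Q> \<bullet>\<bullet> Z a)" for a
  have QZ: "\<Q> \<bullet>\<bullet> Z a = mat_adj (x \<bullet>\<bullet> f a)" for a
    using mat_mul_assoc[of I \<Q> P "mat_adj (x \<bullet>\<bullet> f a)"] by (simp add: Z_def P mat_mul_id[OF finite_index])
  have N: "N a = (x \<bullet>\<bullet> f a \<bullet>\<bullet> circ (f a)) \<bullet>\<bullet> (P \<bullet>\<bullet> mat_adj x)" if "a \<in> A" for a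
  proof -
    have "(x \<bullet>\<bullet> f a \<bullet>\<bullet> circ (f a)) \<bullet>\<bullet> (P \<bullet>\<bullet> mat_adj x)
        = x \<bullet>\<bullet> f a \<bullet>\<bullet> P \<bullet>\<bullet> (mat_adj (f a) \<bullet>\<bullet> ((\<Q> \<bullet>\<bullet> P) \<bullet>\<bullet> mat_adj x))"
      by (simp add: circ_def mat_mul_assoc)
    also have "\<dots> = x \<bullet>\<bullet> f a \<bullet>\<bullet> P \<bullet>\<bullet> mat_adj (x \<bullet>\<bullet> f a)"
      using x by (simp add: P mat_mul_id[OF finite_index] mat_adj_mul)
    also have "\<dots> = N a"
      unfolding N_def QZ by (simp add: Z_def mat_adj_mul P mat_mul_assoc)
    finally show ?thesis by simp
  qed
  have "(\<Sum>a\<in>A. N a) = (\<Sum>a\<in>A. (x \<bullet>\<bullet> (f a \<bullet>\<bullet> circ (f a))) \<bullet>\<bullet> (P \<bullet>\<bullet> mat_adj x))"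
    by (intro sum.cong refl) (simp add: N mat_mul_assoc)
  also have "\<dots> = 0" using z by (simp add: mat_mul_sum(1) flip: mat_mul_sum(2))
  finally have sumN: "(\<Sum>a\<in>A. N a i j) = 0" for i j
    by (metis sum_fun_apply zero_fun_apply)
  have N_entry: "N a i i = (\<Sum>k\<in>I. \<Sum>l\<in>I. cnj (Z a k i) * \<Q> k l * Z a l i)" if "i \<in> I" for a i
    using that by (simp add: N_def mat_mul_entry mat_adj_def sum_distrib_left mult.assoc)
  have "Z a k i = 0" if ki: "k \<in> I" "i \<in> I" for k i
  proof -
    have nn: "0 \<le> Re (N a i i)" for a using gram_form_nonneg[of "\<lambda>k. Z a k i"] by (simp add: N_entry[OF ki(2)])
    have "(\<Sum>a\<in>A. Re (N a i i)) = 0" using sumN[of i i] by (metis Re_sum zero_complex.simps(1))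
    then have "Re (N a i i) = 0" using sum_nonneg_eq_0_iff[OF fA, of "\<lambda>a. Re (N a i i)"] nn a by simp
    then show ?thesis
      using gram_definite[OF good _ ki(1), of "\<lambda>k. Z a k i"] by (simp add: N_entry[OF ki(2)])
  qed
  then have "Z a = 0"
    by (intro on_index_eqI[of I]) (auto simp: Z_def)
  then have "mat_adj (x \<bullet>\<bullet> f a) = 0" using QZ[of a] by simp
  then have "mat_adj (mat_adj (x \<bullet>\<bullet> f a)) = mat_adj 0" by simp
  moreover have "mat_adj 0 = (0 :: nat \<Rightarrow> nat \<Rightarrow> complex)"
    by (rule on_index_eqI[of I]) (simp_all add: mat_adj_def)
  ultimately show ?thesis by simp
qed

text \<open>The element \<open>C\<close> is chosen so that x C = 0 forces x = 0. Right
  multiplication by \<open>C\<close> maps the space into itself, because \<open>C\<close> equals its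
  own \<open>circ\<close>, and is injective, so e C = C for some e in the space; then (e - 1) C = 0
  and e is the identity.\<close>

lemma id_in_haar_matrices: "mat_id I \<in> \<B>"
proof -
  \<comment> \<open>These members suffice for cancellation: if x annihilates all of them, summing
    the entries (i, j) of x X(m, j) over j inverts the transpose and leaves the entry (i, m) of
    x.\<close>
  define X where "X = (\<lambda>(m, j). restrict_index I (\<lambda>i l. h (t m j * w i l)))"
  have X: "X p \<in> \<B>" if "p \<in> I \<times> I" for p
    using that transpose_inverse_in_subalgebra[OF good] by (auto simp: X_def haar_matrices_def)
  define C where "C = (\<Sum>p\<in>I \<times> I. X p \<bullet>\<bullet> circ (X p))"
  have CB: "C \<in> \<B>" unfolding C_def
    by (intro cfun.subspace_sum[OF subspace_haar_matrices] mult_circ_in_haar_matrices X)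
  have circC: "circ C = C" unfolding C_def circ_sum
    by (intro sum.cong refl circ_mult_circ on_index_haar_matrices X)
  have cancel: "x = 0" if x: "on_index I x" and z: "x \<bullet>\<bullet> C = 0" for x
  proof (rule on_index_eqI[of I])
    fix i m assume im: "i \<in> I" "m \<in> I"
    have "(\<Sum>k\<in>I. x i k * h (t m j * w k j)) = 0" if j: "j \<in> I" for j
    proof -
      have "x \<bullet>\<bullet> X (m, j) = 0"
        by (rule mult_circ_sum_eq_0[OF x _ _ z[unfolded C_def]])
          (use finite_index im j X on_index_haar_matrices in auto)
      then have "(x \<bullet>\<bullet> X (m, j)) i j = 0" by simp
      then show ?thesis using im j by (simp add: mat_mul_entry X_def restrict_index_def)
    qed
    then have "0 = (\<Sum>j\<in>I. \<Sum>k\<in>I. x i k * h (t m j * w k j))" by simp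
    also have "\<dots> = (\<Sum>k\<in>I. x i k * h (\<Sum>j\<in>I. t m j * w k j))"
      by (subst sum.swap) (simp add: h_lin sum_distrib_left)
    also have "\<dots> = (\<Sum>k\<in>I. if m = k then x i k else 0)"
      using goodD(6)[OF good im(2)] by (intro sum.cong) (auto simp: h_lin stateD(2)[OF h])
    also have "\<dots> = x i m" using im finite_index by simp
    finally show "x i m = 0 i m" by simp
  qed (use x in simp_all)
  obtain e where e: "e \<in> \<B>" "e \<bullet>\<bullet> C = C"
  proof (rule mat_surj_if_inj[OF finite_index subspace_haar_matrices, of "\<lambda>x. x \<bullet>\<bullet> C" C])
    show "x \<bullet>\<bullet> C \<in> \<B>" if "x \<in> \<B>" for x
      using mult_circ_in_haar_matrices[OF that CB] by (simp add: circC)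
  qed (use on_index_haar_matrices cancel CB in \<open>auto simp: mat_mul_add\<close>)
  have "(e - mat_id I) \<bullet>\<bullet> C = 0"
    using e on_index_haar_matrices[OF CB] by (simp add: mat_mul_add mat_mul_id[OF finite_index])
  moreover have "on_index I (e - mat_id I)" using e on_index_haar_matrices by simp
  ultimately have "e - mat_id I = 0" by (rule cancel[rotated])
  then show ?thesis using e by simp
qed

lemma coefficients_vanish:
  assumes z: "(\<Sum>i\<in>I. \<Sum>j\<in>I. f i j *\<^sub>C w i j) = 0"
  shows "(\<Sum>i\<in>I. \<Sum>j\<in>I. f i j *\<^sub>C v i j) = 0"
proof -
  obtain b where b: "b \<in> A0" "mat_id I = restrict_index I (\<lambda>i j. h (b * w i j))"
    using id_in_haar_matrices unfolding haar_matrices_def by blast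
  have hb: "h (b * w i j) = (if i = j then 1 else 0)" if "i \<in> I" "j \<in> I" for i j
    using fun_cong[OF fun_cong[OF b(2)], of i j] that by (simp add: mat_id_def restrict_index_def)
  obtain S :: "(nat \<times> nat \<times> nat) set" and r s where S: "\<Phi> b = (\<Sum>k\<in>S. tens (r k) (s k))"
    using comult_decompose[OF b(1)] by metis
  \<comment> \<open>The factors \<open>r k\<close> and \<open>s k\<close> come from \<open>b\<close>
    alone, so \<open>v i m\<close> is the image of \<open>w i m\<close> under one linear map, the
    same for all indices.\<close>
  have v: "v i m = (\<Sum>k\<in>S. h (r k * w i m) *\<^sub>C s k)" if im: "i \<in> I" "m \<in> I" for i m
  proof -
    have "(\<Sum>j\<in>I. h (b * w i j) *\<^sub>C v j m) = (\<Sum>j\<in>I. if i = j then v j m else 0)"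
      using hb im by (intro sum.cong) auto
    then show ?thesis using strong_invariance[OF b(1) S im] im finite_index by simp
  qed
  have "(\<Sum>i\<in>I. \<Sum>m\<in>I. f i m *\<^sub>C v i m)
      = (\<Sum>i\<in>I. \<Sum>m\<in>I. \<Sum>k\<in>S. h (r k * (f i m *\<^sub>C w i m)) *\<^sub>C s k)"
    by (intro sum.cong refl) (simp add: v scaleC_sum_right scaleC_scaleC mult_scaleC_right h_lin)
  also have "\<dots> = (\<Sum>i\<in>I. \<Sum>k\<in>S. \<Sum>m\<in>I. h (r k * (f i m *\<^sub>C w i m)) *\<^sub>C s k)"
    by (intro sum.cong refl sum.swap)
  also have "\<dots> = (\<Sum>k\<in>S. \<Sum>i\<in>I. \<Sum>m\<in>I. h (r k * (f i m *\<^sub>C w i m)) *\<^sub>C s k)" by (rule sum.swap)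
  also have "\<dots> = (\<Sum>k\<in>S. h (r k * (\<Sum>i\<in>I. \<Sum>m\<in>I. f i m *\<^sub>C w i m)) *\<^sub>C s k)"
    by (simp only: sum_distrib_left h_lin(7) scaleC_sum_left)
  also have "\<dots> = 0" by (simp add: z h_lin)
  finally show ?thesis .
qed

end

section \<open>The antipode as a map\<close>

text \<open>Additivity of the relation reduces two presentations of \<open>a\<close> to a single
  presentation of 0 with image b - c, where \<open>coefficients_vanish\<close> applies.\<close>

lemma antipode_unique:
  assumes "antipode a b" "antipode a c"
  shows "b = c"
proof -
  have "antipode (a + (-1) *\<^sub>C a) (b + (-1) *\<^sub>C c)"
    using assms by (intro antipode_add antipode_scale)
  then have "antipode 0 (b - c)" by (simp add: scaleC_minus_one)
  then obtain I :: "nat set" and w v t f where g: "good I w v t"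
    and 0: "0 = (\<Sum>i\<in>I. \<Sum>j\<in>I. f i j *\<^sub>C w i j)" "b - c = (\<Sum>i\<in>I. \<Sum>j\<in>I. f i j *\<^sub>C v i j)"
    unfolding antipode_def by blast
  obtain P where "on_index I P" "mat_mul I P (gram h I w) = mat_id I" "mat_mul I (gram h I w) P = mat_id I"
      "mat_adj P = P" by (rule gram_invertible[OF g])
  from coefficients_vanish[OF g this 0(1)[symmetric]] show ?thesis using 0(2) by simp
qed

lemma antipode_in_subalgebra:
  assumes "antipode a b"
  shows "b \<in> A0"
proof -
  obtain I :: "nat set" and w v t f where g: "good I w v t"
    and b: "b = (\<Sum>i\<in>I. \<Sum>j\<in>I. f i j *\<^sub>C v i j)"
    using assms unfolding antipode_def by blast
  show ?thesis unfolding b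
    by (intro A0_closed(6) A0_closed(3) inverse_in_subalgebra[OF g])
qed

definition \<kappa> :: "'a \<Rightarrow> 'a"
  where "\<kappa> a = (THE b. antipode a b)"

lemma \<kappa>_eq: "antipode a b \<Longrightarrow> \<kappa> a = b"
  unfolding \<kappa>_def using antipode_unique by blast

lemma \<kappa>: "a \<in> A0 \<Longrightarrow> antipode a (\<kappa> a)"
  using domain \<kappa>_eq by blast

lemma \<kappa>_closed: "a \<in> A0 \<Longrightarrow> \<kappa> a \<in> A0"
  using \<kappa> antipode_in_subalgebra by blast

lemma \<kappa>_add: "a \<in> A0 \<Longrightarrow> b \<in> A0 \<Longrightarrow> \<kappa> (a + b) = \<kappa> a + \<kappa> b"
  and \<kappa>_scale: "a \<in> A0 \<Longrightarrow> \<kappa> (c *\<^sub>C a) = c *\<^sub>C \<kappa> a"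
  and \<kappa>_mult: "a \<in> A0 \<Longrightarrow> b \<in> A0 \<Longrightarrow> \<kappa> (a * b) = \<kappa> b * \<kappa> a"
  by (intro \<kappa>_eq antipode_add antipode_scale antipode_mult \<kappa>; assumption)+

lemma \<kappa>_zero: "\<kappa> 0 = 0"
  by (rule \<kappa>_eq) (rule antipode_zero)

lemma \<kappa>_sum: "(\<And>i. i \<in> S \<Longrightarrow> f i \<in> A0) \<Longrightarrow> \<kappa> (sum f S) = (\<Sum>i\<in>S. \<kappa> (f i))"
  by (induction S rule: infinite_finite_induct) (auto simp: \<kappa>_zero \<kappa>_add A0_closed)

text \<open>Applying \<kappa> to the relation between \<open>t\<close> and the transpose of
  \<open>w\<close> gives a relation between \<open>v\<close> and the \<kappa> (t k j); multiplying
  it by \<open>w\<close> from the left solves for them.\<close>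

lemma \<kappa>_transpose_inverse:
  fixes I :: "nat set"
  assumes g: "good I w v t" and kl: "k \<in> I" "l \<in> I"
  shows "\<kappa> (t k l) = w l k"
proof -
  note t = transpose_inverse_in_subalgebra[OF g] and w = goodD(3)[OF g] and v = inverse_in_subalgebra[OF g]
  have \<kappa>w: "\<kappa> (w i j) = v i j" if "i \<in> I" "j \<in> I" for i j
    by (rule \<kappa>_eq antipode_entry[OF g that])+
  have "(\<Sum>j\<in>I. t k j * w k j) \<in> A0" using kl t w by (intro A0_closed) auto
  then have one: "1 \<in> A0" using goodD(6)[OF g kl(1) kl(1)] by simp
  \<comment> \<open>That \<kappa> fixes 1 follows in two moves: \<kappa> 1 is a right unit for the
    entries of \<open>v\<close>, and products of these with entries of \<open>w\<close> sum to
    1.\<close>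
  have "v i j * \<kappa> 1 = v i j" if ij: "i \<in> I" "j \<in> I" for i j
    using \<kappa>_mult[OF one w[OF ij]] \<kappa>w[OF ij] by simp
  then have "(\<Sum>j\<in>I. w k j * v j k) * \<kappa> 1 = (\<Sum>j\<in>I. w k j * v j k)"
    using kl by (simp add: sum_distrib_right mult.assoc)
  then have \<kappa>1: "\<kappa> 1 = 1" using goodD(5)[OF g kl(1) kl(1)] by simp
  have eq: "(\<Sum>j\<in>I. v i j * \<kappa> (t k j)) = (if k = i then 1 else 0)" if i: "i \<in> I" for i
  proof -
    have "(\<Sum>j\<in>I. v i j * \<kappa> (t k j)) = \<kappa> (\<Sum>j\<in>I. t k j * w i j)"
      using i kl t w by (subst \<kappa>_sum) (auto simp: \<kappa>_mult \<kappa>w A0_closed)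
    then show ?thesis using goodD(6)[OF g kl(1) i] by (auto simp: \<kappa>1 \<kappa>_zero)
  qed
  have "\<kappa> (t k l) = (\<Sum>j\<in>I. (if l = j then 1 else 0) * \<kappa> (t k j))"
    using kl goodD(2)[OF g] by (simp add: if_distrib[of "\<lambda>x. x * _"] cong: if_cong)
  also have "\<dots> = (\<Sum>j\<in>I. \<Sum>i\<in>I. w l i * (v i j * \<kappa> (t k j)))"
    using goodD(5)[OF g kl(2)] by (intro sum.cong refl) (simp add: sum_distrib_right[symmetric] mult.assoc[symmetric])
  also have "\<dots> = (\<Sum>i\<in>I. w l i * (\<Sum>j\<in>I. v i j * \<kappa> (t k j)))"
    by (subst sum.swap) (simp add: sum_distrib_left)
  also have "\<dots> = (\<Sum>i\<in>I. if k = i then w l i else 0)" using eq by (intro sum.cong) auto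
  also have "\<dots> = w l k" using kl goodD(2)[OF g] by simp
  finally show ?thesis .
qed

text \<open>The conjugate of \<open>w\<close> has the adjoint of \<open>t\<close> as inverse, so the
  inner \<kappa> produces adjoints of entries of \<open>t\<close>; after the star, the outer
  \<kappa> returns these entries to \<open>w\<close>.\<close>

lemma \<kappa>_star_\<kappa>_star:
  assumes "a \<in> A0"
  shows "\<kappa> (star (\<kappa> (star a))) = a"
proof -
  obtain I :: "nat set" and w v t f where g: "good I w v t"
    and a: "a = (\<Sum>i\<in>I. \<Sum>j\<in>I. f i j *\<^sub>C w i j)"
    using domain[OF assms] unfolding antipode_def by blast
  have "star a = (\<Sum>i\<in>I. \<Sum>j\<in>I. cnj (f i j) *\<^sub>C star (w i j))" by (simp add: a star_sum star_scaleC)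
  then have "\<kappa> (star a) = (\<Sum>i\<in>I. \<Sum>j\<in>I. cnj (f i j) *\<^sub>C star (t j i))"
    using \<kappa>_eq[OF antipodeI[OF good_star[OF g], of "\<lambda>i j. cnj (f i j)"]] by simp
  then have "star (\<kappa> (star a)) = (\<Sum>i\<in>I. \<Sum>j\<in>I. f i j *\<^sub>C t j i)"
    by (simp add: star_sum star_scaleC star_star)
  also have "\<kappa> \<dots> = (\<Sum>i\<in>I. \<Sum>j\<in>I. f i j *\<^sub>C w i j)"
    using transpose_inverse_in_subalgebra[OF g]
    by (simp add: \<kappa>_sum \<kappa>_scale \<kappa>_transpose_inverse[OF g] A0_closed)
  finally show ?thesis by (simp add: a)
qed

end


section \<open>The equivalence\<close>

lemma star_subalgebra_entry_algebra: "star_subalgebra (entry_algebra u)"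
  unfolding entry_algebra_def
  by (rule hull_in) (auto simp: star_subalgebra_def cvec.subspace_def)

lemma entry_in_entry_algebra: "u $ p $ q \<in> entry_algebra u"
  unfolding entry_algebra_def by (rule hull_inc) blast

lemma entry_algebra_minimal:
  "star_subalgebra S \<Longrightarrow> (\<And>p q. u $ p $ q \<in> S) \<Longrightarrow> entry_algebra u \<subseteq> S"
  unfolding entry_algebra_def by (rule hull_minimal) auto

lemma invertible_entries:
  fixes u :: "'a::ring_1^'n^'n"
  assumes "invertible u"
  obtains v where "\<And>i j. (\<Sum>k\<in>UNIV. v i k * u $ k $ j) = (if i = j then 1 else 0)"
    "\<And>i j. (\<Sum>k\<in>UNIV. u $ i $ k * v k j) = (if i = j then 1 else 0)"
proof -
  obtain V where V: "u ** V = mat 1" "V ** u = mat 1" using assms unfolding invertible_def by blast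
  show thesis
  proof (rule that[of "\<lambda>i j. V $ i $ j"])
    show "(\<Sum>k\<in>UNIV. V $ i $ k * u $ k $ j) = (if i = j then 1 else 0)" for i j
      using arg_cong[OF V(2), of "\<lambda>M. M $ i $ j"] by (simp add: matrix_matrix_mult_def mat_def)
    show "(\<Sum>k\<in>UNIV. u $ i $ k * V $ k $ j) = (if i = j then 1 else 0)" for i j
      using arg_cong[OF V(1), of "\<lambda>M. M $ i $ j"] by (simp add: matrix_matrix_mult_def mat_def)
  qed
qed

lemma invertibleI_entries:
  fixes u :: "'a::ring_1^'n^'n"
  assumes "\<And>i j. (\<Sum>k\<in>UNIV. v i k * u $ k $ j) = (if i = j then 1 else 0)"
    "\<And>i j. (\<Sum>k\<in>UNIV. u $ i $ k * v k j) = (if i = j then 1 else 0)"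
  shows "invertible u"
  unfolding invertible_def
  by (intro exI[of _ "\<chi> i j. v i j"]) (simp add: matrix_matrix_mult_def mat_def vec_eq_iff assms)

lemma antipode_if_invertible:
  fixes u :: "'a::unital_cstar_algebra^'n^'n"
    and tens :: "'a \<Rightarrow> 'a \<Rightarrow> 't::unital_cstar_algebra"
  assumes tensor: "minimal_tensor_product tens" and hom: "star_hom \<Phi>"
    and comult: "\<And>p q. \<Phi> (u $ p $ q) = (\<Sum>k\<in>UNIV. tens (u $ p $ k) (u $ k $ q))"
    and inv: "invertible u" "invertible (transpose u)"
  obtains \<kappa> where "\<kappa> \<in> entry_algebra u \<rightarrow> entry_algebra u" "clinear_on (entry_algebra u) \<kappa>"
    "\<And>a b. a \<in> entry_algebra u \<Longrightarrow> b \<in> entry_algebra u \<Longrightarrow> \<kappa> (a * b) = \<kappa> b * \<kappa> a"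
    "\<And>a. a \<in> entry_algebra u \<Longrightarrow> \<kappa> (star (\<kappa> (star a))) = a"
    "\<And>p q. (\<Sum>k\<in>UNIV. \<kappa> (u $ p $ k) * u $ k $ q) = (if p = q then 1 else 0)"
    "\<And>p q. (\<Sum>k\<in>UNIV. u $ p $ k * \<kappa> (u $ k $ q)) = (if p = q then 1 else 0)"
proof -
  obtain v where v: "\<And>i j. (\<Sum>k\<in>UNIV. v i k * u $ k $ j) = (if i = j then 1 else 0)"
    "\<And>i j. (\<Sum>k\<in>UNIV. u $ i $ k * v k j) = (if i = j then 1 else 0)"
    by (rule invertible_entries[OF inv(1)]) blast
  obtain t where t: "\<And>i j. (\<Sum>k\<in>UNIV. t i k * transpose u $ k $ j) = (if i = j then 1 else 0)"
    "\<And>i j. (\<Sum>k\<in>UNIV. transpose u $ i $ k * t k j) = (if i = j then 1 else 0)"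
    by (rule invertible_entries[OF inv(2)]) blast
  interpret min_tensor tens by unfold_locales (rule tensor)
  have mult: "\<Phi> (a * b) = \<Phi> a * \<Phi> b" for a b using hom by (simp add: star_hom_def)
  have "\<Phi> 1 = 1"
  proof -
    fix p :: 'n
    \<comment> \<open>The inverse of \<open>u\<close> is used in both legs to strip
      \<open>\<Phi> (u $ p $ q)\<close> down to 1 \<otimes> 1. Since \<Phi> 1 fixes every value of
      \<Phi> from the left, it fixes X = 1.\<close>
    define X where "X = (\<Sum>q\<in>UNIV. \<Sum>r\<in>UNIV. \<Phi> (u $ p $ q) * (tens 1 (v q r) * tens (v r p) 1))"
    have contract: "(\<Sum>q\<in>UNIV. \<Phi> (u $ p $ q) * tens 1 (v q r)) = tens (u $ p $ r) 1" for r
    proof -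
      have "(\<Sum>q\<in>UNIV. \<Phi> (u $ p $ q) * tens 1 (v q r))
          = (\<Sum>q\<in>UNIV. \<Sum>k\<in>UNIV. tens (u $ p $ k) (u $ k $ q * v q r))"
        by (simp add: comult sum_distrib_right tens_mult)
      also have "\<dots> = (\<Sum>k\<in>UNIV. tens (u $ p $ k) (\<Sum>q\<in>UNIV. u $ k $ q * v q r))"
        by (subst sum.swap) (simp add: tens_simps)
      also have "\<dots> = (\<Sum>k\<in>UNIV. if k = r then tens (u $ p $ k) 1 else 0)"
        by (intro sum.cong) (auto simp: v tens_simps)
      finally show ?thesis by simp
    qed
    have "X = (\<Sum>r\<in>UNIV. (\<Sum>q\<in>UNIV. \<Phi> (u $ p $ q) * tens 1 (v q r)) * tens (v r p) 1)"
      unfolding X_def by (subst sum.swap) (simp only: sum_distrib_right mult.assoc)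
    also have "\<dots> = (\<Sum>r\<in>UNIV. tens (u $ p $ r) 1 * tens (v r p) 1)"
      by (simp only: contract)
    also have "\<dots> = tens (\<Sum>r\<in>UNIV. u $ p $ r * v r p) 1" by (simp add: tens_mult tens_simps)
    finally have X: "X = 1" by (simp add: v tens_one)
    have "\<Phi> 1 * X = X"
      by (simp add: X_def sum_distrib_left mult.assoc[symmetric] mult[symmetric])
    then show ?thesis by (simp add: X)
  qed
  then interpret comultiplication_subalgebra tens \<Phi> "entry_algebra u"
    by unfold_locales (rule hom star_subalgebra_entry_algebra | assumption)+
  have g: "good UNIV (\<lambda>p q. u $ p $ q) v t"
    unfolding good_def corep_def using v t by (auto simp: comult transpose_def entry_in_entry_algebra)
  have dom: "\<exists>b. antipode a b" if "a \<in> entry_algebra u" for a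
  proof -
    have "entry_algebra u \<subseteq> {a. \<exists>b. antipode a b}"
      by (rule entry_algebra_minimal[OF star_subalgebra_antipode_domain[OF antipode_zero]])
        (use antipode_entry[OF g] in blast)
    then show ?thesis using that by blast
  qed
  obtain h where h: "state h" "\<And>a b \<rho>. antipode a b \<Longrightarrow> state \<rho> \<Longrightarrow> conv h \<rho> a = h a"
    by (rule invariant_on_antipode_domain) blast
  interpret haar_comultiplication tens \<Phi> "entry_algebra u" h
    by unfold_locales (use h dom in blast)+
  have \<kappa>u: "\<kappa> (u $ p $ q) = v p q" for p q
    by (rule \<kappa>_eq) (rule antipode_entry[OF g], simp_all)
  show thesis
  proof (rule that[of \<kappa>])
    show "\<kappa> \<in> entry_algebra u \<rightarrow> entry_algebra u" using \<kappa>_closed by blast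
    show "clinear_on (entry_algebra u) \<kappa>" by (simp add: clinear_on_def \<kappa>_add \<kappa>_scale)
  qed (simp_all add: \<kappa>u v \<kappa>_mult \<kappa>_star_\<kappa>_star)
qed

lemma invertible_if_antipode:
  fixes u :: "'a::unital_cstar_algebra^'n^'n"
  assumes closed: "\<kappa> \<in> entry_algebra u \<rightarrow> entry_algebra u" and lin: "clinear_on (entry_algebra u) \<kappa>"
    and anti: "\<And>a b. a \<in> entry_algebra u \<Longrightarrow> b \<in> entry_algebra u \<Longrightarrow> \<kappa> (a * b) = \<kappa> b * \<kappa> a"
    and invol: "\<And>a. a \<in> entry_algebra u \<Longrightarrow> \<kappa> (star (\<kappa> (star a))) = a"
    and left: "\<And>p q. (\<Sum>k\<in>UNIV. \<kappa> (u $ p $ k) * u $ k $ q) = (if p = q then 1 else 0)"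
    and right: "\<And>p q. (\<Sum>k\<in>UNIV. u $ p $ k * \<kappa> (u $ k $ q)) = (if p = q then 1 else 0)"
  shows "invertible u" "invertible (transpose u)"
proof -
  let ?A = "entry_algebra u"
  have A: "star_subalgebra ?A" by (rule star_subalgebra_entry_algebra)
  have A_simps: "0 \<in> ?A" "a \<in> ?A \<Longrightarrow> b \<in> ?A \<Longrightarrow> a + b \<in> ?A" "a \<in> ?A \<Longrightarrow> b \<in> ?A \<Longrightarrow> a * b \<in> ?A"
    "a \<in> ?A \<Longrightarrow> star a \<in> ?A" "(\<And>i. i \<in> S \<Longrightarrow> f i \<in> ?A) \<Longrightarrow> sum f S \<in> ?A" for a b f and S :: "'n set"
    using A by (auto simp: star_subalgebra_def cvec.subspace_0 cvec.subspace_add cvec.subspace_sum)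
  note entry = entry_in_entry_algebra
  have \<kappa>A: "a \<in> ?A \<Longrightarrow> \<kappa> a \<in> ?A" for a using closed by blast
  show "invertible u" by (rule invertibleI_entries[of "\<lambda>p q. \<kappa> (u $ p $ q)"]) (simp_all add: left right)
  text \<open>\<open>\<kappa>'\<close> is the inverse of \<open>\<kappa>\<close>; applying it to the two relations inverts the transpose.\<close>
  define \<kappa>' where "\<kappa>' a = star (\<kappa> (star a))" for a
  have \<kappa>'_add: "\<kappa>' (a + b) = \<kappa>' a + \<kappa>' b" if "a \<in> ?A" "b \<in> ?A" for a b
    using that lin A_simps(4) by (simp add: \<kappa>'_def clinear_on_def star_add)
  have \<kappa>'_mult: "\<kappa>' (a * b) = \<kappa>' b * \<kappa>' a" if "a \<in> ?A" "b \<in> ?A" for a b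
    using that A_simps(4) by (simp add: \<kappa>'_def star_mult anti)
  have \<kappa>'_0: "\<kappa>' 0 = 0" using \<kappa>'_add[of 0 0] A_simps(1) by simp
  have \<kappa>'_sum: "\<kappa>' (sum f S) = (\<Sum>i\<in>S. \<kappa>' (f i))" if "\<And>i. i \<in> S \<Longrightarrow> f i \<in> ?A" for f and S :: "'n set"
    using that by (induction S rule: infinite_finite_induct) (auto simp: \<kappa>'_0 \<kappa>'_add A_simps)
  have \<kappa>'\<kappa>: "\<kappa>' (\<kappa> a) = a" if "a \<in> ?A" for a
    using invol[OF A_simps(4)[OF that]] by (simp add: \<kappa>'_def star_star star_eq_iff)
  have one: "1 \<in> ?A"
  proof -
    fix p :: 'n
    have "(\<Sum>k\<in>UNIV. \<kappa> (u $ p $ k) * u $ k $ p) \<in> ?A" by (intro A_simps(5) A_simps(3) \<kappa>A entry)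
    then show ?thesis by (simp add: left)
  qed
  \<comment> \<open>Antimultiplicativity of \<kappa>' on the product of 1 and \<kappa> 1, together
    with \<kappa>' (\<kappa> 1) = 1.\<close>
  have \<kappa>'_1: "\<kappa>' 1 = 1"
    using \<kappa>'_mult[OF one \<kappa>A[OF one]] by (simp add: \<kappa>'\<kappa>[OF one])
  have "(\<Sum>k\<in>UNIV. \<kappa>' (u $ k $ q) * u $ p $ k) = (if p = q then 1 else 0)" for p q
    using arg_cong[OF left[of p q], of \<kappa>']
    by (simp add: \<kappa>'_sum A_simps \<kappa>A entry \<kappa>'_mult \<kappa>'\<kappa> \<kappa>'_0 \<kappa>'_1 split: if_splits)
  moreover have "(\<Sum>k\<in>UNIV. u $ k $ q * \<kappa>' (u $ p $ k)) = (if p = q then 1 else 0)" for p q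
    using arg_cong[OF right[of p q], of \<kappa>']
    by (simp add: \<kappa>'_sum A_simps \<kappa>A entry \<kappa>'_mult \<kappa>'\<kappa> \<kappa>'_0 \<kappa>'_1 split: if_splits)
  ultimately show "invertible (transpose u)"
    \<comment> \<open>The reversal of factors under \<kappa>' moves the summation index to the first
      place of one \<open>u\<close> and the second of the other, so the inverse of the transpose has
      its indices swapped.\<close>
    by (intro invertibleI_entries[of "\<lambda>i j. \<kappa>' (u $ j $ i)"]) (auto simp: transpose_def)
qed

theorem mainTheorem8:
  fixes u :: "'a::unital_cstar_algebra^'n^'n"
    and tens :: "'a \<Rightarrow> 'a \<Rightarrow> 't::unital_cstar_algebra"
  assumes tensor: "minimal_tensor_product tens"
    and dense: "closure (entry_algebra u) = UNIV"
    and comult: "\<exists>\<Phi> :: 'a \<Rightarrow> 't. star_hom \<Phi> \<and>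
      (\<forall>p q. \<Phi> (u $ p $ q) = (\<Sum>k\<in>UNIV. tens (u $ p $ k) (u $ k $ q)))"
  shows "(\<exists>\<kappa> :: 'a \<Rightarrow> 'a.
            \<kappa> \<in> entry_algebra u \<rightarrow> entry_algebra u \<and>
            clinear_on (entry_algebra u) \<kappa> \<and>
            (\<forall>a \<in> entry_algebra u. \<forall>b \<in> entry_algebra u. \<kappa> (a * b) = \<kappa> b * \<kappa> a) \<and>
            (\<forall>a \<in> entry_algebra u. \<kappa> (star (\<kappa> (star a))) = a) \<and>
            (\<forall>p q. (\<Sum>k\<in>UNIV. \<kappa> (u $ p $ k) * u $ k $ q) = (if p = q then 1 else 0)) \<and>
            (\<forall>p q. (\<Sum>k\<in>UNIV. u $ p $ k * \<kappa> (u $ k $ q)) = (if p = q then 1 else 0)))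
         \<longleftrightarrow> invertible u \<and> invertible (transpose u)"
  (is "(\<exists>\<kappa>. ?antipode \<kappa>) \<longleftrightarrow> _")
proof
  assume "\<exists>\<kappa>. ?antipode \<kappa>"
  then obtain \<kappa> where "?antipode \<kappa>" ..
  then show "invertible u \<and> invertible (transpose u)"
    using invertible_if_antipode[of \<kappa> u] by blast
next
  assume inv: "invertible u \<and> invertible (transpose u)"
  obtain \<Phi> :: "'a \<Rightarrow> 't" where \<Phi>: "star_hom \<Phi>"
    "\<And>p q. \<Phi> (u $ p $ q) = (\<Sum>k\<in>UNIV. tens (u $ p $ k) (u $ k $ q))"
    using comult by blast
  show "\<exists>\<kappa>. ?antipode \<kappa>"
    by (rule antipode_if_invertible[OF tensor \<Phi>]) (use inv in blast)+
qed

end
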